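(* Let $X=(X_n)_{n\in\mathbb{Z}}$ be an i.i.d. sequence of random variables with values in $\{-1,0,1,2,\dots\}$ with $0<\mathbb{P}[X_0=-1]\le1$ and $0<\mathbb{E}[X_0]\le\infty$. Let $S_0=0$, $S_n=\sum_{k=0}^{n-1}X_k$ for $n>0$, let $\eta_{-1}=\inf\{n\ge0:S_n=-1\}$ (with $\inf\emptyset=\infty$) and $c=\mathbb{P}[\eta_{-1}<\infty]$. Define distributions on $\{0,1,2,\dots\}$ by $\tilde\pi(k)=c^{k-1}\mathbb{P}[X_0=k-1]$ and $\bar\pi(k)=\mathbb{P}[X_0\ge k]c^k$. Let $[\mathbf{T},0]$ be the connected component of $0$ in the record graph of $X$, rooted at $0$, viewed as an ordered Family Tree with children ordered by the order of $\mathbb{Z}$. Then $[\mathbf{T},0]$ has the distribution of the unimodularised ECS ordered bi-variate Eternal Kesten Tree $EKT(\bar\pi,\tilde\pi)$.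
   Context: For a sequence $x=(x_n)_{n\in\mathbb{Z}}$ write $y(j,k)=\sum_{l=j}^{k-1}x_l$ for $j<k$. The record map is $R_x(i)=\inf\{n>i: y(i,n)\ge0\}$ if this set is nonempty, and $R_x(i)=i$ otherwise. The record graph has vertex set $\mathbb{Z}$ and a directed edge $i\to R_x(i)$ (child to parent) whenever $R_x(i)\ne i$; components are taken in the undirected sense. A Family Tree is a directed tree in which every vertex has out-degree at most one; it is ordered if the children of every vertex are totally ordered. $GW(\beta)$ denotes an ordered Galton-Watson tree with offspring distribution $\beta$. Unimodularised ECS ordered $EKT(\alpha,\beta)$ (for $\alpha,\beta$ on $\{0,1,\dots\}$ with $m(\alpha)<\infty$, $m(\beta)<1$): let $([\mathbf{T}_i,\mathbf{o}_i])_{i\in\mathbb{Z}}$ be i.i.d. ordered Family Trees, where in each $\mathbf{T}_i$ the root $\mathbf{o}_i$ has an $\alpha$-distributed number of children whose descendant trees are i.i.d. $GW(\beta)$, independent of that number. Form the Eternal Family Tree $\mathbf{T}'$ by adding the directed edges $\mathbf{o}_i\to\mathbf{o}_{i+1}$ for all $i$; order it so that $\mathbf{o}_i$ is the smallest among the children of $\mathbf{o}_{i+1}$ and the remaining children of $\mathbf{o}_{i+1}$ (those in $\mathbf{T}_{i+1}$) are in uniform random order (ECS order). The unimodularised version is the law $\mathcal{P}'$ on rooted ordered trees given by $\mathcal{P}'[A]=\mathbb{E}\big[\sum_{v\in V(\mathbf{T}_0)}\mathbf{1}_A([\mathbf{T}',v])\big]/\mathbb{E}[\#V(\mathbf{T}_0)]$.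 *)

theory Defs
  imports "HOL-Probability.Probability"
begin

text \<open>An ordered Family Tree is given by a vertex set V, a parent map par (par v = None:
no outgoing edge), and a strict order lt used to compare siblings.
A rooted ordered Family Tree [T,v] is encoded up to isomorphism by
(i) the set of valid addresses (k,w): go up k steps from the root, then down along the
child indices w (child number j = the child having exactly j smaller siblings), and
(ii) for each k, the index of the k-th ancestor among the children of the (k+1)-th ancestor.\<close>

type_synonym tcode = "(nat \<times> nat list \<Rightarrow> bool) \<times> (nat \<Rightarrow> nat option)"

definition code_space :: "tcode measure" where
  "code_space = (PiM UNIV (\<lambda>_. count_space UNIV)) \<Otimes>\<^sub>M (PiM UNIV (\<lambda>_. count_space UNIV))"

definition children :: "'v set \<Rightarrow> ('v \<Rightarrow> 'v option) \<Rightarrow> 'v \<Rightarrow> 'v set" where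
  "children V par x = {c \<in> V. par c = Some x}"

definition sib_pos :: "'v set \<Rightarrow> ('v \<Rightarrow> 'v option) \<Rightarrow> ('v \<Rightarrow> 'v \<Rightarrow> bool) \<Rightarrow> 'v \<Rightarrow> 'v \<Rightarrow> nat option" where
  "sib_pos V par lt x c =
     (if c \<in> children V par x \<and> finite {c' \<in> children V par x. lt c' c}
      then Some (card {c' \<in> children V par x. lt c' c}) else None)"

definition child_at :: "'v set \<Rightarrow> ('v \<Rightarrow> 'v option) \<Rightarrow> ('v \<Rightarrow> 'v \<Rightarrow> bool) \<Rightarrow> 'v \<Rightarrow> nat \<Rightarrow> 'v option" where
  "child_at V par lt x j =
     (if \<exists>c. sib_pos V par lt x c = Some j
      then Some (THE c. sib_pos V par lt x c = Some j) else None)"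

fun anc :: "('v \<Rightarrow> 'v option) \<Rightarrow> 'v \<Rightarrow> nat \<Rightarrow> 'v option" where
  "anc par v 0 = Some v"
| "anc par v (Suc k) = Option.bind (anc par v k) par"

fun down :: "'v set \<Rightarrow> ('v \<Rightarrow> 'v option) \<Rightarrow> ('v \<Rightarrow> 'v \<Rightarrow> bool) \<Rightarrow> 'v \<Rightarrow> nat list \<Rightarrow> 'v option" where
  "down V par lt x [] = Some x"
| "down V par lt x (j # w) = Option.bind (child_at V par lt x j) (\<lambda>c. down V par lt c w)"

definition tree_code :: "'v set \<Rightarrow> ('v \<Rightarrow> 'v option) \<Rightarrow> ('v \<Rightarrow> 'v \<Rightarrow> bool) \<Rightarrow> 'v \<Rightarrow> tcode" where
  "tree_code V par lt v =
     ((\<lambda>(k, w). Option.bind (anc par v k) (\<lambda>a. down V par lt a w) \<noteq> None),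
      (\<lambda>k. Option.bind (anc par v k) (\<lambda>a. Option.bind (par a) (\<lambda>b. sib_pos V par lt b a))))"

definition ysum :: "(int \<Rightarrow> int) \<Rightarrow> int \<Rightarrow> int \<Rightarrow> int" where
  "ysum x j k = (\<Sum>l\<in>{j..<k}. x l)"

definition record_map :: "(int \<Rightarrow> int) \<Rightarrow> int \<Rightarrow> int" where
  "record_map x i =
     (if \<exists>n>i. ysum x i n \<ge> 0 then (LEAST n. n > i \<and> ysum x i n \<ge> 0) else i)"

definition record_par :: "(int \<Rightarrow> int) \<Rightarrow> int \<Rightarrow> int option" where
  "record_par x i = (if record_map x i = i then None else Some (record_map x i))"

definition record_code :: "(int \<Rightarrow> int) \<Rightarrow> tcode" where
  "record_code x = tree_code UNIV (record_par x) (<) 0"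

definition walk_S :: "(int \<Rightarrow> 'a \<Rightarrow> int) \<Rightarrow> nat \<Rightarrow> 'a \<Rightarrow> int" where
  "walk_S X n \<omega> = (\<Sum>k<n. X (int k) \<omega>)"

definition hit_c :: "'a measure \<Rightarrow> (int \<Rightarrow> 'a \<Rightarrow> int) \<Rightarrow> real" where
  "hit_c M X = measure M {\<omega> \<in> space M. \<exists>n. walk_S X n \<omega> = -1}"

definition tilde_pi :: "'a measure \<Rightarrow> (int \<Rightarrow> 'a \<Rightarrow> int) \<Rightarrow> nat \<Rightarrow> real" where
  "tilde_pi M X k = hit_c M X powi (int k - 1) * measure M {\<omega> \<in> space M. X 0 \<omega> = int k - 1}"

definition bar_pi :: "'a measure \<Rightarrow> (int \<Rightarrow> 'a \<Rightarrow> int) \<Rightarrow> nat \<Rightarrow> real" where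
  "bar_pi M X k = measure M {\<omega> \<in> space M. X 0 \<omega> \<ge> int k} * hit_c M X ^ k"

text \<open>Randomness: for each i, (N_i, sigma_i) with N_i ~ alpha the number of children of o_i in T_i
and sigma_i a uniform permutation of {..<N_i} (the ECS order: child j of o_i in T_i gets
position 1 + sigma_i j among the children of o_i, position 0 being o_(i-1));
for each (i,p), Xi(i,p) ~ beta the offspring number of vertex p of T_i (p nonempty).
Vertex (i,u) is the vertex of T_i with Ulam-Harris label u.\<close>

type_synonym ekt_omega = "(int \<Rightarrow> nat \<times> (nat \<Rightarrow> nat)) \<times> (int \<times> nat list \<Rightarrow> nat)"

definition root_pmf :: "nat pmf \<Rightarrow> (nat \<times> (nat \<Rightarrow> nat)) pmf" where
  "root_pmf \<alpha> = bind_pmf \<alpha> (\<lambda>n. map_pmf (\<lambda>\<sigma>. (n, \<sigma>)) (pmf_of_set {\<sigma>. \<sigma> permutes {..<n}}))"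

definition ekt_space :: "nat pmf \<Rightarrow> nat pmf \<Rightarrow> ekt_omega measure" where
  "ekt_space \<alpha> \<beta> = (PiM UNIV (\<lambda>_::int. measure_pmf (root_pmf \<alpha>)))
                     \<Otimes>\<^sub>M (PiM UNIV (\<lambda>_::int \<times> nat list. measure_pmf \<beta>))"

fun gw_ok :: "(int \<times> nat list \<Rightarrow> nat) \<Rightarrow> int \<Rightarrow> nat list \<Rightarrow> nat list \<Rightarrow> bool" where
  "gw_ok Xi i p [] = True"
| "gw_ok Xi i p (j # w) = (j < Xi (i, p) \<and> gw_ok Xi i (p @ [j]) w)"

definition ekt_vertex :: "ekt_omega \<Rightarrow> int \<times> nat list \<Rightarrow> bool" where
  "ekt_vertex \<omega> v =
     (case v of (i, []) \<Rightarrow> True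
              | (i, j # w) \<Rightarrow> j < fst (fst \<omega> i) \<and> gw_ok (snd \<omega>) i [j] w)"

definition ekt_par :: "int \<times> nat list \<Rightarrow> (int \<times> nat list) option" where
  "ekt_par v = (if snd v = [] then Some (fst v + 1, []) else Some (fst v, butlast (snd v)))"

definition ekt_key :: "ekt_omega \<Rightarrow> int \<times> nat list \<Rightarrow> nat" where
  "ekt_key \<omega> v =
     (if snd v = [] then 0
      else if length (snd v) = 1 then Suc (snd (fst \<omega> (fst v)) (hd (snd v)))
      else last (snd v))"

definition ekt_code :: "ekt_omega \<Rightarrow> int \<times> nat list \<Rightarrow> tcode" where
  "ekt_code \<omega> v = tree_code {v. ekt_vertex \<omega> v} ekt_par (\<lambda>a b. ekt_key \<omega> a < ekt_key \<omega> b) v"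

definition unimod_ekt_prob :: "nat pmf \<Rightarrow> nat pmf \<Rightarrow> tcode set \<Rightarrow> ennreal" where
  "unimod_ekt_prob \<alpha> \<beta> A =
     (\<integral>\<^sup>+\<omega>. (\<integral>\<^sup>+u. indicator A (ekt_code \<omega> (0, u)) \<partial>count_space {u. ekt_vertex \<omega> (0, u)}) \<partial>ekt_space \<alpha> \<beta>)
     / (\<integral>\<^sup>+\<omega>. emeasure (count_space UNIV) {u. ekt_vertex \<omega> (0, u)} \<partial>ekt_space \<alpha> \<beta>)"

end

theory Submission
  imports Defs
begin

text \<open>Call \<open>a\<close> a left record when \<open>y(n, a) \<ge> 0\<close> for all \<open>n < a\<close>; these are the vertices
  \<open>o_i\<close> of the spine, and the parent of a left record is the next left record. Reading the increments
  from left to right between two consecutive left records spells the bush of \<open>o_i\<close> in postorder: the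
  postorder words of the subtrees of its children other than \<open>o_(i-1)\<close>, followed by one letter that
  only has to be at least the number of these children. As the reflected walk never hits \<open>-1\<close>
  with probability \<open>1 - c\<close>, a prescribed finite window of bushes with a prescribed position of
  the vertex \<open>0\<close> in the central one has probability \<open>1 - c\<close> times the product of the bush
  probabilities under \<open>EKT\<close>, which is the size-biasing of the unimodularisation. Different windows
  are disjoint events, and their total mass is \<open>1 - c\<close> times the mean bush size, which
  the fixed-point equation for \<open>c\<close> shows to be \<open>1\<close>; hence almost surely \<open>X\<close> decomposes into
  bushes, and no law of large numbers is needed.\<close>

section \<open>Plane trees and their postorder words\<close>

text \<open>Both offspring laws come from the weights of words. A vertex with k children contributes
  the increment k - 1, and these increments add up to -1 over a finite tree. Tilting the law of
  \<open>X 0 + 1\<close> by c^(k-1) therefore divides the weight of every finite tree by the same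
  number c, the total weight of all finite trees, and turns these weights into a probability: this
  is tilde-pi. In a bush whose root has k subtrees, untilting the subtrees yields c^k and the last
  letter yields the probability of X_0 >= k; the product is bar-pi(k). What remains is the factor 1
  - c for a left record at a given place, which has to be the reciprocal of the mean bush size.
  Averaging a partial summation of geometric series gives (1 - c) m(bar-pi) + c m(tilde-pi) = c, and
  this identity settles it. Finite plane trees are countable, whereas two-sided sequences of them
  are not. Hence all probabilities are computed for finite windows, as countable sums over disjoint
  patterns, and only uniqueness of the decomposition lets the windows be glued.\<close>

datatype ptree = Node (kids: "ptree list")

instance ptree :: countable
  by countable_datatype

fun post_word :: "ptree \<Rightarrow> nat list" where
  "post_word (Node ts) = concat (map post_word ts) @ [length ts]"

abbreviation forest_word :: "ptree list \<Rightarrow> nat list" where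
  "forest_word ts \<equiv> concat (map post_word ts)"

fun is_path :: "ptree \<Rightarrow> nat list \<Rightarrow> bool" where
  "is_path t [] = True"
| "is_path t (j # p) = (j < length (kids t) \<and> is_path (kids t ! j) p)"

fun arity :: "ptree \<Rightarrow> nat list \<Rightarrow> nat" where
  "arity t [] = length (kids t)"
| "arity t (j # p) = arity (kids t ! j) p"

text \<open>Positions count from 1: in a bush that starts at \<open>a\<close> the vertex
  \<open>p\<close> sits at \<open>a + int (pos t p)\<close>, one place to the right of the letter
  that carries its number of children.\<close>

fun pos :: "ptree \<Rightarrow> nat list \<Rightarrow> nat" where
  "pos t [] = length (post_word t)"
| "pos t (j # p) = length (forest_word (take j (kids t))) + pos (kids t ! j) p"

lemma post_word_kids: "post_word t = forest_word (kids t) @ [length (kids t)]"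
  by (cases t) simp

lemma length_post_word_pos: "0 < length (post_word t)"
  by (simp add: post_word_kids)

lemma length_forest_word_take_mono:
  "i \<le> j \<Longrightarrow> length (forest_word (take i ts)) \<le> length (forest_word (take j ts))"
proof -
  assume "i \<le> j"
  then have "take j ts = take i ts @ take (j - i) (drop i ts)"
    using take_add[of i "j - i" ts] by simp
  then show ?thesis by simp
qed

lemma length_forest_word_take_le: "length (forest_word (take i ts)) \<le> length (forest_word ts)"
proof -
  have "length (forest_word ts) = length (forest_word (take i ts @ drop i ts))" by simp
  then show ?thesis by (simp only: map_append concat_append length_append)
qed

lemma forest_word_take_Suc: "j < length ts \<Longrightarrow> forest_word (take (Suc j) ts) = forest_word (take j ts) @ post_word (ts ! j)"
  by (simp add: take_Suc_conv_app_nth)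

lemma pos_bounds: "is_path t p \<Longrightarrow> 0 < pos t p \<and> pos t p \<le> length (post_word t)"
proof (induction p arbitrary: t)
  case Nil
  then show ?case using length_post_word_pos[of t] by simp
next
  case (Cons j p)
  then have j: "j < length (kids t)" and "is_path (kids t ! j) p" by auto
  then have "0 < pos (kids t ! j) p" "pos (kids t ! j) p \<le> length (post_word (kids t ! j))"
    using Cons.IH by blast+
  moreover have "length (forest_word (take j (kids t))) + length (post_word (kids t ! j)) \<le> length (forest_word (kids t))"
    using forest_word_take_Suc[OF j] length_forest_word_take_le[of "Suc j" "kids t"] by simp
  ultimately show ?case by (simp add: post_word_kids[of t])
qed

lemma pos_Cons_bounds:
  assumes "is_path t (j # p)"
  shows "length (forest_word (take j (kids t))) < pos t (j # p)"
    and "pos t (j # p) \<le> length (forest_word (take (Suc j) (kids t)))"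
    and "pos t (j # p) < length (post_word t)"
proof -
  from assms have j: "j < length (kids t)" and "is_path (kids t ! j) p" by auto
  then have *: "0 < pos (kids t ! j) p" "pos (kids t ! j) p \<le> length (post_word (kids t ! j))"
    using pos_bounds by blast+
  then show "length (forest_word (take j (kids t))) < pos t (j # p)"
    and 2: "pos t (j # p) \<le> length (forest_word (take (Suc j) (kids t)))"
    using forest_word_take_Suc[OF j] by auto
  have "length (forest_word (take (Suc j) (kids t))) \<le> length (forest_word (kids t))"
    by (rule length_forest_word_take_le)
  with 2 show "pos t (j # p) < length (post_word t)" by (simp add: post_word_kids[of t])
qed

text \<open>The subtrees of the children occupy disjoint consecutive segments of the word, and the
  root comes after all of them.\<close>

lemma pos_inj: "is_path t p \<Longrightarrow> is_path t q \<Longrightarrow> pos t p = pos t q \<Longrightarrow> p = q"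
proof (induction p arbitrary: t q)
  case Nil
  show ?case
  proof (cases q)
    case (Cons i r)
    then show ?thesis using Nil.prems pos_Cons_bounds(3)[of t i r] by simp
  qed simp
next
  case (Cons j p)
  show ?case
  proof (cases q)
    case Nil
    then show ?thesis using Cons.prems pos_Cons_bounds(3)[of t j p] by simp
  next
    case q: (Cons i r)
    have "j = i"
    proof (rule ccontr)
      assume "j \<noteq> i"
      then consider "Suc j \<le> i" | "Suc i \<le> j" by linarith
      then show False
      proof cases
        case 1
        then show False
          using length_forest_word_take_mono[OF 1, of "kids t"] pos_Cons_bounds[of t j p] pos_Cons_bounds[of t i r]
            Cons.prems q by simp
      next
        case 2
        then show False
          using length_forest_word_take_mono[OF 2, of "kids t"] pos_Cons_bounds[of t j p] pos_Cons_bounds[of t i r]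
            Cons.prems q by simp
      qed
    qed
    then show ?thesis using Cons q by auto
  qed
qed

lemma pos_surj: "0 < n \<Longrightarrow> n \<le> length (post_word t) \<Longrightarrow> \<exists>p. is_path t p \<and> pos t p = n"
proof (induction t arbitrary: n)
  case (Node ts)
  show ?case
  proof (cases "n = length (post_word (Node ts))")
    case True
    then show ?thesis by (intro exI[of _ "[]"]) simp
  next
    case False
    with Node.prems have n: "n \<le> length (forest_word ts)" by simp
    \<comment> \<open>The child whose segment contains the letter number \<open>n\<close>. As
      positions count from 1, segments are open on the left and closed on the right.\<close>
    define j where "j = (LEAST j. n \<le> length (forest_word (take (Suc j) ts)))"
    have ex: "n \<le> length (forest_word (take (Suc (length ts)) ts))" using n by simp
    have le: "n \<le> length (forest_word (take (Suc j) ts))"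
      unfolding j_def by (rule LeastI[where P = "\<lambda>j. n \<le> length (forest_word (take (Suc j) ts))", OF ex])
    have gt: "length (forest_word (take j ts)) < n"
    proof (cases j)
      case 0
      then show ?thesis using Node.prems by simp
    next
      case (Suc i)
      then have "\<not> n \<le> length (forest_word (take (Suc i) ts))"
        unfolding j_def by (intro not_less_Least[where P = "\<lambda>j. n \<le> length (forest_word (take (Suc j) ts))"]) simp
      then show ?thesis using Suc by simp
    qed
    have j: "j < length ts"
    proof (rule ccontr)
      assume "\<not> j < length ts"
      then show False using gt n by simp
    qed
    have "n - length (forest_word (take j ts)) \<le> length (post_word (ts ! j))" "0 < n - length (forest_word (take j ts))"
      using le gt unfolding forest_word_take_Suc[OF j] length_append by linarith+
    then obtain p where "is_path (ts ! j) p" "pos (ts ! j) p = n - length (forest_word (take j ts))"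
      using Node.IH[of "ts ! j" "n - length (forest_word (take j ts))"] j by auto
    then show ?thesis using j gt by (intro exI[of _ "j # p"]) auto
  qed
qed

lemma pos_bij: "bij_betw (pos t) {p. is_path t p} {0<..length (post_word t)}"
  unfolding bij_betw_def
proof
  show "inj_on (pos t) {p. is_path t p}" by (auto simp: inj_on_def dest: pos_inj)
  show "pos t ` {p. is_path t p} = {0<..length (post_word t)}"
  proof (intro equalityI subsetI)
    fix n assume "n \<in> {0<..length (post_word t)}"
    then obtain p where "is_path t p" "pos t p = n" using pos_surj[of n t] by auto
    then show "n \<in> pos t ` {p. is_path t p}" by blast
  qed (use pos_bounds in auto)
qed

lemma finite_paths [simp]: "finite {p. is_path t p}"
  using bij_betw_finite[OF pos_bij] by blast

lemma card_paths: "card {p. is_path t p} = length (post_word t)"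
  using bij_betw_same_card[OF pos_bij, of t] by simp

lemma paths_eq: "{p. is_path t p} = insert [] (\<Union>j<length (kids t). (#) j ` {p. is_path (kids t ! j) p})"
proof -
  have "is_path t p \<longleftrightarrow> p \<in> insert [] (\<Union>j<length (kids t). (#) j ` {p. is_path (kids t ! j) p})" for p
    by (cases p) auto
  then show ?thesis by blast
qed

lemma is_path_append: "is_path t (p @ q) \<Longrightarrow> is_path t p"
  by (induction p arbitrary: t) auto

lemma is_path_snoc: "is_path t (p @ [j]) \<longleftrightarrow> is_path t p \<and> j < arity t p"
  by (induction p arbitrary: t) auto

text \<open>Postorder visits siblings from left to right, so the order of the integers induces the
  plane order on the children inside a bush.\<close>

lemma pos_snoc_less:
  "is_path t (p @ [i]) \<Longrightarrow> is_path t (p @ [j]) \<Longrightarrow> i < j \<Longrightarrow> pos t (p @ [i]) < pos t (p @ [j])"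
proof (induction p arbitrary: t)
  case Nil
  have "pos t [i] \<le> length (forest_word (take (Suc i) (kids t)))"
    using Nil by (intro pos_Cons_bounds) simp
  also have "\<dots> \<le> length (forest_word (take j (kids t)))"
    using Nil by (intro length_forest_word_take_mono) simp
  also have "\<dots> < pos t [j]"
    using Nil by (intro pos_Cons_bounds) simp
  finally show ?case by simp
next
  case (Cons a p)
  then show ?case by auto
qed

section \<open>Words spelled by integer sequences\<close>

text \<open>A letter is a set of admissible increments, since the last letter of a bush is bounded
  below but not prescribed.\<close>

fun spells :: "(int \<Rightarrow> int) \<Rightarrow> int \<Rightarrow> int set list \<Rightarrow> bool" where
  "spells x a [] = True"
| "spells x a (d # ds) = (x a \<in> d \<and> spells x (a + 1) ds)"

lemma spells_append:
  "spells x a (ds @ es) \<longleftrightarrow> spells x a ds \<and> spells x (a + int (length ds)) es"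
  by (induction ds arbitrary: a) (auto simp: algebra_simps)

lemma spells_iff: "spells x a ds \<longleftrightarrow> (\<forall>k<length ds. x (a + int k) \<in> ds ! k)"
proof (induction ds arbitrary: a)
  case (Cons d ds)
  show ?case unfolding length_Cons All_less_Suc2 spells.simps Cons by (simp add: algebra_simps)
qed simp

definition tree_pattern :: "ptree \<Rightarrow> int set list" where
  "tree_pattern t = map (\<lambda>k. {int k - 1}) (post_word t)"

definition forest_pattern :: "ptree list \<Rightarrow> int set list" where
  "forest_pattern ts = map (\<lambda>k. {int k - 1}) (forest_word ts)"

text \<open>The bush in \<open>[a, b)\<close> has vertex set \<open>(a, b]\<close>, and the letter at \<open>b - 1\<close> belongs to
  its root \<open>b\<close>. That root also has the child \<open>a\<close> outside the bush, and it is a left record as soon as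
  the letter leaves room for it, so only a lower bound is prescribed.\<close>

definition bush_pattern :: "ptree \<Rightarrow> int set list" where
  "bush_pattern t = forest_pattern (kids t) @ [{int (length (kids t))..}]"

lemma length_tree_pattern [simp]: "length (tree_pattern t) = length (post_word t)"
  by (simp add: tree_pattern_def)

lemma length_forest_pattern [simp]: "length (forest_pattern ts) = length (forest_word ts)"
  by (simp only: forest_pattern_def length_map)

lemma length_bush_pattern [simp]: "length (bush_pattern t) = length (post_word t)"
  by (simp add: bush_pattern_def post_word_kids)

lemma forest_pattern_Nil [simp]: "forest_pattern [] = []"
  by (simp add: forest_pattern_def)

lemma forest_pattern_append [simp]: "forest_pattern (ts @ us) = forest_pattern ts @ forest_pattern us"
  by (simp add: forest_pattern_def)

lemma forest_pattern_Cons [simp]: "forest_pattern (t # us) = tree_pattern t @ forest_pattern us"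
  by (simp add: forest_pattern_def tree_pattern_def)

lemma tree_pattern_kids: "tree_pattern t = forest_pattern (kids t) @ [{int (length (kids t)) - 1}]"
  by (simp add: tree_pattern_def forest_pattern_def post_word_kids)

lemma ysum_same [simp]: "ysum x a a = 0"
  by (simp add: ysum_def)

lemma ysum_add: "a \<le> b \<Longrightarrow> b \<le> c \<Longrightarrow> ysum x a b + ysum x b c = ysum x a c"
  unfolding ysum_def
  by (subst sum.union_disjoint[symmetric]) (auto simp: ivl_disj_un)

lemma ysum_Suc: "a \<le> b \<Longrightarrow> ysum x a (b + 1) = ysum x a b + x b"
proof -
  assume "a \<le> b"
  moreover have "{b..<b + 1} = {b}" by auto
  ultimately show ?thesis using ysum_add[of a b "b + 1" x] by (simp add: ysum_def)
qed

text \<open>Each tree lowers the sum by one, and inside a tree the sum counted from its own start is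
  negative. The facts on single trees are hypotheses because the induction on trees provides them
  only for the children.\<close>

lemma spells_forest_pattern_aux:
  assumes "\<And>t a. t \<in> set ts \<Longrightarrow> spells x a (tree_pattern t) \<Longrightarrow> ysum x a (a + int (length (post_word t))) = -1"
    and "\<And>t a n. t \<in> set ts \<Longrightarrow> spells x a (tree_pattern t) \<Longrightarrow> a < n \<Longrightarrow> n \<le> a + int (length (post_word t)) \<Longrightarrow> ysum x a n < 0"
    and "spells x a (forest_pattern ts)"
  shows "ysum x a (a + int (length (forest_word ts))) = - int (length ts) \<and>
    (\<forall>n. a < n \<and> n \<le> a + int (length (forest_word ts)) \<longrightarrow> ysum x a n < 0)"
  using assms
proof (induction ts arbitrary: a)
  case (Cons t ts)
  let ?b = "a + int (length (post_word t))"
  have t: "spells x a (tree_pattern t)" and ts: "spells x ?b (forest_pattern ts)"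
    using Cons.prems(3) by (auto simp: spells_append)
  have 1: "ysum x a ?b = -1" and 2: "\<And>n. a < n \<Longrightarrow> n \<le> ?b \<Longrightarrow> ysum x a n < 0"
    using Cons.prems(1)[OF _ t] Cons.prems(2)[OF _ t] by auto
  have IH: "ysum x ?b (?b + int (length (forest_word ts))) = - int (length ts) \<and>
    (\<forall>n. ?b < n \<and> n \<le> ?b + int (length (forest_word ts)) \<longrightarrow> ysum x ?b n < 0)"
  proof (rule Cons.IH[OF _ _ ts])
    show "t \<in> set ts \<Longrightarrow> spells x a (tree_pattern t) \<Longrightarrow> ysum x a (a + int (length (post_word t))) = -1" for t a
      by (rule Cons.prems(1)) auto
    show "t \<in> set ts \<Longrightarrow> spells x a (tree_pattern t) \<Longrightarrow> a < n \<Longrightarrow> n \<le> a + int (length (post_word t)) \<Longrightarrow> ysum x a n < 0" for t a n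
      by (rule Cons.prems(2)) auto
  qed
  have 3: "ysum x ?b (?b + int (length (forest_word ts))) = - int (length ts)"
    and 4: "\<And>n. ?b < n \<Longrightarrow> n \<le> ?b + int (length (forest_word ts)) \<Longrightarrow> ysum x ?b n < 0"
    using IH by auto
  have "ysum x a (a + int (length (forest_word (t # ts)))) = - int (length (t # ts))"
    using ysum_add[of a ?b "?b + int (length (forest_word ts))" x] 1 3 by (simp add: algebra_simps)
  moreover have "ysum x a n < 0" if "a < n" "n \<le> a + int (length (forest_word (t # ts)))" for n
  proof (cases "n \<le> ?b")
    case False
    then show ?thesis using ysum_add[of a ?b n x] 1 4[of n] that by (simp add: algebra_simps)
  qed (use 2 that in auto)
  ultimately show ?case by blast
qed simp

lemma spells_tree_pattern:
  assumes "spells x a (tree_pattern t)"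
  shows "ysum x a (a + int (length (post_word t))) = -1"
    and "a < n \<Longrightarrow> n \<le> a + int (length (post_word t)) \<Longrightarrow> ysum x a n < 0"
proof -
  have "ysum x a (a + int (length (post_word t))) = -1 \<and>
      (\<forall>n. a < n \<and> n \<le> a + int (length (post_word t)) \<longrightarrow> ysum x a n < 0)"
    using assms
  proof (induction t arbitrary: a)
    case (Node ts)
    let ?b = "a + int (length (forest_word ts))"
    from Node.prems have ts: "spells x a (forest_pattern ts)" and l: "x ?b = int (length ts) - 1"
      by (auto simp: tree_pattern_kids spells_append)
    have 1: "ysum x a ?b = - int (length ts)" and 2: "\<And>n. a < n \<Longrightarrow> n \<le> ?b \<Longrightarrow> ysum x a n < 0"
      using spells_forest_pattern_aux[OF _ _ ts] Node.IH by blast+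
    have 3: "ysum x a (?b + 1) = -1" using ysum_Suc[of a ?b x] 1 l by simp
    have "ysum x a n < 0" if "a < n" "n \<le> ?b + 1" for n
    proof (cases "n = ?b + 1")
      case True
      then show ?thesis using 3 by simp
    next
      case False
      then show ?thesis using 2 that by simp
    qed
    then show ?case using 3 by (simp add: algebra_simps)
  qed
  then show "ysum x a (a + int (length (post_word t))) = -1"
    and "a < n \<Longrightarrow> n \<le> a + int (length (post_word t)) \<Longrightarrow> ysum x a n < 0" by auto
qed

lemma spells_forest_pattern:
  assumes "spells x a (forest_pattern ts)"
  shows "ysum x a (a + int (length (forest_word ts))) = - int (length ts)"
    and "a < n \<Longrightarrow> n \<le> a + int (length (forest_word ts)) \<Longrightarrow> ysum x a n < 0"
  using spells_forest_pattern_aux[OF _ _ assms] spells_tree_pattern by blast+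

text \<open>Postorder words are decodable from the right: the last letter tells how many trees precede it.\<close>

lemma forest_word_suffix_unique:
  "v @ forest_word ts = v' @ forest_word us \<Longrightarrow> length ts = length us \<Longrightarrow> ts = us \<and> v = v'"
proof (induction "length (forest_word ts)" arbitrary: ts us rule: less_induct)
  case less
  show ?case
  proof (cases ts rule: rev_cases)
    case Nil
    then show ?thesis using less.prems by simp
  next
    case t: (snoc ts' t)
    then obtain us' u where u: "us = us' @ [u]"
      using less.prems(2) by (metis length_0_conv append_is_Nil_conv list.distinct(1) rev_exhaust)
    \<comment> \<open>Deleting the last letter replaces the last tree by its children: both forests
      again have the same number of trees, and their words are one letter shorter.\<close>
    have *: "length (kids t) = length (kids u)" "v @ forest_word (ts' @ kids t) = v' @ forest_word (us' @ kids u)"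
      using less.prems(1) by (simp_all add: t u post_word_kids)
    have "ts' @ kids t = us' @ kids u \<and> v = v'"
      by (rule less.hyps[OF _ *(2)]) (use less.prems(2) *(1) in \<open>auto simp: t u post_word_kids\<close>)
    then show ?thesis using * less.prems(2) t u by (auto intro: ptree.expand)
  qed
qed

text \<open>The letters are read from right to left, and \<open>m\<close> counts the trees still to
  be completed. A letter \<open>z\<close> opens a root, which replaces one pending tree by
  \<open>z\<close> pending children; the bound on prefixes keeps this count positive until the
  end.\<close>

lemma parse_forest:
  assumes "(\<Sum>z\<leftarrow>zs. int z - 1) = - int m"
    and "\<And>k. k < length zs \<Longrightarrow> (\<Sum>z\<leftarrow>take k zs. int z - 1) > - int m"
  shows "\<exists>ts. length ts = m \<and> rev (forest_word ts) = zs"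
  using assms
proof (induction zs arbitrary: m)
  case Nil
  then show ?case by (intro exI[of _ "[]"]) simp
next
  case (Cons z zs)
  have m: "m > 0" using Cons.prems(2)[of 0] by simp
  have "\<exists>ts. length ts = m + z - 1 \<and> rev (forest_word ts) = zs"
  proof (rule Cons.IH)
    show "(\<Sum>z\<leftarrow>zs. int z - 1) = - int (m + z - 1)"
      using Cons.prems(1) m by (simp add: of_nat_diff)
    fix k assume "k < length zs"
    then show "(\<Sum>z\<leftarrow>take k zs. int z - 1) > - int (m + z - 1)"
      using Cons.prems(2)[of "Suc k"] m by (simp add: of_nat_diff)
  qed
  then obtain ts where ts: "length ts = m + z - 1" "rev (forest_word ts) = zs" by blast
  \<comment> \<open>The last \<open>z\<close> trees found so far become the children of the root
    just read.\<close>
  define us ks where "us = take (m - 1) ts" and "ks = drop (m - 1) ts"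
  have "forest_word ts = forest_word us @ forest_word ks"
    by (metis append_take_drop_id concat_append ks_def map_append us_def)
  moreover have "length us = m - 1" "length ks = z" using ts m by (auto simp: us_def ks_def)
  ultimately show ?case using ts(2) m by (intro exI[of _ "us @ [Node ks]"]) auto
qed

section \<open>Left records and parents in the record graph\<close>

definition left_record :: "(int \<Rightarrow> int) \<Rightarrow> int \<Rightarrow> bool" where
  "left_record x a \<longleftrightarrow> (\<forall>n<a. 0 \<le> ysum x n a)"

lemma ysum_rev_word:
  "(\<Sum>z\<leftarrow>map (\<lambda>k. nat (x (a - 1 - int k) + 1)) [0..<n]. int z - 1) = ysum x (a - int n) a"
  if "\<And>i. x i \<ge> -1"
proof (induction n)
  case (Suc n)
  have "ysum x (a - int (Suc n)) a = x (a - int (Suc n)) + ysum x (a - int n) a"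
    using ysum_add[of "a - int (Suc n)" "a - int n" a x] ysum_Suc[of "a - int (Suc n)" "a - int (Suc n)" x]
    by simp
  moreover have "- 2 < x (a - 1 - int n)" using that[of "a - 1 - int n"] by linarith
  ultimately show ?case using Suc that[of "a - 1 - int n"] by (simp add: algebra_simps)
qed simp

text \<open>Going left from \<open>a\<close>, the sum can drop by at most one per step, so it is
  exactly -1 when it first becomes negative, and the letters read until then form one postorder
  word. This makes a condition on the whole past a countable union of word events.\<close>

lemma not_left_record_iff:
  assumes x: "\<And>i. x i \<ge> -1"
  shows "\<not> left_record x a \<longleftrightarrow> (\<exists>t. spells x (a - int (length (post_word t))) (tree_pattern t))"
proof
  assume "\<exists>t. spells x (a - int (length (post_word t))) (tree_pattern t)"
  then obtain t where "spells x (a - int (length (post_word t))) (tree_pattern t)" by blast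
  from spells_tree_pattern(1)[OF this] show "\<not> left_record x a"
    using length_post_word_pos[of t] unfolding left_record_def
    by (auto intro!: exI[of _ "a - int (length (post_word t))"])
next
  assume "\<not> left_record x a"
  then obtain n' where "n' < a" "ysum x n' a < 0" by (auto simp: left_record_def not_le)
  then have ex: "ysum x (a - int (nat (a - n'))) a < 0" by simp
  define n where "n = (LEAST n. ysum x (a - int n) a < 0)"
  have neg: "ysum x (a - int n) a < 0" unfolding n_def by (rule LeastI[where P = "\<lambda>n. ysum x (a - int n) a < 0", OF ex])
  have min: "ysum x (a - int k) a \<ge> 0" if "k < n" for k
    using not_less_Least[of k "\<lambda>n. ysum x (a - int n) a < 0"] that by (simp add: n_def)
  define zs where "zs = map (\<lambda>k. nat (x (a - 1 - int k) + 1)) [0..<n]"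
  have take: "take k zs = map (\<lambda>k. nat (x (a - 1 - int k) + 1)) [0..<k]" if "k \<le> n" for k
    using that by (simp add: zs_def take_map)
  have sum: "(\<Sum>z\<leftarrow>take k zs. int z - 1) = ysum x (a - int k) a" if "k \<le> n" for k
    unfolding take[OF that] by (rule ysum_rev_word[OF x])
  obtain m where m: "n = Suc m" using neg by (cases n) auto
  have "ysum x (a - int n) a \<ge> -1"
    using ysum_add[of "a - int (Suc m)" "a - int m" a x] ysum_Suc[of "a - int (Suc m)" "a - int (Suc m)" x]
      min[of m] x[of "a - int (Suc m)"] m by simp
  with neg have "ysum x (a - int n) a = -1" by simp
  then have "(\<Sum>z\<leftarrow>zs. int z - 1) = - int 1" using sum[of n] by (simp add: zs_def)
  moreover have "(\<Sum>z\<leftarrow>take k zs. int z - 1) > - int 1" if "k < length zs" for k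
    using sum[of k] min[of k] that by (simp add: zs_def)
  ultimately obtain ts where "length ts = 1" and ts: "rev (forest_word ts) = zs"
    using parse_forest by blast
  then obtain t where "ts = [t]" by (metis One_nat_def length_0_conv length_Suc_conv)
  with ts have t: "post_word t = rev zs" by (metis concat.simps append_Nil2 list.map rev_rev_ident)
  have len: "length (post_word t) = n" by (simp add: t zs_def)
  have "spells x (a - int (length (post_word t))) (tree_pattern t)"
    unfolding spells_iff
  proof (intro allI impI)
    fix k assume k: "k < length (tree_pattern t)"
    then have "k < n" by (simp add: len)
    then have "zs ! (n - Suc k) = nat (x (a - int n + int k) + 1)"
      by (simp add: zs_def of_nat_diff algebra_simps)
    moreover have "post_word t ! k = zs ! (n - Suc k)"
      using \<open>k < n\<close> by (simp add: t rev_nth zs_def)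
    ultimately show "x (a - int (length (post_word t)) + int k) \<in> tree_pattern t ! k"
      using k x[of "a - int n + int k"] by (simp add: tree_pattern_def len)
  qed
  then show "\<exists>t. spells x (a - int (length (post_word t))) (tree_pattern t)" by blast
qed

lemma spells_map_singleton:
  "spells x a (map (\<lambda>k. {int k - 1}) ks) \<longleftrightarrow> ks = map (\<lambda>k. nat (x (a + int k) + 1)) [0..<length ks]
     \<and> (\<forall>k<length ks. x (a + int k) \<ge> -1)"
proof -
  have "x (a + int k) = int (ks ! k) - 1 \<longleftrightarrow> ks ! k = nat (x (a + int k) + 1) \<and> x (a + int k) \<ge> -1" for k
    by linarith
  then have "spells x a (map (\<lambda>k. {int k - 1}) ks) \<longleftrightarrow>
      (\<forall>k<length ks. ks ! k = nat (x (a + int k) + 1) \<and> x (a + int k) \<ge> -1)"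
    by (simp add: spells_iff)
  also have "\<dots> \<longleftrightarrow> ks = map (\<lambda>k. nat (x (a + int k) + 1)) [0..<length ks]
     \<and> (\<forall>k<length ks. x (a + int k) \<ge> -1)"
    by (subst list_eq_iff_nth_eq[of ks]) auto
  finally show ?thesis .
qed

text \<open>Both words end at \<open>a\<close>, so the shorter one is a suffix of the longer one,
  and decoding from the right gives the same tree. Hence the union in
  \<open>not_left_record_iff\<close> is disjoint.\<close>

lemma spells_tree_pattern_unique:
  assumes "spells x (a - int (length (post_word t))) (tree_pattern t)" "spells x (a - int (length (post_word u))) (tree_pattern u)"
  shows "t = u"
proof -
  have *: "length (post_word t) \<le> length (post_word u) \<Longrightarrow> t = u"
    if "spells x (a - int (length (post_word t))) (tree_pattern t)" "spells x (a - int (length (post_word u))) (tree_pattern u)" for t u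
  proof -
    assume le: "length (post_word t) \<le> length (post_word u)"
    let ?n = "length (post_word t)" and ?m = "length (post_word u)"
    have "post_word t ! k = post_word u ! (k + (?m - ?n))" if "k < ?n" for k
    proof -
      have m: "k + (?m - ?n) < ?m" using that le by simp
      have "x (a - int ?n + int k) = int (post_word t ! k) - 1"
        using \<open>spells x (a - int ?n) (tree_pattern t)\<close> that by (auto simp: spells_iff tree_pattern_def)
      moreover have "x (a - int ?m + int (k + (?m - ?n))) = int (post_word u ! (k + (?m - ?n))) - 1"
        using \<open>spells x (a - int ?m) (tree_pattern u)\<close> m unfolding spells_iff length_tree_pattern
        by (auto simp only: tree_pattern_def nth_map simp_thms)
      moreover have "x (a - int ?m + int (k + (?m - ?n))) = x (a - int ?n + int k)"
        using le by (intro arg_cong[of _ _ x]) (simp add: of_nat_diff)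
      ultimately have "int (post_word t ! k) - 1 = int (post_word u ! (k + (?m - ?n))) - 1" by linarith
      then show ?thesis by linarith
    qed
    then have "post_word t = drop (?m - ?n) (post_word u)"
      using le by (intro nth_equalityI) (auto simp: add.commute)
    then have "take (?m - ?n) (post_word u) @ forest_word [t] = [] @ forest_word [u]"
      using append_take_drop_id[of "?m - ?n" "post_word u"] by simp
    then show "t = u" using forest_word_suffix_unique[of _ "[t]" "[]" "[u]"] by auto
  qed
  show ?thesis using *[of t u] *[of u t] assms by (cases "length (post_word t) \<le> length (post_word u)") auto
qed

lemma record_par_eqI:
  assumes "i < b" "0 \<le> ysum x i b" "\<And>n. i < n \<Longrightarrow> n < b \<Longrightarrow> ysum x i n < 0"
  shows "record_par x i = Some b"
proof -
  have "(LEAST n. n > i \<and> ysum x i n \<ge> 0) = b"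
    using assms by (intro Least_equality) (auto simp: not_less[symmetric])
  then have "record_map x i = b" unfolding record_map_def using assms by auto
  then show ?thesis using assms by (simp add: record_par_def)
qed

text \<open>A common weakening of \<open>tree_pattern\<close> and \<open>bush_pattern\<close> that
  still determines all parents inside the tree.\<close>

definition fits_tree :: "(int \<Rightarrow> int) \<Rightarrow> int \<Rightarrow> ptree \<Rightarrow> bool" where
  "fits_tree x a t \<longleftrightarrow> spells x a (forest_pattern (kids t)) \<and>
     x (a + int (length (forest_word (kids t)))) \<ge> int (length (kids t)) - 1"

lemma fits_tree_tree_pattern: "spells x a (tree_pattern t) \<Longrightarrow> fits_tree x a t"
  by (auto simp: fits_tree_def tree_pattern_kids spells_append)

lemma fits_tree_bush_pattern: "spells x a (bush_pattern t) \<Longrightarrow> fits_tree x a t"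
  by (auto simp: fits_tree_def bush_pattern_def spells_append)

lemma forest_pattern_split:
  assumes "j < length ts"
  shows "forest_pattern ts = forest_pattern (take j ts) @ tree_pattern (ts ! j) @ forest_pattern (drop (Suc j) ts)"
proof -
  have "ts = take j ts @ [ts ! j] @ drop (Suc j) ts" using assms by (simp add: id_take_nth_drop)
  then have "forest_pattern ts = forest_pattern (take j ts @ [ts ! j] @ drop (Suc j) ts)" by simp
  then show ?thesis by (simp only: forest_pattern_Cons forest_pattern_append forest_pattern_Nil append_Nil append_Nil2)
qed

text \<open>Child \<open>j\<close> of the root sits at \<open>?e\<close>. The siblings to its right
  contribute minus their number, and the letter of the root makes up for this, leaving at least
  \<open>j\<close>. Deeper vertices lie in a subtree whose root letter is exact.\<close>

lemma record_par_fits_tree: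
  "fits_tree x a t \<Longrightarrow> is_path t p \<Longrightarrow> p \<noteq> [] \<Longrightarrow>
    record_par x (a + int (pos t p)) = Some (a + int (pos t (butlast p)))"
proof (induction p arbitrary: t a)
  case (Cons j p)
  let ?ts = "kids t" and ?s = "a + int (length (forest_word (take j (kids t))))"
  have j: "j < length ?ts" and p: "is_path (?ts ! j) p" using Cons.prems by auto
  let ?e = "?s + int (length (post_word (?ts ! j)))"
  have sp: "spells x a (forest_pattern ?ts)" using Cons.prems by (simp add: fits_tree_def)
  then have tw: "spells x ?s (tree_pattern (?ts ! j))" and rest: "spells x ?e (forest_pattern (drop (Suc j) ?ts))"
    unfolding forest_pattern_split[OF j] by (auto simp: spells_append)
  show ?case
  proof (cases "p = []")
    case False
    then show ?thesis using Cons.IH[OF fits_tree_tree_pattern[OF tw] p] by (simp add: algebra_simps)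
  next
    case True
    let ?b = "a + int (length (forest_word ?ts))"
    have b: "?b = ?e + int (length (forest_word (drop (Suc j) ?ts)))"
      using arg_cong[OF forest_pattern_split[OF j], of length] by simp
    have l: "x ?b \<ge> int (length ?ts) - 1" using Cons.prems by (simp add: fits_tree_def)
    have s: "ysum x ?e ?b = - int (length ?ts - Suc j)" using spells_forest_pattern(1)[OF rest] by (simp add: b)
    have "record_par x ?e = Some (?b + 1)"
    proof (rule record_par_eqI)
      show "?e < ?b + 1" using b by simp
      have "ysum x ?e (?b + 1) = ysum x ?e ?b + x ?b" using b by (intro ysum_Suc) simp
      then show "0 \<le> ysum x ?e (?b + 1)" using s l j by (simp add: of_nat_diff)
      show "ysum x ?e n < 0" if "?e < n" "n < ?b + 1" for n
        using spells_forest_pattern(2)[OF rest, of n] that b by simp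
    qed
    then show ?thesis using True by (simp add: post_word_kids[of t] algebra_simps)
  qed
qed simp

lemma spells_bush_pattern:
  assumes "spells x a (bush_pattern t)"
  shows "0 \<le> ysum x a (a + int (length (post_word t)))"
    and "a < n \<Longrightarrow> n < a + int (length (post_word t)) \<Longrightarrow> ysum x a n < 0"
proof -
  let ?b = "a + int (length (forest_word (kids t)))"
  have sp: "spells x a (forest_pattern (kids t))" and l: "x ?b \<ge> int (length (kids t))"
    using assms by (auto simp: bush_pattern_def spells_append)
  show "0 \<le> ysum x a (a + int (length (post_word t)))"
    using ysum_Suc[of a ?b x] spells_forest_pattern(1)[OF sp] l by (simp add: post_word_kids algebra_simps)
  show "a < n \<Longrightarrow> n < a + int (length (post_word t)) \<Longrightarrow> ysum x a n < 0"
    using spells_forest_pattern(2)[OF sp] by (simp add: post_word_kids)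
qed

lemma record_par_bush_pattern: "spells x a (bush_pattern t) \<Longrightarrow> record_par x a = Some (a + int (length (post_word t)))"
  using spells_bush_pattern length_post_word_pos[of t] by (intro record_par_eqI) auto

text \<open>Inside the bush the sum to its right end is the total minus a prefix; the total is
  nonnegative and the prefix is negative.\<close>

lemma left_record_bush_pattern:
  assumes "left_record x a" "spells x a (bush_pattern t)"
  shows "left_record x (a + int (length (post_word t)))"
  unfolding left_record_def
proof (intro allI impI)
  fix n assume n: "n < a + int (length (post_word t))"
  show "0 \<le> ysum x n (a + int (length (post_word t)))"
  proof (cases "n < a")
    case True
    then show ?thesis
      using assms(1) spells_bush_pattern(1)[OF assms(2)] ysum_add[of n a "a + int (length (post_word t))" x]
      by (force simp: left_record_def)
  next
    case False
    then show ?thesis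
      using spells_bush_pattern[OF assms(2)] ysum_add[of a n "a + int (length (post_word t))" x] n
      by (cases "n = a") force+
  qed
qed

text \<open>No left record hides inside a bush. This is what forces every decomposition into bushes
  to cut at the same places.\<close>

lemma not_left_record_bush_pattern:
  assumes "spells x a (bush_pattern t)" "a < n" "n < a + int (length (post_word t))"
  shows "\<not> left_record x n"
  using spells_bush_pattern(2)[OF assms] assms(2) by (auto simp: left_record_def not_le)

text \<open>The last letter of a bush does not reveal the number of its trees; this number is
  recovered from the sum over the letters before it.\<close>

lemma bush_pattern_unique:
  assumes "spells x a (bush_pattern t)" "spells x a (bush_pattern u)" "length (post_word t) = length (post_word u)"
  shows "t = u"
proof -
  have t: "spells x a (forest_pattern (kids t))" and u: "spells x a (forest_pattern (kids u))"
    using assms by (auto simp: bush_pattern_def spells_append)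
  have len: "length (forest_word (kids t)) = length (forest_word (kids u))" using assms(3) by (simp add: post_word_kids)
  have "forest_word (kids t) = forest_word (kids u)"
    using t u len unfolding forest_pattern_def spells_map_singleton by metis
  moreover have "length (kids t) = length (kids u)"
    using spells_forest_pattern(1)[OF t] spells_forest_pattern(1)[OF u] len by simp
  ultimately have "kids t = kids u" using forest_word_suffix_unique[of "[]" "kids t" "[]" "kids u"] by simp
  then show ?thesis by (rule ptree.expand)
qed

section \<open>Tree weights\<close>

text \<open>Consing is a bijection from pairs onto nonempty lists, so each further entry contributes
  one independent factor.\<close>

lemma nn_integral_lists_prod:
  fixes h :: "'b::countable \<Rightarrow> ennreal"
  shows "(\<integral>\<^sup>+xs. prod_list (map h xs) * indicator {xs. length xs = k} xs \<partial>count_space UNIV)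
    = (\<integral>\<^sup>+x. h x \<partial>count_space UNIV) ^ k"
proof (induction k)
  case 0
  have "(\<lambda>xs. prod_list (map h xs) * indicator {xs. length xs = 0} xs) = indicator {[]}"
    by (auto simp: indicator_def fun_eq_iff)
  then show ?case by simp
next
  case (Suc k)
  let ?f = "\<lambda>xs. prod_list (map h xs) * indicator {xs. length xs = Suc k} xs"
  have bij: "bij_betw (\<lambda>(x, xs). x # xs) UNIV (range (\<lambda>(x, xs). x # xs))"
    by (intro inj_on_imp_bij_betw) (auto simp: inj_on_def)
  have "(\<integral>\<^sup>+xs. ?f xs \<partial>count_space UNIV) = (\<integral>\<^sup>+xs. ?f xs \<partial>count_space (range (\<lambda>(x, xs). x # xs)))"
  proof (rule nn_integral_count_space_eq)
    fix xs :: "'b list" assume "xs \<in> UNIV - range (\<lambda>(x, xs). x # xs)"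
    then have "xs = []" by (cases xs) auto
    then show "?f xs = 0" by simp
  qed auto
  also have "\<dots> = (\<integral>\<^sup>+z. ?f (case z of (x, xs) \<Rightarrow> x # xs) \<partial>count_space UNIV)"
    by (rule nn_integral_bij_count_space[OF bij, symmetric])
  also have "\<dots> = (\<integral>\<^sup>+x. \<integral>\<^sup>+xs. ?f (x # xs) \<partial>count_space UNIV \<partial>count_space UNIV)"
    by (subst nn_integral_fst_count_space[symmetric]) simp
  also have "\<dots> = (\<integral>\<^sup>+x. \<integral>\<^sup>+xs. h x * (prod_list (map h xs) * indicator {xs. length xs = k} xs)
      \<partial>count_space UNIV \<partial>count_space UNIV)"
    by (intro nn_integral_cong) (auto simp: indicator_def mult.assoc)
  also have "\<dots> = (\<integral>\<^sup>+x. h x * (\<integral>\<^sup>+x. h x \<partial>count_space UNIV) ^ k \<partial>count_space UNIV)"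
    by (simp add: nn_integral_cmult Suc)
  also have "\<dots> = (\<integral>\<^sup>+x. h x \<partial>count_space UNIV) ^ Suc k"
    by (simp add: nn_integral_multc)
  finally show ?case .
qed

text \<open>With \<open>h\<close> of total mass 1 the entries behave like \<open>k\<close>
  independent draws: each contributes the mean of \<open>g\<close>, and the remaining factors
  integrate to 1.\<close>

lemma nn_integral_lists_sum:
  fixes h g :: "'b::countable \<Rightarrow> ennreal"
  assumes h: "(\<integral>\<^sup>+x. h x \<partial>count_space UNIV) = 1"
  shows "(\<integral>\<^sup>+xs. prod_list (map h xs) * sum_list (map g xs) * indicator {xs. length xs = k} xs \<partial>count_space UNIV)
    = of_nat k * (\<integral>\<^sup>+x. h x * g x \<partial>count_space UNIV)"
proof (induction k)
  case 0
  have "(\<lambda>xs. prod_list (map h xs) * sum_list (map g xs) * indicator {xs. length xs = 0} xs) = (\<lambda>_. 0)"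
    by (auto simp: indicator_def fun_eq_iff)
  then show ?case by (simp only:) simp
next
  case (Suc k)
  let ?f = "\<lambda>xs. prod_list (map h xs) * sum_list (map g xs) * indicator {xs. length xs = Suc k} xs"
  have bij: "bij_betw (\<lambda>(x, xs). x # xs) UNIV (range (\<lambda>(x, xs). x # xs))"
    by (intro inj_on_imp_bij_betw) (auto simp: inj_on_def)
  have "(\<integral>\<^sup>+xs. ?f xs \<partial>count_space UNIV) = (\<integral>\<^sup>+xs. ?f xs \<partial>count_space (range (\<lambda>(x, xs). x # xs)))"
  proof (rule nn_integral_count_space_eq)
    fix xs :: "'b list" assume "xs \<in> UNIV - range (\<lambda>(x, xs). x # xs)"
    then have "xs = []" by (cases xs) auto
    then show "?f xs = 0" by simp
  qed auto
  also have "\<dots> = (\<integral>\<^sup>+z. ?f (case z of (x, xs) \<Rightarrow> x # xs) \<partial>count_space UNIV)"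
    by (rule nn_integral_bij_count_space[OF bij, symmetric])
  also have "\<dots> = (\<integral>\<^sup>+x. \<integral>\<^sup>+xs. ?f (x # xs) \<partial>count_space UNIV \<partial>count_space UNIV)"
    by (subst nn_integral_fst_count_space[symmetric]) simp
  also have "\<dots> = (\<integral>\<^sup>+x. \<integral>\<^sup>+xs. h x * g x * (prod_list (map h xs) * indicator {xs. length xs = k} xs)
      + h x * (prod_list (map h xs) * sum_list (map g xs) * indicator {xs. length xs = k} xs)
      \<partial>count_space UNIV \<partial>count_space UNIV)"
    by (intro nn_integral_cong) (auto simp: indicator_def algebra_simps)
  also have "\<dots> = (\<integral>\<^sup>+x. h x * g x + h x * (of_nat k * (\<integral>\<^sup>+x. h x * g x \<partial>count_space UNIV)) \<partial>count_space UNIV)"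
    by (simp add: nn_integral_cmult nn_integral_add Suc nn_integral_lists_prod h)
  also have "\<dots> = of_nat (Suc k) * (\<integral>\<^sup>+x. h x * g x \<partial>count_space UNIV)"
    by (subst nn_integral_add, simp, simp, subst nn_integral_multc) (simp_all add: h distrib_right)
  finally show ?case .
qed

lemma nn_integral_ptree:
  "(\<integral>\<^sup>+t. f (kids t) \<partial>count_space UNIV)
    = (\<integral>\<^sup>+k. \<integral>\<^sup>+ts. f ts * indicator {ts. length ts = k} ts \<partial>count_space UNIV \<partial>count_space UNIV)"
  for f :: "ptree list \<Rightarrow> ennreal"
proof -
  have bij: "bij_betw kids UNIV UNIV"
    by (rule bij_betwI[where g = Node]) auto
  have "(\<integral>\<^sup>+t. f (kids t) \<partial>count_space UNIV) = (\<integral>\<^sup>+ts. f ts \<partial>count_space UNIV)"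
    by (rule nn_integral_bij_count_space[OF bij])
  also have "\<dots> = (\<integral>\<^sup>+ts. \<integral>\<^sup>+k. f ts * indicator {ts. length ts = k} ts \<partial>count_space UNIV \<partial>count_space UNIV)"
  proof (intro nn_integral_cong)
    fix ts :: "ptree list"
    have *: "indicator {ts. length ts = k} ts = (indicator {length ts} k :: ennreal)" for k
      by (auto simp: indicator_def)
    show "f ts = (\<integral>\<^sup>+k. f ts * indicator {ts. length ts = k} ts \<partial>count_space UNIV)"
      unfolding * by (simp add: nn_integral_cmult)
  qed
  also have "\<dots> = (\<integral>\<^sup>+k. \<integral>\<^sup>+ts. f ts * indicator {ts. length ts = k} ts \<partial>count_space UNIV \<partial>count_space UNIV)"
    using nn_integral_fst_count_space[of "\<lambda>(ts, k). f ts * indicator {ts. length ts = k} ts"]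
      nn_integral_snd_count_space[of "\<lambda>(ts, k). f ts * indicator {ts. length ts = k} ts"] by simp
  finally show ?thesis .
qed

text \<open>For a probability vector \<open>v\<close> this is the probability that a Galton-Watson
  tree with offspring law \<open>v\<close> equals \<open>t\<close>.\<close>

definition weight :: "(nat \<Rightarrow> ennreal) \<Rightarrow> ptree \<Rightarrow> ennreal" where
  "weight v t = prod_list (map v (post_word t))"

lemma prod_list_forest_word: "prod_list (map v (forest_word ts)) = prod_list (map (weight v) ts)"
  by (induction ts) (auto simp: weight_def)

lemma weight_kids: "weight v t = prod_list (map (weight v) (kids t)) * v (length (kids t))"
  unfolding weight_def[of v t] post_word_kids map_append prod_list.append prod_list_forest_word by simp

text \<open>The branching property at the root. The root law \<open>v\<close> and the weight
  \<open>h\<close> of the subtrees are kept apart because a bush has root law \<alpha> over trees of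
  law \<beta>, and because \<open>C_less_1\<close> inserts truncated weights for
  \<open>h\<close>.\<close>

lemma nn_integral_kids_prod:
  "(\<integral>\<^sup>+t. prod_list (map h (kids t)) * v (length (kids t)) \<partial>count_space UNIV)
    = (\<integral>\<^sup>+k. v k * (\<integral>\<^sup>+t. h t \<partial>count_space UNIV) ^ k \<partial>count_space UNIV)"
  for h :: "ptree \<Rightarrow> ennreal"
proof -
  have "(\<integral>\<^sup>+ts. prod_list (map h ts) * v (length ts) * indicator {ts. length ts = k} ts \<partial>count_space UNIV)
      = v k * (\<integral>\<^sup>+t. h t \<partial>count_space UNIV) ^ k" for k
    unfolding nn_integral_lists_prod[symmetric]
    by (subst nn_integral_cmult[symmetric]) (auto intro!: nn_integral_cong simp: indicator_def mult_ac)
  then show ?thesis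
    unfolding nn_integral_ptree[of "\<lambda>ts. prod_list (map h ts) * v (length ts)"] by simp
qed

text \<open>The vertices are the root and those below each child, which gives an identity of Wald
  type. It serves both for a tree of law \<beta>, where it is an equation for the mean size, and for
  a bush.\<close>

lemma nn_integral_kids_sum:
  fixes h :: "ptree \<Rightarrow> ennreal"
  assumes h: "(\<integral>\<^sup>+t. h t \<partial>count_space UNIV) = 1" and v: "(\<integral>\<^sup>+k. v k \<partial>count_space UNIV) = 1"
  shows "(\<integral>\<^sup>+t. prod_list (map h (kids t)) * v (length (kids t)) * of_nat (length (post_word t)) \<partial>count_space UNIV)
    = 1 + (\<integral>\<^sup>+k. v k * of_nat k \<partial>count_space UNIV) * (\<integral>\<^sup>+t. h t * of_nat (length (post_word t)) \<partial>count_space UNIV)"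
proof -
  let ?g = "\<lambda>t. of_nat (length (post_word t)) :: ennreal"
  have len: "?g t = 1 + sum_list (map ?g (kids t))" for t
  proof -
    have "of_nat (length (forest_word ts)) = sum_list (map ?g ts)" for ts by (induction ts) auto
    then show ?thesis by (subst post_word_kids) simp
  qed
  have "(\<integral>\<^sup>+t. prod_list (map h (kids t)) * v (length (kids t)) * ?g t \<partial>count_space UNIV)
    = (\<integral>\<^sup>+t. prod_list (map h (kids t)) * v (length (kids t))
        + prod_list (map h (kids t)) * v (length (kids t)) * sum_list (map ?g (kids t)) \<partial>count_space UNIV)"
    by (subst len) (simp add: algebra_simps)
  also have "\<dots> = 1 + (\<integral>\<^sup>+t. prod_list (map h (kids t)) * v (length (kids t)) * sum_list (map ?g (kids t)) \<partial>count_space UNIV)"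
    by (subst nn_integral_add) (simp_all add: nn_integral_kids_prod h v)
  also have "(\<integral>\<^sup>+t. prod_list (map h (kids t)) * v (length (kids t)) * sum_list (map ?g (kids t)) \<partial>count_space UNIV)
    = (\<integral>\<^sup>+k. v k * (of_nat k * (\<integral>\<^sup>+t. h t * ?g t \<partial>count_space UNIV)) \<partial>count_space UNIV)"
    unfolding nn_integral_ptree[of "\<lambda>ts. prod_list (map h ts) * v (length ts) * sum_list (map ?g ts)"]
    unfolding nn_integral_lists_sum[OF h, symmetric]
    by (subst nn_integral_cmult[symmetric])
      (auto intro!: nn_integral_cong simp: indicator_def mult_ac)
  also have "\<dots> = (\<integral>\<^sup>+k. v k * of_nat k \<partial>count_space UNIV) * (\<integral>\<^sup>+t. h t * ?g t \<partial>count_space UNIV)"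
    by (subst nn_integral_multc[symmetric]) (auto simp: mult_ac)
  finally show ?thesis .
qed

section \<open>Extinction probability of a supercritical offspring law\<close>

lemma nn_integral_pmf_UNIV: "(\<integral>\<^sup>+k. ennreal (pmf p k) \<partial>count_space UNIV) = 1"
  by (subst nn_integral_pmf) (simp add: measure_pmf.emeasure_space_1[simplified])

text \<open>Here \<open>p\<close> stands for the law of \<open>X 0 + 1\<close>: \<open>p0\<close>
  says that the step -1 has positive probability, and \<open>mean\<close> that the drift is
  positive, possibly infinite.\<close>

locale offspring =
  fixes p :: "nat pmf"
  assumes p0: "0 < pmf p 0"
    and mean: "1 < (\<integral>\<^sup>+k. of_nat k \<partial>measure_pmf p)"
begin

text \<open>The extinction probability, as the total mass of finite trees. It takes values in
  \<open>ennreal\<close> because finiteness only follows from \<open>C_less_1\<close>.\<close>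

definition C :: ennreal where
  "C = (\<integral>\<^sup>+t. weight (\<lambda>k. ennreal (pmf p k)) t \<partial>count_space UNIV)"

definition c :: real where
  "c = enn2real C"

lemma C_fix: "C = (\<integral>\<^sup>+k. pmf p k * C ^ k \<partial>count_space UNIV)"
  unfolding C_def nn_integral_kids_prod[symmetric]
  by (intro nn_integral_cong) (rule weight_kids)

text \<open>The generating function of \<open>p\<close> has slope greater than 1 at 1, so it lies below the diagonal just left of 1.\<close>

lemma exists_super_fixpoint: "\<exists>s. 0 < s \<and> s < 1 \<and> (\<integral>\<^sup>+k. pmf p k * ennreal s ^ k \<partial>count_space UNIV) \<le> ennreal s"
proof -
  have "1 < (\<integral>\<^sup>+k. ennreal (pmf p k) * of_nat k \<partial>count_space UNIV)"
    using mean by (simp add: nn_integral_measure_pmf)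
  also have "\<dots> = (SUP n. \<Sum>k<n. ennreal (pmf p k) * of_nat k)"
    by (simp add: nn_integral_count_space_nat suminf_eq_SUP)
  finally obtain K where "1 < (\<Sum>k<K. ennreal (pmf p k) * of_nat k)" by (auto simp: less_SUP_iff)
  also have "(\<Sum>k<K. ennreal (pmf p k) * of_nat k) = ennreal (\<Sum>k<K. pmf p k * real k)"
    by (subst sum_ennreal[symmetric]) (auto simp: ennreal_mult ennreal_of_nat_eq_real_of_nat)
  finally have K: "1 < (\<Sum>k<K. pmf p k * real k)" by simp
  \<comment> \<open>Only \<open>K\<close> terms are kept, as the mean may be infinite. Writing the
    terms with 1 - s^k makes the dropped ones nonnegative, so that a strict inequality for the
    truncated sum passes to the full series.\<close>
  let ?g = "\<lambda>s::real. (\<Sum>k<K. pmf p k * (1 - s ^ k)) - (1 - s)"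
  have "(?g has_real_derivative (\<Sum>k<K. pmf p k * (0 - real k * 1 ^ (k - 1))) - (0 - 1)) (at 1)"
    by (auto intro!: derivative_eq_intros sum.cong)
  moreover have "(\<Sum>k<K. pmf p k * (0 - real k * 1 ^ (k - 1))) - (0 - 1) < 0"
  proof -
    have "(\<Sum>k<K. pmf p k * (0 - real k * 1 ^ (k - 1))) = - (\<Sum>k<K. pmf p k * real k)"
      unfolding sum_negf[symmetric] by (rule sum.cong) auto
    then show ?thesis using K by simp
  qed
  ultimately obtain d where d: "d > 0" "\<And>h. h > 0 \<Longrightarrow> h < d \<Longrightarrow> ?g 1 < ?g (1 - h)"
    using DERIV_neg_dec_left by blast
  define s where "s = 1 - min (d / 2) (1 / 2)"
  have s: "0 < s" "s < 1" using d(1) by (auto simp: s_def)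
  have g: "1 - s < (\<Sum>k<K. pmf p k * (1 - s ^ k))"
    using d(2)[of "min (d / 2) (1 / 2)"] d(1) by (simp add: s_def)
  have sk: "s ^ k \<le> 1" for k using s by (intro power_le_one) auto
  have "(\<integral>\<^sup>+k. pmf p k * ennreal s ^ k \<partial>count_space UNIV)
      + (\<integral>\<^sup>+k. ennreal (pmf p k * (1 - s ^ k)) \<partial>count_space UNIV)
      = (\<integral>\<^sup>+k. ennreal (pmf p k) \<partial>count_space UNIV)"
  proof (subst nn_integral_add[symmetric], simp, simp, intro nn_integral_cong)
    fix k
    have "ennreal (pmf p k) * ennreal s ^ k + ennreal (pmf p k * (1 - s ^ k))
        = ennreal (pmf p k * s ^ k + pmf p k * (1 - s ^ k))"
      using s sk[of k] by (subst ennreal_plus) (auto simp: ennreal_power ennreal_mult)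
    then show "ennreal (pmf p k) * ennreal s ^ k + ennreal (pmf p k * (1 - s ^ k)) = ennreal (pmf p k)"
      by (simp add: right_diff_distrib)
  qed
  then have 1: "(\<integral>\<^sup>+k. pmf p k * ennreal s ^ k \<partial>count_space UNIV)
      + (\<integral>\<^sup>+k. ennreal (pmf p k * (1 - s ^ k)) \<partial>count_space UNIV) = 1"
    by (simp add: nn_integral_pmf_UNIV)
  have "ennreal (1 - s) \<le> ennreal (\<Sum>k<K. pmf p k * (1 - s ^ k))" using g by (intro ennreal_leI) simp
  also have "\<dots> = (\<Sum>k<K. ennreal (pmf p k * (1 - s ^ k)))" using sk by (subst sum_ennreal) auto
  also have "\<dots> \<le> (\<integral>\<^sup>+k. ennreal (pmf p k * (1 - s ^ k)) \<partial>count_space UNIV)"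
    by (simp add: nn_integral_count_space_nat sum_le_suminf)
  finally have 2: "ennreal (1 - s) \<le> (\<integral>\<^sup>+k. ennreal (pmf p k * (1 - s ^ k)) \<partial>count_space UNIV)" .
  let ?I = "\<integral>\<^sup>+k. pmf p k * ennreal s ^ k \<partial>count_space UNIV"
  have "?I + ennreal (1 - s) \<le> ennreal s + ennreal (1 - s)"
    using add_left_mono[OF 2, of ?I] 1 s by (simp add: ennreal_plus[symmetric] del: ennreal_plus)
  then have "?I \<le> ennreal s" by (simp add: add.commute[of _ "ennreal (1 - s)"] ennreal_add_left_cancel_le)
  then show ?thesis using s by blast
qed

text \<open>The mass of trees with fewer than \<open>n\<close> vertices stays below any super-fixpoint, by induction on \<open>n\<close>.\<close>

lemma C_less_1: "C < 1"
proof -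
  let ?w = "weight (\<lambda>k. ennreal (pmf p k))"
  obtain s where s: "0 < s" "s < 1" "(\<integral>\<^sup>+k. pmf p k * ennreal s ^ k \<partial>count_space UNIV) \<le> ennreal s"
    using exists_super_fixpoint by blast
  have le: "(\<integral>\<^sup>+t. ?w t * indicator {t. length (post_word t) < n} t \<partial>count_space UNIV) \<le> ennreal s" for n
  proof (induction n)
    case 0
    then show ?case by simp
  next
    case (Suc n)
    let ?h = "\<lambda>t. ?w t * indicator {t. length (post_word t) < n} t"
    have "?w t * indicator {t. length (post_word t) < Suc n} t \<le> prod_list (map ?h (kids t)) * ennreal (pmf p (length (kids t)))" for t
    proof (cases "length (post_word t) < Suc n")
      case True
      have "length (post_word u) < n" if "u \<in> set (kids t)" for u
      proof -
        have "length (post_word u) \<le> length (forest_word (kids t))"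
          using that by (auto simp: length_concat intro!: member_le_sum_list)
        then show ?thesis using True by (simp add: post_word_kids[of t])
      qed
      then have "map ?h (kids t) = map ?w (kids t)" by (intro map_cong) auto
      then show ?thesis using True by (simp only: weight_kids[of _ t]) simp
    qed simp
    then have "(\<integral>\<^sup>+t. ?w t * indicator {t. length (post_word t) < Suc n} t \<partial>count_space UNIV)
      \<le> (\<integral>\<^sup>+t. prod_list (map ?h (kids t)) * ennreal (pmf p (length (kids t))) \<partial>count_space UNIV)"
      by (intro nn_integral_mono) auto
    also have "\<dots> = (\<integral>\<^sup>+k. pmf p k * (\<integral>\<^sup>+t. ?h t \<partial>count_space UNIV) ^ k \<partial>count_space UNIV)"
      by (rule nn_integral_kids_prod)
    also have "\<dots> \<le> (\<integral>\<^sup>+k. pmf p k * ennreal s ^ k \<partial>count_space UNIV)"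
      using Suc by (intro nn_integral_mono mult_left_mono power_mono) auto
    finally show ?case using s(3) by simp
  qed
  have SUP: "(SUP n. ?w t * indicator {t. length (post_word t) < n} t) = ?w t" for t
  proof (rule antisym)
    show "(SUP n. ?w t * indicator {t. length (post_word t) < n} t) \<le> ?w t"
      by (intro SUP_least) (auto simp: indicator_def)
    show "?w t \<le> (SUP n. ?w t * indicator {t. length (post_word t) < n} t)"
      by (rule SUP_upper2[of "Suc (length (post_word t))"]) auto
  qed
  have "C = (\<integral>\<^sup>+t. (SUP n. ?w t * indicator {t. length (post_word t) < n} t) \<partial>count_space UNIV)"
    unfolding C_def by (simp only: SUP)
  also have "\<dots> = (SUP n. \<integral>\<^sup>+t. ?w t * indicator {t. length (post_word t) < n} t \<partial>count_space UNIV)"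
    by (rule nn_integral_monotone_convergence_SUP) (auto simp: incseq_def le_fun_def indicator_def)
  also have "\<dots> \<le> ennreal s" using le by (intro SUP_least) auto
  also have "\<dots> < 1" using s by (simp add: ennreal_less_one_iff)
  finally show ?thesis .
qed

lemma C_eq: "C = ennreal c"
  using C_less_1 unfolding c_def by (intro ennreal_enn2real[symmetric]) (rule order.strict_trans[OF _ ennreal_one_less_top])

lemma c_less_1: "c < 1"
  using C_less_1 by (simp add: C_eq ennreal_less_one_iff)

lemma c_pos: "0 < c"
proof -
  have "ennreal (pmf p 0) = weight (\<lambda>k. ennreal (pmf p k)) (Node [])" by (simp add: weight_def)
  also have "\<dots> \<le> C"
    unfolding C_def by (rule nn_integral_ge_point) simp
  finally have "ennreal (pmf p 0) \<le> ennreal c" by (simp add: C_eq)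
  then show ?thesis using p0 c_def by (smt (verit) enn2real_nonneg ennreal_le_iff)
qed

section \<open>The tilted offspring law and the law at the root of a bush\<close>

definition \<beta> :: "nat pmf" where
  "\<beta> = embed_pmf (\<lambda>k. c ^ k / c * pmf p k)"

text \<open>The tilted weights add up to 1 because \<open>C\<close> is a fixed point of the
  generating function. Writing \<open>c ^ k / c\<close> covers \<open>k = 0\<close> without a
  negative exponent.\<close>

lemma pmf_\<beta>: "pmf \<beta> k = c ^ k / c * pmf p k"
  unfolding \<beta>_def
proof (rule pmf_embed_pmf)
  show "0 \<le> c ^ k / c * pmf p k" for k using c_pos by simp
  have "ennreal c * (\<integral>\<^sup>+k. ennreal (c ^ k / c * pmf p k) \<partial>count_space UNIV) = C"
    using c_pos by (subst C_fix, subst nn_integral_cmult[symmetric])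
      (auto intro!: nn_integral_cong simp: ennreal_mult[symmetric] ennreal_power C_eq mult_ac)
  then have "ennreal c * (\<integral>\<^sup>+k. ennreal (c ^ k / c * pmf p k) \<partial>count_space UNIV) = ennreal c * 1"
    by (simp add: C_eq)
  then show "(\<integral>\<^sup>+k. ennreal (c ^ k / c * pmf p k) \<partial>count_space UNIV) = 1"
    by (subst (asm) ennreal_mult_cancel_left) (use c_pos in auto)
qed

lemma emeasure_tail: "emeasure (measure_pmf p) {k<..} = ennreal (measure_pmf.prob p {k<..})"
  by (simp add: measure_pmf.emeasure_eq_measure)

text \<open>The pairs k < j are summed in the other order.\<close>

lemma nn_integral_tail:
  fixes g :: "nat \<Rightarrow> ennreal"
  shows "(\<integral>\<^sup>+k. ennreal (measure_pmf.prob p {k<..}) * g k \<partial>count_space UNIV)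
    = (\<integral>\<^sup>+j. pmf p j * (\<Sum>k<j. g k) \<partial>count_space UNIV)"
proof -
  have "(\<integral>\<^sup>+k. ennreal (measure_pmf.prob p {k<..}) * g k \<partial>count_space UNIV)
    = (\<Sum>k. \<integral>\<^sup>+j. indicator {k<..} j * g k \<partial>measure_pmf p)"
    by (simp add: nn_integral_count_space_nat emeasure_tail[symmetric] nn_integral_multc)
  also have "\<dots> = (\<integral>\<^sup>+j. (\<Sum>k. indicator {k<..} j * g k) \<partial>measure_pmf p)"
    by (rule nn_integral_suminf[symmetric]) simp
  also have "\<dots> = (\<integral>\<^sup>+j. (\<Sum>k<j. g k) \<partial>measure_pmf p)"
    by (intro nn_integral_cong, subst suminf_finite[of "{..<_}"]) (auto simp: indicator_def intro!: sum.cong)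
  finally show ?thesis by (simp add: nn_integral_measure_pmf)
qed

definition \<alpha> :: "nat pmf" where
  "\<alpha> = embed_pmf (\<lambda>k. measure_pmf.prob p {k<..} * c ^ k)"

text \<open>The geometric sum (1 - c)(1 + ... + c^(j-1)) + c^j = 1 is averaged over \<open>j\<close>
  under \<open>p\<close>, and its last term averages to \<open>c\<close> by \<open>C_fix\<close>.
  The identity is kept additive because subtraction in \<open>ennreal\<close> truncates.\<close>

lemma \<alpha>_mass: "(\<integral>\<^sup>+k. ennreal (measure_pmf.prob p {k<..} * c ^ k) \<partial>count_space UNIV) = 1"
proof -
  let ?A = "\<integral>\<^sup>+k. ennreal (measure_pmf.prob p {k<..} * c ^ k) \<partial>count_space UNIV"
  have A: "?A = (\<integral>\<^sup>+j. pmf p j * ennreal (\<Sum>k<j. c ^ k) \<partial>count_space UNIV)"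
    using nn_integral_tail[of "\<lambda>k. ennreal (c ^ k)"] c_pos by (simp add: ennreal_mult)
  have gs: "(1 - c) * (\<Sum>k<j. c ^ k) + c ^ j = 1" for j
    using power_diff_1_eq[of c j] by (simp add: algebra_simps)
  have "ennreal (1 - c) * ?A + ennreal c
    = (\<integral>\<^sup>+j. ennreal (1 - c) * (pmf p j * ennreal (\<Sum>k<j. c ^ k)) + pmf p j * C ^ j \<partial>count_space UNIV)"
    unfolding A using C_fix by (subst nn_integral_add) (auto simp: nn_integral_cmult C_eq)
  also have "\<dots> = (\<integral>\<^sup>+j. ennreal (pmf p j) \<partial>count_space UNIV)"
  proof (intro nn_integral_cong)
    fix j
    have nn: "0 \<le> (\<Sum>k<j. c ^ k)" using c_pos by (intro sum_nonneg) auto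
    have "ennreal (1 - c) * (pmf p j * ennreal (\<Sum>k<j. c ^ k)) + pmf p j * C ^ j
      = ennreal ((1 - c) * (pmf p j * (\<Sum>k<j. c ^ k)) + pmf p j * c ^ j)"
      using c_pos c_less_1 nn
      by (simp add: C_eq ennreal_power ennreal_mult[symmetric] ennreal_plus[symmetric] del: ennreal_plus)
    also have "(1 - c) * (pmf p j * (\<Sum>k<j. c ^ k)) + pmf p j * c ^ j
      = pmf p j * ((1 - c) * (\<Sum>k<j. c ^ k) + c ^ j)" by (simp only: algebra_simps)
    finally show "ennreal (1 - c) * (pmf p j * ennreal (\<Sum>k<j. c ^ k)) + pmf p j * C ^ j = ennreal (pmf p j)"
      by (simp only: gs mult_1_right)
  qed
  also have "\<dots> = ennreal (1 - c) * 1 + ennreal c"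
    using c_pos c_less_1 by (simp add: nn_integral_pmf_UNIV ennreal_plus[symmetric] del: ennreal_plus)
  finally have "ennreal (1 - c) * ?A = ennreal (1 - c) * 1"
    by (simp add: add.commute[of _ "ennreal c"] ennreal_add_left_cancel)
  then show "?A = 1" by (subst (asm) ennreal_mult_cancel_left) (use c_less_1 in auto)
qed

lemma pmf_\<alpha>: "pmf \<alpha> k = measure_pmf.prob p {k<..} * c ^ k"
  unfolding \<alpha>_def by (rule pmf_embed_pmf) (use c_pos \<alpha>_mass in auto)

definition m\<alpha> :: ennreal where "m\<alpha> = (\<integral>\<^sup>+k. ennreal (pmf \<alpha> k) * of_nat k \<partial>count_space UNIV)"
definition m\<beta> :: ennreal where "m\<beta> = (\<integral>\<^sup>+k. ennreal (pmf \<beta> k) * of_nat k \<partial>count_space UNIV)"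

text \<open>Partial summation of a geometric series (\<open>gs\<close>), averaged under
  \<open>p\<close>; the right-hand side is \<open>c\<close> times the total mass of \<alpha>. No
  finiteness is presupposed: the identity itself shows that both means are finite, and it links the
  mean size of a bush to that of a tree of law \<beta>.\<close>

lemma m\<alpha>_m\<beta>: "ennreal (1 - c) * m\<alpha> + ennreal c * m\<beta> = ennreal c"
proof -
  have A: "m\<alpha> = (\<integral>\<^sup>+j. pmf p j * ennreal (\<Sum>k<j. c ^ k * real k) \<partial>count_space UNIV)"
  proof -
    have "m\<alpha> = (\<integral>\<^sup>+k. ennreal (measure_pmf.prob p {k<..}) * ennreal (c ^ k * real k) \<partial>count_space UNIV)"
      unfolding m\<alpha>_def pmf_\<alpha> using c_pos
      by (intro nn_integral_cong) (simp add: ennreal_mult[symmetric] mult.assoc ennreal_of_nat_eq_real_of_nat)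
    also have "\<dots> = (\<integral>\<^sup>+j. pmf p j * (\<Sum>k<j. ennreal (c ^ k * real k)) \<partial>count_space UNIV)"
      by (rule nn_integral_tail)
    finally show ?thesis using c_pos by (simp add: sum_ennreal)
  qed
  have B: "ennreal c * m\<beta> = (\<integral>\<^sup>+j. ennreal (pmf p j * (c ^ j * real j)) \<partial>count_space UNIV)"
    unfolding m\<beta>_def using c_pos
    by (subst nn_integral_cmult[symmetric])
      (auto intro!: nn_integral_cong simp: pmf_\<beta> ennreal_mult[symmetric] ennreal_of_nat_eq_real_of_nat)
  have gs: "(1 - c) * (\<Sum>k<j. c ^ k * real k) + c ^ j * real j = c * (\<Sum>k<j. c ^ k)" for j
  proof (induction j)
    case (Suc j)
    have "(1 - c) * (\<Sum>k<Suc j. c ^ k * real k) + c ^ Suc j * real (Suc j)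
      = ((1 - c) * (\<Sum>k<j. c ^ k * real k) + c ^ j * real j) + c * c ^ j"
      unfolding sum.lessThan_Suc by (simp add: algebra_simps del: sum.lessThan_Suc)
    also have "\<dots> = c * (\<Sum>k<Suc j. c ^ k)"
      unfolding Suc by (simp add: distrib_left)
    finally show ?case .
  qed simp
  have "ennreal (1 - c) * m\<alpha> + ennreal c * m\<beta>
    = (\<integral>\<^sup>+j. ennreal (1 - c) * (pmf p j * ennreal (\<Sum>k<j. c ^ k * real k))
        + ennreal (pmf p j * (c ^ j * real j)) \<partial>count_space UNIV)"
    unfolding A B by (subst nn_integral_add) (auto simp: nn_integral_cmult)
  also have "\<dots> = (\<integral>\<^sup>+j. ennreal c * (pmf p j * ennreal (\<Sum>k<j. c ^ k)) \<partial>count_space UNIV)"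
  proof (intro nn_integral_cong)
    fix j
    have nn: "0 \<le> (\<Sum>k<j. c ^ k * real k)" "0 \<le> (\<Sum>k<j. c ^ k)"
      using c_pos by (intro sum_nonneg; simp)+
    have "ennreal (1 - c) * (pmf p j * ennreal (\<Sum>k<j. c ^ k * real k)) + ennreal (pmf p j * (c ^ j * real j))
      = ennreal ((1 - c) * (pmf p j * (\<Sum>k<j. c ^ k * real k)) + pmf p j * (c ^ j * real j))"
      using c_pos c_less_1 nn
      by (simp add: ennreal_mult[symmetric] ennreal_plus[symmetric] del: ennreal_plus)
    also have "(1 - c) * (pmf p j * (\<Sum>k<j. c ^ k * real k)) + pmf p j * (c ^ j * real j)
      = pmf p j * ((1 - c) * (\<Sum>k<j. c ^ k * real k) + c ^ j * real j)" by (simp only: algebra_simps)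
    also have "\<dots> = c * (pmf p j * (\<Sum>k<j. c ^ k))" unfolding gs by (simp only: mult_ac)
    also have "ennreal \<dots> = ennreal c * (pmf p j * ennreal (\<Sum>k<j. c ^ k))"
      using c_pos nn by (simp add: ennreal_mult)
    finally show "ennreal (1 - c) * (pmf p j * ennreal (\<Sum>k<j. c ^ k * real k)) + ennreal (pmf p j * (c ^ j * real j))
      = ennreal c * (pmf p j * ennreal (\<Sum>k<j. c ^ k))" .
  qed
  also have "\<dots> = ennreal c * 1"
    using nn_integral_tail[of "\<lambda>k. ennreal (c ^ k)"] c_pos \<alpha>_mass
    by (simp add: nn_integral_cmult ennreal_mult)
  finally show ?thesis by simp
qed

text \<open>The exponents k - 1 add up to -1 over the vertices of a finite tree, so tilting rescales
  all finite trees by the same factor.\<close>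

lemma weight_\<beta>: "ennreal c * weight (\<lambda>k. ennreal (pmf \<beta> k)) t = weight (\<lambda>k. ennreal (pmf p k)) t"
proof (induction t)
  case (Node ts)
  let ?b = "weight (\<lambda>k. ennreal (pmf \<beta> k))"
  have *: "ennreal c ^ length us * prod_list (map ?b us) = prod_list (map (weight (\<lambda>k. ennreal (pmf p k))) us)"
    if "set us \<subseteq> set ts" for us
    using that by (induction us) (auto simp: Node.IH[symmetric] mult_ac)
  have "ennreal c * pmf \<beta> (length ts) = ennreal c ^ length ts * pmf p (length ts)"
    using c_pos by (simp add: pmf_\<beta> ennreal_mult[symmetric] ennreal_power)
  then have "ennreal c * ?b (Node ts) = ennreal c ^ length ts * prod_list (map ?b ts) * pmf p (length ts)"
    by (simp only: weight_kids[of _ "Node ts"] ptree.sel mult_ac) (simp only: mult.assoc[symmetric])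
  then show ?case by (simp only: *[OF order_refl] weight_kids[of _ "Node ts"] ptree.sel)
qed

lemma weight_\<beta>_sum: "(\<integral>\<^sup>+t. weight (\<lambda>k. ennreal (pmf \<beta> k)) t \<partial>count_space UNIV) = 1"
proof -
  have "ennreal c * (\<integral>\<^sup>+t. weight (\<lambda>k. ennreal (pmf \<beta> k)) t \<partial>count_space UNIV) = ennreal c * 1"
    by (subst nn_integral_cmult[symmetric]) (simp_all add: weight_\<beta> C_def[symmetric] C_eq)
  then show ?thesis by (subst (asm) ennreal_mult_cancel_left) (use c_pos in auto)
qed

definition bush_weight :: "ptree \<Rightarrow> ennreal" where
  "bush_weight t = prod_list (map (weight (\<lambda>k. ennreal (pmf \<beta> k))) (kids t)) * pmf \<alpha> (length (kids t))"

lemma bush_weight_sum: "(\<integral>\<^sup>+t. bush_weight t \<partial>count_space UNIV) = 1"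
  unfolding bush_weight_def nn_integral_kids_prod[where v = "\<lambda>k. ennreal (pmf \<alpha> k)"]
  by (simp add: weight_\<beta>_sum nn_integral_pmf_UNIV)

text \<open>The factor c^k in \<alpha> is absorbed by the \<open>k\<close> subtrees, one
  \<open>c\<close> each. What is left is the probability that independent steps spell the bush, so
  the Kesten tree and the walk give a bush the same weight.\<close>

lemma bush_weight_eq: "bush_weight t = prod_list (map (weight (\<lambda>k. ennreal (pmf p k))) (kids t)) * measure_pmf.prob p {length (kids t)<..}"
proof -
  let ?b = "weight (\<lambda>k. ennreal (pmf \<beta> k))"
  have *: "ennreal c ^ length us * prod_list (map ?b us) = prod_list (map (weight (\<lambda>k. ennreal (pmf p k))) us)" for us
    by (induction us) (auto simp: weight_\<beta>[symmetric] mult_ac)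
  show ?thesis unfolding bush_weight_def *[symmetric] pmf_\<alpha> using c_pos
    by (simp add: ennreal_mult ennreal_power mult_ac)
qed

definition bush_pmf :: "ptree pmf" where
  "bush_pmf = embed_pmf (\<lambda>t. enn2real (bush_weight t))"

lemma pmf_bush_pmf: "ennreal (pmf bush_pmf t) = bush_weight t"
proof -
  have "bush_weight t \<le> 1" for t unfolding bush_weight_sum[symmetric] by (rule nn_integral_ge_point) simp
  then have *: "ennreal (enn2real (bush_weight t)) = bush_weight t" for t
    by (intro ennreal_enn2real) (metis ennreal_one_less_top order.strict_trans1)
  have "pmf bush_pmf t = enn2real (bush_weight t)"
    unfolding bush_pmf_def by (rule pmf_embed_pmf) (simp_all add: * bush_weight_sum)
  then show ?thesis by (simp add: *)
qed

text \<open>Otherwise \<alpha> has no mass at 1, so \<open>p\<close> lives on 0 and 1 and its mean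
  is at most 1. Positivity is what lets a finite mean bush size bound the mean size of the trees
  hanging below the root.\<close>

lemma m\<alpha>_pos: "m\<alpha> \<noteq> 0"
proof
  assume "m\<alpha> = 0"
  then have "AE k in count_space UNIV. ennreal (pmf \<alpha> k) * of_nat k = 0"
    by (subst (asm) m\<alpha>_def, subst (asm) nn_integral_0_iff_AE) auto
  then have "ennreal (pmf \<alpha> 1) * of_nat 1 = 0" unfolding AE_count_space by blast
  then have "measure_pmf.prob p {1<..} = 0" using c_pos by (simp add: pmf_\<alpha>)
  then have "AE k in measure_pmf p. \<not> 1 < k"
    using emeasure_tail[of 1] by (simp add: AE_iff_measurable[OF _ refl] greaterThan_def)
  then have "(\<integral>\<^sup>+k. of_nat k \<partial>measure_pmf p) \<le> (\<integral>\<^sup>+k. 1 \<partial>measure_pmf p)"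
    by (intro nn_integral_mono_AE) (auto elim!: eventually_mono simp: not_less le_Suc_eq)
  then show False using mean by (simp add: measure_pmf.emeasure_space_1[simplified])
qed

text \<open>The assumed bound (from disjointness of events) makes the mean size \<open>e\<close> of a \<open>GW(\<beta>)\<close> tree finite;
  then \<open>e = 1 + m(\<beta>) e\<close> forces \<open>m(\<beta>) < 1\<close>.\<close>

lemma bush_size:
  assumes le: "ennreal (1 - c) * (\<integral>\<^sup>+t. bush_weight t * of_nat (length (post_word t)) \<partial>count_space UNIV) \<le> 1"
  shows "ennreal (1 - c) * (\<integral>\<^sup>+t. bush_weight t * of_nat (length (post_word t)) \<partial>count_space UNIV) = 1"
    and "m\<alpha> < \<infinity>" and "m\<beta> < 1"
proof -
  define SE where "SE = (\<integral>\<^sup>+t. bush_weight t * of_nat (length (post_word t)) \<partial>count_space UNIV)"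
  define e where "e = (\<integral>\<^sup>+t. weight (\<lambda>k. ennreal (pmf \<beta> k)) t * of_nat (length (post_word t)) \<partial>count_space UNIV)"
  have SE: "SE = 1 + m\<alpha> * e"
    unfolding SE_def bush_weight_def e_def m\<alpha>_def
    by (rule nn_integral_kids_sum[OF weight_\<beta>_sum nn_integral_pmf_UNIV])
  have e: "e = 1 + m\<beta> * e"
    unfolding e_def m\<beta>_def
    using nn_integral_kids_sum[OF weight_\<beta>_sum nn_integral_pmf_UNIV[of \<beta>]] by (simp only: weight_kids[where v = "\<lambda>k. ennreal (pmf \<beta> k)", symmetric])
  have c1: "0 < 1 - c" using c_less_1 by simp
  have "SE \<noteq> \<top>" using le c1 by (auto simp: SE_def[symmetric] ennreal_mult_top top_unique)
  then have efin: "e \<noteq> \<top>" using m\<alpha>_pos by (auto simp: SE ennreal_mult_eq_top_iff)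
  have ma: "m\<alpha> \<noteq> \<top>" using m\<alpha>_m\<beta> c1 by (auto simp: ennreal_mult_top)
  have mb: "m\<beta> \<noteq> \<top>" using m\<alpha>_m\<beta> c_pos by (auto simp: ennreal_mult_top)
  obtain a where a: "m\<alpha> = ennreal a" "0 \<le> a" using ma by (cases m\<alpha>) auto
  obtain b where b: "m\<beta> = ennreal b" "0 \<le> b" using mb by (cases m\<beta>) auto
  obtain r where r: "e = ennreal r" "0 \<le> r" using efin by (cases e) auto
  have 1: "(1 - c) * a + c * b = c"
    using m\<alpha>_m\<beta> a b c_pos c1
    by (simp add: ennreal_mult[symmetric] ennreal_plus[symmetric] del: ennreal_plus)
  have 2: "r = 1 + b * r"
  proof -
    have "ennreal r = ennreal (1 + b * r)" using e a b r by (simp add: ennreal_mult)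
    then show ?thesis using b r by (subst (asm) ennreal_inj) auto
  qed
  \<comment> \<open>The product collapses by the relations r (1 - b) = 1 for the mean tree size and
    (1 - c) a = c (1 - b) for the two offspring means.\<close>
  have "(1 - c) * (1 + a * r) = (1 - c) + ((1 - c) * a) * r" by (simp add: algebra_simps)
  also have "(1 - c) * a = c * (1 - b)" using 1 by (simp add: algebra_simps)
  also have "(1 - c) + c * (1 - b) * r = (1 - c) + c * (r - b * r)" by (simp add: algebra_simps)
  also have "r - b * r = 1" using 2 by simp
  finally have "(1 - c) * (1 + a * r) = 1" by simp
  then have "ennreal (1 - c) * (1 + ennreal a * ennreal r) = 1"
    using c1 a r by (simp add: ennreal_mult[symmetric] ennreal_1[symmetric] ennreal_plus[symmetric] del: ennreal_plus ennreal_1)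
  then show "ennreal (1 - c) * (\<integral>\<^sup>+t. bush_weight t * of_nat (length (post_word t)) \<partial>count_space UNIV) = 1"
    unfolding SE_def[symmetric] SE a r .
  show "m\<alpha> < \<infinity>" using ma by (simp add: top.not_eq_extremum)
  have "0 < r * (1 - b)" using 2 by (simp add: algebra_simps)
  then have "b < 1" using r by (simp add: zero_less_mult_iff)
  then show "m\<beta> < 1" by (simp add: b ennreal_less_one_iff)
qed

end

section \<open>Codes of trees\<close>

text \<open>Linearity is asked among siblings only: the orders used for the Kesten tree compare
  keys, and vertices with different parents may share a key.\<close>

definition sib_linear :: "'v set \<Rightarrow> ('v \<Rightarrow> 'v option) \<Rightarrow> ('v \<Rightarrow> 'v \<Rightarrow> bool) \<Rightarrow> bool" where
  "sib_linear V par lt \<longleftrightarrow> (\<forall>a. \<not> lt a a) \<and> (\<forall>a b c. lt a b \<longrightarrow> lt b c \<longrightarrow> lt a c) \<and>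
    (\<forall>x. \<forall>a\<in>children V par x. \<forall>b\<in>children V par x. a \<noteq> b \<longrightarrow> lt a b \<or> lt b a)"

lemma sib_pos_inj:
  assumes "sib_linear V par lt" "sib_pos V par lt x a = Some j" "sib_pos V par lt x b = Some j"
  shows "a = b"
proof (rule ccontr)
  assume "a \<noteq> b"
  let ?S = "\<lambda>a. {c \<in> children V par x. lt c a}"
  have fin: "finite (?S a)" "finite (?S b)" and card: "card (?S a) = card (?S b)"
    and ch: "a \<in> children V par x" "b \<in> children V par x"
    using assms(2,3) by (auto simp: sib_pos_def split: if_splits)
  have irr: "\<not> lt a a" "\<not> lt b b" and tr: "\<And>a b c. lt a b \<Longrightarrow> lt b c \<Longrightarrow> lt a c" and "lt a b \<or> lt b a"
    using assms(1) ch \<open>a \<noteq> b\<close> unfolding sib_linear_def by blast+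
  then consider "lt a b" | "lt b a" by blast
  then show False
  proof cases
    case 1
    then have "?S a \<subset> ?S b" using tr irr ch by blast
    from psubset_card_mono[OF fin(2) this] show False using card by simp
  next
    case 2
    then have "?S b \<subset> ?S a" using tr irr ch by blast
    from psubset_card_mono[OF fin(1) this] show False using card by simp
  qed
qed

lemma child_at_eq_Some:
  assumes "sib_linear V par lt"
  shows "child_at V par lt x j = Some a \<longleftrightarrow> sib_pos V par lt x a = Some j"
proof -
  have "(THE c. sib_pos V par lt x c = Some j) = a" if "sib_pos V par lt x a = Some j" for a
    using that sib_pos_inj[OF assms] by (intro the_equality) auto
  then show ?thesis by (auto simp: child_at_def)
qed

text \<open>Finiteness and cardinality are expressed by an enumerating list. Lists over a countable
  type are countable, so measurability follows from countable quantifiers.\<close>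

lemma sib_pos_eq_Some:
  "sib_pos V par lt x a = Some n \<longleftrightarrow> a \<in> V \<and> par a = Some x \<and>
    (\<exists>vs. distinct vs \<and> length vs = n \<and> (\<forall>v. v \<in> set vs \<longleftrightarrow> v \<in> V \<and> par v = Some x \<and> lt v a))"
proof -
  let ?S = "{c \<in> children V par x. lt c a}"
  have eq: "set vs = ?S \<longleftrightarrow> (\<forall>v. v \<in> set vs \<longleftrightarrow> v \<in> V \<and> par v = Some x \<and> lt v a)" for vs
    unfolding children_def by blast
  have "finite ?S \<and> card ?S = n \<longleftrightarrow> (\<exists>vs. distinct vs \<and> length vs = n \<and> set vs = ?S)"
  proof (intro iffI)
    assume S: "finite ?S \<and> card ?S = n"
    then obtain vs where vs: "set vs = ?S" "distinct vs" using finite_distinct_list[of ?S] by blast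
    then have "length vs = n" using distinct_card[OF vs(2)] S by simp
    with vs show "\<exists>vs. distinct vs \<and> length vs = n \<and> set vs = ?S" by blast
  next
    assume "\<exists>vs. distinct vs \<and> length vs = n \<and> set vs = ?S"
    then obtain vs where "distinct vs" "length vs = n" and S: "?S = set vs" by auto
    then show "finite ?S \<and> card ?S = n" unfolding S by (simp add: distinct_card)
  qed
  moreover have "sib_pos V par lt x a = Some n \<longleftrightarrow> a \<in> V \<and> par a = Some x \<and> finite ?S \<and> card ?S = n"
    by (cases "a \<in> children V par x \<and> finite ?S") (auto simp: sib_pos_def, auto simp: children_def)
  ultimately show ?thesis unfolding eq by (simp only:)
qed

lemma bind_eq_Some': "Option.bind f g = Some b \<longleftrightarrow> (\<exists>a. f = Some a \<and> g a = Some b)"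
  by (cases f) auto

lemma measurable_option_iff:
  fixes f :: "'a \<Rightarrow> 'v::countable option"
  assumes "\<And>v. Measurable.pred M (\<lambda>\<omega>. f \<omega> = Some v)"
  shows "f \<in> measurable M (count_space UNIV)"
proof -
  have "Measurable.pred M (\<lambda>\<omega>. f \<omega> = a)" for a
  proof (cases a)
    case None
    note [measurable] = assms
    have "Measurable.pred M (\<lambda>\<omega>. \<forall>v. \<not> f \<omega> = Some v)" by measurable
    moreover have "(\<lambda>\<omega>. \<forall>v. \<not> f \<omega> = Some v) = (\<lambda>\<omega>. f \<omega> = None)"
      by (auto simp: fun_eq_iff)
    ultimately show ?thesis unfolding None by simp
  qed (use assms in simp)
  then show ?thesis
    by (subst measurable_count_space_eq2_countable) (auto simp: pred_def vimage_def Int_def conj_commute)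
qed

text \<open>Each coordinate of the code is built from statements of the form
  \<open>... = Some v\<close>, and binding them only adds quantifiers over the countable vertex
  type.\<close>

lemma measurable_tree_code:
  fixes V :: "'a \<Rightarrow> 'v::countable set"
  assumes V: "\<And>v. Measurable.pred M (\<lambda>\<omega>. v \<in> V \<omega>)"
    and par: "\<And>v w. Measurable.pred M (\<lambda>\<omega>. par \<omega> v = Some w)"
    and lt: "\<And>v w. Measurable.pred M (\<lambda>\<omega>. lt \<omega> v w)"
    and lin: "\<And>\<omega>. sib_linear (V \<omega>) (par \<omega>) (lt \<omega>)"
  shows "(\<lambda>\<omega>. tree_code (V \<omega>) (par \<omega>) (lt \<omega>) r) \<in> measurable M code_space"
proof -
  note [measurable] = V par lt
  have sib [measurable]: "Measurable.pred M (\<lambda>\<omega>. sib_pos (V \<omega>) (par \<omega>) (lt \<omega>) x a = Some n)" for x a n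
    unfolding sib_pos_eq_Some by measurable
  have child [measurable]: "Measurable.pred M (\<lambda>\<omega>. child_at (V \<omega>) (par \<omega>) (lt \<omega>) x j = Some a)" for x a j
    unfolding child_at_eq_Some[OF lin] by measurable
  have down [measurable]: "Measurable.pred M (\<lambda>\<omega>. down (V \<omega>) (par \<omega>) (lt \<omega>) x w = Some y)" for x w y
  proof (induction w arbitrary: x)
    case (Cons j w)
    note [measurable] = Cons
    show ?case unfolding down.simps bind_eq_Some' by measurable
  qed simp
  have anc [measurable]: "Measurable.pred M (\<lambda>\<omega>. anc (par \<omega>) r k = Some y)" for k y
  proof (induction k arbitrary: y)
    case (Suc k)
    note [measurable] = Suc
    show ?case unfolding anc.simps bind_eq_Some' by measurable
  qed simp
  have 1: "Measurable.pred M (\<lambda>\<omega>. Option.bind (anc (par \<omega>) r k) (\<lambda>a. down (V \<omega>) (par \<omega>) (lt \<omega>) a w) \<noteq> None)" for k w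
    unfolding not_None_eq bind_eq_Some' by measurable
  have 2: "(\<lambda>\<omega>. Option.bind (anc (par \<omega>) r k) (\<lambda>a. Option.bind (par \<omega> a) (\<lambda>b. sib_pos (V \<omega>) (par \<omega>) (lt \<omega>) b a)))
     \<in> measurable M (count_space UNIV)" for k
    by (rule measurable_option_iff, unfold bind_eq_Some', measurable)
  show ?thesis
    unfolding tree_code_def code_space_def
    by (intro measurable_Pair measurable_PiM_single') (auto simp: 1[simplified] 2 split: prod.split)
qed

text \<open>A bijection commuting with the parent maps; that it maps the children of a vertex onto the children of its
  image is then automatic.\<close>

locale tree_iso =
  fixes V :: "'v set" and par lt and V' :: "'w set" and par' lt' and g :: "'v \<Rightarrow> 'w"
  assumes bij: "bij_betw g V V'"
    and par_in: "\<And>v w. v \<in> V \<Longrightarrow> par v = Some w \<Longrightarrow> w \<in> V"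
    and par': "\<And>v. v \<in> V \<Longrightarrow> par' (g v) = map_option g (par v)"
    and lt': "\<And>x a b. a \<in> V \<Longrightarrow> b \<in> V \<Longrightarrow> par a = Some x \<Longrightarrow> par b = Some x \<Longrightarrow> lt' (g a) (g b) \<longleftrightarrow> lt a b"
    and lin: "sib_linear V par lt" and lin': "sib_linear V' par' lt'"
begin

lemma g_eq: "a \<in> V \<Longrightarrow> b \<in> V \<Longrightarrow> g a = g b \<longleftrightarrow> a = b"
  using bij by (auto simp: bij_betw_def inj_on_def)

lemma children_g: "x \<in> V \<Longrightarrow> children V' par' (g x) = g ` children V par x"
proof (intro set_eqI iffI)
  fix w assume x: "x \<in> V" and "w \<in> children V' par' (g x)"
  then obtain v where v: "v \<in> V" "w = g v" "par' w = Some (g x)"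
    using bij by (auto simp: children_def bij_betw_def)
  then obtain y where "par v = Some y" "g y = g x" using par'[of v] by auto
  then show "w \<in> g ` children V par x" using v x par_in[of v y] g_eq by (auto simp: children_def)
next
  fix w assume "x \<in> V" "w \<in> g ` children V par x"
  then show "w \<in> children V' par' (g x)"
    using bij par' by (auto simp: children_def bij_betw_def)
qed

lemma sib_pos_g:
  assumes "x \<in> V" "c \<in> V"
  shows "sib_pos V' par' lt' (g x) (g c) = sib_pos V par lt x c"
proof (cases "c \<in> children V par x")
  case True
  have "{w \<in> children V' par' (g x). lt' w (g c)} = g ` {v \<in> children V par x. lt v c}"
    unfolding children_g[OF assms(1)] using True lt' by (auto simp: children_def)
  moreover have "inj_on g {v \<in> children V par x. lt v c}"
    using bij by (auto simp: bij_betw_def inj_on_def children_def)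
  ultimately show ?thesis
    using True children_g[OF assms(1)] by (auto simp: sib_pos_def card_image finite_image_iff)
next
  case False
  then have "g c \<notin> children V' par' (g x)"
    using assms unfolding children_g[OF assms(1)] by (auto simp: children_def g_eq)
  then show ?thesis using False by (simp add: sib_pos_def)
qed

lemma child_at_g:
  assumes "x \<in> V"
  shows "child_at V' par' lt' (g x) j = map_option g (child_at V par lt x j)"
proof (cases "child_at V par lt x j")
  case (Some c)
  then have s: "sib_pos V par lt x c = Some j" by (simp add: child_at_eq_Some[OF lin])
  then have "c \<in> V" by (auto simp: sib_pos_def children_def split: if_splits)
  then show ?thesis using s Some assms by (simp add: child_at_eq_Some[OF lin'] sib_pos_g)
next
  case None
  have "child_at V' par' lt' (g x) j \<noteq> Some w" for w
  proof
    assume "child_at V' par' lt' (g x) j = Some w"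
    then have s: "sib_pos V' par' lt' (g x) w = Some j" by (simp add: child_at_eq_Some[OF lin'])
    then have "w \<in> V'" by (auto simp: sib_pos_def children_def split: if_splits)
    then obtain v where v: "v \<in> V" "w = g v" using bij by (auto simp: bij_betw_def)
    with s assms have "child_at V par lt x j = Some v" by (simp add: child_at_eq_Some[OF lin] sib_pos_g)
    then show False using None by simp
  qed
  then show ?thesis using None by (cases "child_at V' par' lt' (g x) j") auto
qed

lemma child_at_in: "child_at V par lt x j = Some c \<Longrightarrow> c \<in> V"
  by (auto simp: child_at_eq_Some[OF lin] sib_pos_def children_def split: if_splits)

lemma down_g: "x \<in> V \<Longrightarrow> down V' par' lt' (g x) w = map_option g (down V par lt x w)"
proof (induction w arbitrary: x)
  case (Cons j w)
  then show ?case
    by (cases "child_at V par lt x j") (auto simp: child_at_g child_at_in)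
qed simp

lemma anc_g: "r \<in> V \<Longrightarrow> anc par' (g r) k = map_option g (anc par r k) \<and> (\<forall>a. anc par r k = Some a \<longrightarrow> a \<in> V)"
proof (induction k)
  case (Suc k)
  then show ?case by (cases "anc par r k") (auto simp: par' par_in)
qed simp

lemma tree_code_g:
  assumes "r \<in> V"
  shows "tree_code V' par' lt' (g r) = tree_code V par lt r"
proof -
  have "Option.bind (anc par' (g r) k) (\<lambda>a. down V' par' lt' a w) \<noteq> None \<longleftrightarrow>
    Option.bind (anc par r k) (\<lambda>a. down V par lt a w) \<noteq> None" for k w
    using anc_g[OF assms, of k] by (cases "anc par r k") (auto simp: down_g)
  moreover have "Option.bind (anc par' (g r) k) (\<lambda>a. Option.bind (par' a) (\<lambda>b. sib_pos V' par' lt' b a))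
    = Option.bind (anc par r k) (\<lambda>a. Option.bind (par a) (\<lambda>b. sib_pos V par lt b a))" for k
  proof (cases "anc par r k")
    case None
    then show ?thesis using anc_g[OF assms, of k] by simp
  next
    case (Some a)
    then have "a \<in> V" using anc_g[OF assms, of k] by blast
    then show ?thesis using Some anc_g[OF assms, of k] by (cases "par a") (auto simp: par' sib_pos_g par_in)
  qed
  ultimately show ?thesis by (simp add: tree_code_def)
qed

end

section \<open>The record graph as a sequence of bushes\<close>

text \<open>This is \<open>ekt_key\<close> with the identity for every permutation. Key 0 belongs to
  the spine child o_(i-1), hence the shift by one for the other children of a spine vertex.\<close>

definition canon_key :: "int \<times> nat list \<Rightarrow> nat" where
  "canon_key v = (if snd v = [] then 0 else if length (snd v) = 1 then Suc (hd (snd v)) else last (snd v))"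

definition canon_verts :: "(int \<Rightarrow> ptree) \<Rightarrow> (int \<times> nat list) set" where
  "canon_verts f = {(i, p). is_path (f i) p}"

definition canon_code :: "(int \<Rightarrow> ptree) \<Rightarrow> int \<times> nat list \<Rightarrow> tcode" where
  "canon_code f v = tree_code (canon_verts f) ekt_par (\<lambda>a b. canon_key a < canon_key b) v"

lemma ekt_par_eq_Some:
  "ekt_par a = Some x \<longleftrightarrow> (\<exists>i. a = (i, []) \<and> x = (i + 1, [])) \<or> (\<exists>i q j. a = (i, q @ [j]) \<and> x = (i, q))"
proof -
  obtain i p where a: "a = (i, p)" by (cases a)
  show ?thesis by (cases p rule: rev_cases) (auto simp: a ekt_par_def)
qed

lemma canon_key_snoc: "canon_key (i, q @ [j]) = (if q = [] then Suc j else j)"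
  by (auto simp: canon_key_def)

lemma sib_linear_canon: "sib_linear V ekt_par (\<lambda>a b. canon_key a < canon_key b)"
proof -
  have "a = b" if a: "ekt_par a = Some x" and b: "ekt_par b = Some x" and key: "canon_key a = canon_key b" for a b x
    using a[unfolded ekt_par_eq_Some] b[unfolded ekt_par_eq_Some]
  proof (elim disjE exE conjE)
    fix i q j i' q' j'
    assume "a = (i, q @ [j])" "x = (i, q)" "b = (i', q' @ [j'])" "x = (i', q')"
    then show "a = b" using key by (simp add: canon_key_snoc split: if_splits)
  qed (use key in \<open>auto simp: canon_key_def\<close>)
  then show ?thesis unfolding sib_linear_def children_def by (auto simp: linorder_neq_iff[symmetric]) 
qed

lemma measurable_canon_code:
  "(\<lambda>f. canon_code f v) \<in> measurable (PiM UNIV (\<lambda>_. count_space UNIV)) code_space"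
proof -
  have "Measurable.pred (PiM UNIV (\<lambda>_. count_space UNIV)) (\<lambda>f. w \<in> canon_verts f)" for w
  proof -
    obtain i p where w: "w = (i, p)" by (cases w)
    have "(\<lambda>f. is_path (f i) p) \<in> measurable (PiM UNIV (\<lambda>_. count_space UNIV)) (count_space UNIV)"
      by (rule measurable_compose[OF measurable_component_singleton]) auto
    then show ?thesis by (simp add: w canon_verts_def)
  qed
  then show ?thesis unfolding canon_code_def
    by (intro measurable_tree_code sib_linear_canon) auto
qed

text \<open>The position in \<open>\<int>\<close> of the spine vertex \<open>o_i\<close>, given that \<open>0\<close> is the vertex \<open>p\<close> of the bush of \<open>o_0\<close>.\<close>

definition bush_end :: "(int \<Rightarrow> ptree) \<Rightarrow> nat list \<Rightarrow> int \<Rightarrow> int" where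
  "bush_end f p i = (\<Sum>j\<in>{0..i}. int (length (post_word (f j)))) - (\<Sum>j\<in>{i<..-1}. int (length (post_word (f j))))
     - int (pos (f 0) p)"

lemma bush_end_step: "bush_end f p i = bush_end f p (i - 1) + int (length (post_word (f i)))"
proof (cases "0 \<le> i")
  case True
  then have "{0..i} = insert i {0..i - 1}" "{i<..-1} = {}" "{i - 1<..-1} = {}" by auto
  then show ?thesis by (simp add: bush_end_def)
next
  case False
  then have "{i - 1<..-1} = insert i {i<..-1}" "{0..i} = {}" "{0..i - 1} = {}" by auto
  then show ?thesis by (simp add: bush_end_def)
qed

lemma bush_end_Suc: "bush_end f p (i + 1) = bush_end f p i + int (length (post_word (f (i + 1))))"
  using bush_end_step[of f p "i + 1"] by simp

lemma bush_end_minus_1: "bush_end f p (-1) = - int (pos (f 0) p)"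
  by (simp add: bush_end_def)

lemma bush_end_0: "bush_end f p 0 = int (length (post_word (f 0))) - int (pos (f 0) p)"
  by (simp add: bush_end_def)

lemma bush_end_cong:
  assumes "\<And>j. - int n \<le> j \<Longrightarrow> j \<le> int n \<Longrightarrow> f j = f' j" "- int n - 1 \<le> i" "i \<le> int n"
  shows "bush_end f p i = bush_end f' p i"
proof -
  have "(\<Sum>j\<in>{0..i}. int (length (post_word (f j)))) = (\<Sum>j\<in>{0..i}. int (length (post_word (f' j))))"
    "(\<Sum>j\<in>{i<..-1}. int (length (post_word (f j)))) = (\<Sum>j\<in>{i<..-1}. int (length (post_word (f' j))))"
    using assms by (auto intro!: sum.cong)
  moreover have "f 0 = f' 0" using assms(1)[of 0] by simp
  ultimately show ?thesis by (simp add: bush_end_def)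
qed

lemma bush_end_less: "bush_end f p (i - 1) < bush_end f p i"
  using bush_end_step[of f p i] length_post_word_pos[of "f i"] by simp

lemma bush_end_mono: "i \<le> j \<Longrightarrow> bush_end f p i \<le> bush_end f p j"
proof (induction j rule: int_ge_induct)
  case (step j)
  then show ?case using bush_end_less[of f p "j + 1"] by simp
qed simp

section \<open>Finite windows of bushes and their uniqueness\<close>

definition window :: "nat \<Rightarrow> (int \<Rightarrow> int) \<Rightarrow> (int \<Rightarrow> ptree) \<Rightarrow> nat list \<Rightarrow> bool" where
  "window n x f p \<longleftrightarrow> is_path (f 0) p \<and> left_record x (bush_end f p (- int n - 1)) \<and>
     (\<forall>i. - int n \<le> i \<and> i \<le> int n \<longrightarrow> spells x (bush_end f p (i - 1)) (bush_pattern (f i)))"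

text \<open>This is why \<open>window\<close> asks for a left record at its left end only. That
  condition concerns the past of the window, while the words concern later steps, which is the form
  in which probabilities factorise.\<close>

lemma window_left_record:
  assumes "window n x f p" "- int n - 1 \<le> i" "i \<le> int n"
  shows "left_record x (bush_end f p i)"
  using assms(2,3)
proof (induction i rule: int_ge_induct)
  case base
  then show ?case using assms(1) by (simp add: window_def)
next
  case (step i)
  then have "spells x (bush_end f p i) (bush_pattern (f (i + 1)))"
    using assms(1) by (auto simp: window_def dest!: spec[of _ "i + 1"])
  with step show ?case by (auto simp: bush_end_Suc intro: left_record_bush_pattern)
qed

lemma window_mono: "window n x f p \<Longrightarrow> m \<le> n \<Longrightarrow> window m x f p"
  unfolding window_def[of m] using window_left_record[of n x f p "- int m - 1"] by (auto simp: window_def)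

lemma window_cong:
  assumes "\<And>j. - int n \<le> j \<Longrightarrow> j \<le> int n \<Longrightarrow> f j = f' j"
  shows "window n x f p \<longleftrightarrow> window n x f' p"
proof -
  have o: "bush_end f p i = bush_end f' p i" if "- int n - 1 \<le> i" "i \<le> int n" for i
    using bush_end_cong[OF assms that] .
  show ?thesis
    unfolding window_def using assms o by (auto simp: assms[of 0])
qed

text \<open>If the two ends differed, the smaller one would be a left record strictly inside the
  other bush.\<close>

lemma bush_end_unique:
  assumes "spells x a (bush_pattern t)" "left_record x (a + int (length (post_word t)))"
    and "spells x a (bush_pattern u)" "left_record x (a + int (length (post_word u)))"
  shows "t = u"
proof (rule bush_pattern_unique[OF assms(1,3)])
  show "length (post_word t) = length (post_word u)"
    using not_left_record_bush_pattern[OF assms(1), of "a + int (length (post_word u))"] length_post_word_pos[of u]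
      not_left_record_bush_pattern[OF assms(3), of "a + int (length (post_word t))"] length_post_word_pos[of t] assms
    by (cases "length (post_word t)" "length (post_word u)" rule: linorder_cases) auto
qed

lemma bush_start_unique:
  assumes "spells x a (bush_pattern t)" "left_record x a" "spells x b (bush_pattern u)" "left_record x b"
    and "a + int (length (post_word t)) = b + int (length (post_word u))"
  shows "t = u \<and> a = b"
proof -
  have "a = b"
    using not_left_record_bush_pattern[OF assms(1), of b] not_left_record_bush_pattern[OF assms(3), of a]
      length_post_word_pos[of u] length_post_word_pos[of t] assms
    by (cases a b rule: linorder_cases) auto
  then show ?thesis using bush_pattern_unique[OF assms(1)] assms by auto
qed

lemma window_bush: "window n x f p \<Longrightarrow> - int n \<le> i \<Longrightarrow> i \<le> int n \<Longrightarrow>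
    spells x (bush_end f p (i - 1)) (bush_pattern (f i)) \<and> left_record x (bush_end f p (i - 1)) \<and> left_record x (bush_end f p i)"
  using window_left_record[of n x f p] by (auto simp: window_def)

text \<open>The central bush is the one that covers 0, which fixes its left end and the address of 0
  in it. Agreement then spreads bush by bush, to the right by \<open>bush_end_unique\<close> and to
  the left by \<open>bush_start_unique\<close>.\<close>

lemma window_unique:
  assumes f: "window n x f p" and f': "window n x f' p'"
  shows "p = p'" and "- int n \<le> i \<Longrightarrow> i \<le> int n \<Longrightarrow> f i = f' i"
proof -
  have o: "bush_end f p (-1) < 0" "0 \<le> bush_end f p 0" "bush_end f' p' (-1) < 0" "0 \<le> bush_end f' p' 0"
    using pos_bounds[of "f 0" p] pos_bounds[of "f' 0" p'] f f' by (auto simp: window_def bush_end_minus_1 bush_end_0)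
  have s: "bush_end f p 0 = bush_end f p (-1) + int (length (post_word (f 0)))"
    "bush_end f' p' 0 = bush_end f' p' (-1) + int (length (post_word (f' 0)))"
    using bush_end_step[of f p 0] bush_end_step[of f' p' 0] by auto
  have b: "spells x (bush_end f p (-1)) (bush_pattern (f 0))" "left_record x (bush_end f p (-1))" "left_record x (bush_end f p 0)"
    "spells x (bush_end f' p' (-1)) (bush_pattern (f' 0))" "left_record x (bush_end f' p' (-1))" "left_record x (bush_end f' p' 0)"
    using window_bush[OF f, of 0] window_bush[OF f', of 0] by auto
  \<comment> \<open>Both left ends are negative and both right ends are nonnegative, so the larger
    left end would lie strictly inside the other bush.\<close>
  have start: "bush_end f p (-1) = bush_end f' p' (-1)"
    using not_left_record_bush_pattern[OF b(1), of "bush_end f' p' (-1)"] not_left_record_bush_pattern[OF b(4), of "bush_end f p (-1)"] b o s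
    by (cases "bush_end f p (-1)" "bush_end f' p' (-1)" rule: linorder_cases) auto
  have f0: "f 0 = f' 0"
    by (rule bush_end_unique[of x "bush_end f p (-1)"]) (use b s start in auto)
  then have "pos (f 0) p = pos (f 0) p'" using start by (simp add: bush_end_minus_1)
  then show "p = p'" using pos_inj[of "f 0" p p'] f f' f0 by (auto simp: window_def)
  have up: "f i = f' i \<and> bush_end f p i = bush_end f' p' i" if "0 \<le> i" "i \<le> int n" for i
    using that
  proof (induction i rule: int_ge_induct)
    case base
    then show ?case using f0 start s by simp
  next
    case (step i)
    then have "f (i + 1) = f' (i + 1)"
      using window_bush[OF f, of "i + 1"] window_bush[OF f', of "i + 1"]
        bush_end_unique[of x "bush_end f p i" "f (i + 1)" "f' (i + 1)"] by (simp add: bush_end_Suc)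
    with step show ?case by (simp add: bush_end_Suc)
  qed
  have down: "f i = f' i \<and> bush_end f p (i - 1) = bush_end f' p' (i - 1)" if "i \<le> 0" "- int n \<le> i" for i
    using that
  proof (induction i rule: int_le_induct)
    case base
    then show ?case using f0 start by simp
  next
    case (step i)
    then show ?case
      using window_bush[OF f, of "i - 1"] window_bush[OF f', of "i - 1"]
        bush_end_step[of f p "i - 1"] bush_end_step[of f' p' "i - 1"]
        bush_start_unique[of x "bush_end f p (i - 1 - 1)" "f (i - 1)" "bush_end f' p' (i - 1 - 1)" "f' (i - 1)"]
      by simp
  qed
  show "- int n \<le> i \<Longrightarrow> i \<le> int n \<Longrightarrow> f i = f' i"
    using up[of i] down[of i] by (cases "0 \<le> i") auto
qed

text \<open>By uniqueness larger windows extend smaller ones, so the bush number \<open>i\<close>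
  may be taken from the first window that contains it.\<close>

lemma windows_glue:
  assumes "\<And>n. \<exists>f p. window n x f p"
  shows "\<exists>f p. \<forall>n. window n x f p"
proof -
  obtain F P where FP: "\<And>n. window n x (F n) (P n)" using assms by metis
  define f where "f i = F (nat \<bar>i\<bar>) i" for i
  have "window n x f (P 0)" for n
  proof -
    have "P 0 = P n" using window_unique(1)[OF FP window_mono[OF FP, of 0 n]] by simp
    moreover have "f j = F n j" if "- int n \<le> j" "j \<le> int n" for j
      unfolding f_def using that
      by (intro window_unique(2)[OF FP window_mono[OF FP]]) auto
    ultimately show ?thesis using FP window_cong[of n f "F n"] by auto
  qed
  then show ?thesis by blast
qed

text \<open>Bushes are nonempty, so their ends move by at least one per index and exhaust the
  integers in both directions.\<close>

lemma bush_end_bracket: "\<exists>i. bush_end f p (i - 1) < n \<and> n \<le> bush_end f p i"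
proof -
  have far: "bush_end f p (- int k - 1) \<le> bush_end f p (-1) - int k \<and> bush_end f p 0 + int k \<le> bush_end f p (int k)" for k
  proof (induction k)
    case (Suc k)
    then show ?case
      using bush_end_less[of f p "- int k - 1"] bush_end_less[of f p "int k + 1"] by (simp add: algebra_simps)
  qed simp
  have "bush_end f p (- int k - 1) < n \<Longrightarrow> n \<le> bush_end f p (int k) \<Longrightarrow> ?thesis" for k
  proof (induction k)
    case 0
    then show ?case by (intro exI[of _ 0]) simp
  next
    case (Suc k)
    consider "n \<le> bush_end f p (- int k - 1)" | "bush_end f p (int k) < n"
      | "bush_end f p (- int k - 1) < n" "n \<le> bush_end f p (int k)" by linarith
    then show ?case
    proof cases
      case 1
      with Suc.prems show ?thesis by (intro exI[of _ "- int k - 1"]) (simp add: algebra_simps)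
    next
      case 2
      with Suc.prems show ?thesis by (intro exI[of _ "int k + 1"]) (simp add: algebra_simps)
    qed (use Suc.IH in auto)
  qed
  moreover define k where "k = nat (\<bar>n - bush_end f p (-1)\<bar> + \<bar>n - bush_end f p 0\<bar> + 1)"
  then have "bush_end f p (- int k - 1) < n" "n \<le> bush_end f p (int k)" using far[of k] by linarith+
  ultimately show ?thesis by blast
qed

lemma record_code_eq:
  assumes w: "\<And>n. window n x f p"
  shows "record_code x = canon_code f (0, p)"
proof -
  \<comment> \<open>Vertex \<open>q\<close> of bush \<open>i\<close> goes to its postorder position
    counted from the left end of the bush. The shift built into \<open>bush_end\<close> sends
    \<open>(0, p)\<close> to 0.\<close>
  define g where "g v = bush_end f p (fst v - 1) + int (pos (f (fst v)) (snd v))" for v :: "int \<times> nat list"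
  have b: "spells x (bush_end f p (i - 1)) (bush_pattern (f i))" for i
    using window_bush[OF w, of "nat \<bar>i\<bar>" i] by simp
  have gb: "bush_end f p (fst v - 1) < g v \<and> g v \<le> bush_end f p (fst v)" if "v \<in> canon_verts f" for v
    using that pos_bounds[of "f (fst v)" "snd v"] bush_end_step[of f p "fst v"]
    by (auto simp: g_def canon_verts_def)
  have lt1: "g a < g b" if "a \<in> canon_verts f" "b \<in> canon_verts f" "fst a < fst b" for a b
    using gb[OF that(1)] gb[OF that(2)] bush_end_mono[of "fst a" "fst b - 1" f p] that(3) by simp
  have root: "g (i, []) = bush_end f p i" for i using bush_end_step[of f p i] by (simp add: g_def)
  interpret tree_iso "canon_verts f" ekt_par "\<lambda>a b. canon_key a < canon_key b" UNIV "record_par x" "(<)" g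
  proof
    show "bij_betw g (canon_verts f) UNIV"
      unfolding bij_betw_def
    proof
      show "inj_on g (canon_verts f)"
      proof (rule inj_onI)
        fix a b assume ab: "a \<in> canon_verts f" "b \<in> canon_verts f" "g a = g b"
        then have "fst a = fst b" using lt1[of a b] lt1[of b a] by (cases "fst a" "fst b" rule: linorder_cases) auto
        with ab show "a = b" using pos_inj[of "f (fst a)" "snd a" "snd b"]
          by (cases a, cases b) (auto simp: g_def canon_verts_def)
      qed
      have "n \<in> g ` canon_verts f" for n
      proof -
        obtain i where i: "bush_end f p (i - 1) < n" "n \<le> bush_end f p i" using bush_end_bracket by blast
        then have "0 < nat (n - bush_end f p (i - 1))" "nat (n - bush_end f p (i - 1)) \<le> length (post_word (f i))"
          using bush_end_step[of f p i] by linarith+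
        then obtain q where "is_path (f i) q" "pos (f i) q = nat (n - bush_end f p (i - 1))"
          using pos_surj by blast
        then have "(i, q) \<in> canon_verts f" "n = g (i, q)" using i by (auto simp: canon_verts_def g_def)
        then show ?thesis by blast
      qed
      then show "g ` canon_verts f = UNIV" by blast
    qed
    show "w \<in> canon_verts f" if "v \<in> canon_verts f" "ekt_par v = Some w" for v w
      using that unfolding ekt_par_eq_Some by (auto simp: canon_verts_def is_path_snoc)
    show "record_par x (g v) = map_option g (ekt_par v)" if "v \<in> canon_verts f" for v
    proof -
      obtain i q where v: "v = (i, q)" by (cases v)
      show ?thesis
      proof (cases "q = []")
        case True
        then show ?thesis
          using record_par_bush_pattern[OF b[of "i + 1"]] bush_end_step[of f p "i + 1"] by (simp add: v root ekt_par_def)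
      next
        case False
        then show ?thesis
          using record_par_fits_tree[OF fits_tree_bush_pattern[OF b[of i]], of q] that
          by (simp add: v g_def ekt_par_def canon_verts_def)
      qed
    qed
    show "sib_linear (canon_verts f) ekt_par (\<lambda>a b. canon_key a < canon_key b)"
      by (rule sib_linear_canon)
    show "sib_linear UNIV (record_par x) (<)" by (auto simp: sib_linear_def)
    have lt: "g a < g b" if ab: "a \<in> canon_verts f" "b \<in> canon_verts f"
      "ekt_par a = Some z" "ekt_par b = Some z" "canon_key a < canon_key b" for a b z
    proof -
      \<comment> \<open>A larger key than that of a sibling is positive, so \<open>b\<close> is not
        a spine vertex. Its sibling \<open>a\<close> is then either the spine child, which ends an
        earlier bush, or a child inside the same bush.\<close>
      obtain i q j where b: "b = (i, q @ [j])" "z = (i, q)"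
        using ab(4,5) unfolding ekt_par_eq_Some by (auto simp: canon_key_def)
      from ab(3) b consider "fst a < i" | k where "a = (i, q @ [k])"
        unfolding ekt_par_eq_Some by auto
      then show ?thesis
      proof cases
        case 1
        then show ?thesis using lt1[OF ab(1,2)] b by simp
      next
        case (2 k)
        then have "k < j" using ab(5) b by (auto simp: canon_key_snoc split: if_splits)
        then show ?thesis using pos_snoc_less[of "f i" q k j] ab(1,2) b 2 by (simp add: g_def canon_verts_def)
      qed
    qed
    show "(g a < g b) = (canon_key a < canon_key b)" if ab: "a \<in> canon_verts f" "b \<in> canon_verts f"
      "ekt_par a = Some z" "ekt_par b = Some z" for a b z
    proof -
      have "a = b \<or> canon_key a < canon_key b \<or> canon_key b < canon_key a"
        using sib_linear_canon[of "canon_verts f"] ab unfolding sib_linear_def children_def by blast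
      then show ?thesis using lt[OF ab] lt[OF ab(2,1,4,3)] by fastforce
    qed
  qed
  have "(0, p) \<in> canon_verts f" using w[of 0] by (simp add: window_def canon_verts_def)
  from tree_code_g[OF this] show ?thesis
    by (simp add: record_code_def canon_code_def g_def bush_end_minus_1)
qed

section \<open>Laws of bush sequences\<close>

abbreviation "int_window n \<equiv> {- int n..int n}"

abbreviation seq_space :: "(int \<Rightarrow> 'v) measure" where
  "seq_space \<equiv> PiM UNIV (\<lambda>_. count_space UNIV)"

lemma space_seq_space [simp]: "space seq_space = UNIV"
  by (simp add: space_PiM)

text \<open>Window data are indexed by functions that are undefined outside the window, since only
  these form a countable family.\<close>

lemma countable_window_funs: "countable (PiE (int_window n) (\<lambda>_. UNIV :: 'v::countable set))"
  by (intro countable_PiE) auto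

lemma window_fun_ex: "\<exists>h\<in>PiE (int_window n) (\<lambda>_. UNIV). \<forall>i\<in>int_window n. h i = g i"
  by (rule bexI[of _ "restrict g (int_window n)"]) auto

lemma window_fun_eq:
  assumes "h \<in> PiE (int_window n) (\<lambda>_. UNIV)" "h' \<in> PiE (int_window n) (\<lambda>_. UNIV)"
    and "\<And>i. i \<in> int_window n \<Longrightarrow> h i = h' i"
  shows "h = h'"
  by (rule PiE_ext[OF assms])

lemma sets_window_cylinder [measurable]:
  "{g. \<forall>i\<in>int_window n. g i = h i} \<in> sets (seq_space :: (int \<Rightarrow> 'v::countable) measure)"
proof -
  have "Measurable.pred seq_space (\<lambda>g. g i = h i)" for i
    by (rule measurable_compose[OF measurable_component_singleton[of i]]) auto
  then have "Measurable.pred seq_space (\<lambda>g. \<forall>i\<in>int_window n. g i = h i)" by measurable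
  then show ?thesis by (simp add: pred_def)
qed

text \<open>Since the values are countable, every finite-dimensional cylinder is a countable
  disjoint union of cylinders that fix all values on a symmetric window. Thus no product structure
  is presupposed for either measure.\<close>

lemma measure_eq_windows:
  fixes N1 N2 :: "(int \<Rightarrow> 'v::countable) measure"
  assumes sets: "sets N1 = sets seq_space" "sets N2 = sets seq_space"
    and fin: "finite_measure N1"
    and eq: "\<And>n h. emeasure N1 {g. \<forall>i\<in>int_window n. g i = h i} = emeasure N2 {g. \<forall>i\<in>int_window n. g i = h i}"
  shows "N1 = N2"
proof (rule measure_eqI_PiM_infinite[OF sets])
  fix A :: "int \<Rightarrow> 'v set" and J :: "int set"
  assume J: "finite J"
  define n where "n = Max (insert 0 ((\<lambda>i. nat \<bar>i\<bar>) ` J))"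
  have Jn: "J \<subseteq> int_window n"
  proof
    fix i assume "i \<in> J"
    then have "nat \<bar>i\<bar> \<le> n" unfolding n_def using J by (intro Max_ge) auto
    then show "i \<in> int_window n" by auto
  qed
  define H where "H = {h \<in> PiE (int_window n) (\<lambda>_. UNIV). \<forall>i\<in>J. h i \<in> A i}"
  let ?C = "\<lambda>h. {g. \<forall>i\<in>int_window n. g i = h i}"
  have H: "countable H" unfolding H_def by (rule countable_subset[OF _ countable_window_funs[of n]]) auto
  have eqU: "prod_emb UNIV (\<lambda>_. count_space UNIV) J (PiE J A) = \<Union>(?C ` H)"
  proof (intro set_eqI iffI)
    fix g assume "g \<in> prod_emb UNIV (\<lambda>_. count_space UNIV) J (PiE J A)"
    then have g: "\<forall>i\<in>J. g i \<in> A i" by (auto simp: prod_emb_def restrict_PiE_iff)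
    have "restrict g (int_window n) \<in> H" using g Jn by (auto simp: H_def)
    moreover have "g \<in> ?C (restrict g (int_window n))" by simp
    ultimately show "g \<in> \<Union>(?C ` H)" by blast
  next
    fix g assume "g \<in> \<Union>(?C ` H)"
    then obtain h where h: "h \<in> H" "\<forall>i\<in>int_window n. g i = h i" by blast
    then have "\<forall>i\<in>J. g i \<in> A i" using Jn by (auto simp: H_def)
    then show "g \<in> prod_emb UNIV (\<lambda>_. count_space UNIV) J (PiE J A)"
      by (auto simp: prod_emb_def restrict_PiE_iff)
  qed
  have disj: "disjoint_family_on ?C H"
  proof (unfold disjoint_family_on_def, intro ballI impI)
    fix h h' assume hh: "h \<in> H" "h' \<in> H" "h \<noteq> h'"
    then obtain i where i: "i \<in> int_window n" "h i \<noteq> h' i"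
      using window_fun_eq[of h n h'] by (auto simp: H_def)
    then show "?C h \<inter> ?C h' = {}" by auto
  qed
  have "emeasure N1 (\<Union>(?C ` H)) = (\<integral>\<^sup>+h. emeasure N1 (?C h) \<partial>count_space H)"
    by (rule emeasure_UN_countable[OF _ H disj]) (simp only: sets sets_window_cylinder)
  moreover have "emeasure N2 (\<Union>(?C ` H)) = (\<integral>\<^sup>+h. emeasure N2 (?C h) \<partial>count_space H)"
    by (rule emeasure_UN_countable[OF _ H disj]) (simp only: sets sets_window_cylinder)
  ultimately show "emeasure N1 (prod_emb UNIV (\<lambda>_. count_space UNIV) J (PiE J A))
      = emeasure N2 (prod_emb UNIV (\<lambda>_. count_space UNIV) J (PiE J A))"
    unfolding eqU by (simp add: eq)
qed (use fin in simp_all)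

context offspring
begin

definition bush_law :: "(int \<Rightarrow> ptree) measure" where
  "bush_law = PiM UNIV (\<lambda>_. measure_pmf bush_pmf)"

lemma sets_bush_law: "sets bush_law = sets seq_space"
  unfolding bush_law_def by (intro sets_PiM_cong) auto

lemma space_bush_law: "space bush_law = UNIV"
  using sets_eq_imp_space_eq[OF sets_bush_law] by simp

lemma emeasure_bush_law_window:
  "emeasure bush_law {g. \<forall>i\<in>int_window n. g i = h i} = (\<Prod>i\<in>int_window n. bush_weight (h i))"
proof -
  interpret product_prob_space "\<lambda>_::int. measure_pmf bush_pmf" UNIV by standard
  show ?thesis
    using emeasure_PiM_Collect[of "int_window n" "\<lambda>i. {h i}"]
    by (simp add: bush_law_def[symmetric] space_bush_law emeasure_pmf_single pmf_bush_pmf)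
qed

lemma sets_bush_law_path: "{g. is_path (g i) q} \<in> sets bush_law"
proof -
  have "Measurable.pred seq_space (\<lambda>g::int \<Rightarrow> ptree. is_path (g i) q)"
    by (rule measurable_compose[OF measurable_component_singleton[of i]]) auto
  then show ?thesis by (simp add: sets_bush_law pred_def)
qed

text \<open>The same probability is expanded over windows of any size \<open>n\<close>, to match the
  sum of window probabilities in \<open>window_total\<close>.\<close>

lemma emeasure_bush_law_path:
  "emeasure bush_law {g. is_path (g 0) q}
    = (\<integral>\<^sup>+h. indicator {h. is_path (h 0) q} h * (\<Prod>i\<in>int_window n. bush_weight (h i)) \<partial>count_space (PiE (int_window n) (\<lambda>_. UNIV)))"
proof -
  let ?H = "{h \<in> PiE (int_window n) (\<lambda>_. UNIV). is_path (h 0) q}"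
  let ?C = "\<lambda>h. {g. \<forall>i\<in>int_window n. g i = h i}"
  have 0: "0 \<in> int_window n" by simp
  have "{g. is_path (g 0) q} = \<Union>(?C ` ?H)"
  proof (intro set_eqI iffI)
    fix g :: "int \<Rightarrow> ptree" assume "g \<in> {g. is_path (g 0) q}"
    then have "restrict g (int_window n) \<in> ?H" "g \<in> ?C (restrict g (int_window n))" by auto
    then show "g \<in> \<Union>(?C ` ?H)" by blast
  next
    fix g assume "g \<in> \<Union>(?C ` ?H)"
    then show "g \<in> {g. is_path (g 0) q}" using 0 by auto
  qed
  moreover have "disjoint_family_on ?C ?H"
  proof (unfold disjoint_family_on_def, intro ballI impI)
    fix h h' assume hh: "h \<in> ?H" "h' \<in> ?H" "h \<noteq> h'"
    then obtain i where i: "i \<in> int_window n" "h i \<noteq> h' i"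
      using window_fun_eq[of h n h'] by auto
    then show "?C h \<inter> ?C h' = {}" by auto
  qed
  moreover have "countable ?H" by (rule countable_subset[OF _ countable_window_funs[of n]]) auto
  ultimately have "emeasure bush_law {g. is_path (g 0) q} = (\<integral>\<^sup>+h. emeasure bush_law (?C h) \<partial>count_space ?H)"
    by (simp only:) (rule emeasure_UN_countable, simp_all only: sets_bush_law sets_window_cylinder)
  also have "\<dots> = (\<integral>\<^sup>+h. (\<Prod>i\<in>int_window n. bush_weight (h i)) \<partial>count_space ?H)"
    by (simp only: emeasure_bush_law_window)
  also have "\<dots> = (\<integral>\<^sup>+h. indicator {h. is_path (h 0) q} h * (\<Prod>i\<in>int_window n. bush_weight (h i)) \<partial>count_space (PiE (int_window n) (\<lambda>_. UNIV)))"
  proof -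
    have "(\<integral>\<^sup>+h. (\<Prod>i\<in>int_window n. bush_weight (h i)) \<partial>count_space ?H)
      = (\<integral>\<^sup>+h. indicator {h. is_path (h 0) q} h * (\<Prod>i\<in>int_window n. bush_weight (h i)) \<partial>count_space ?H)"
      by (rule nn_integral_cong) (simp add: indicator_def)
    also have "\<dots> = (\<integral>\<^sup>+h. indicator {h. is_path (h 0) q} h * (\<Prod>i\<in>int_window n. bush_weight (h i)) \<partial>count_space (PiE (int_window n) (\<lambda>_. UNIV)))"
      by (rule nn_integral_count_space_eq) (auto simp: indicator_def)
    finally show ?thesis .
  qed
  finally show ?thesis .
qed

text \<open>After exchanging the sums, a tree is counted once for each of its vertices; this is
  where size-biasing enters.\<close>

lemma nn_integral_bush_law_path:
  "(\<integral>\<^sup>+q. emeasure bush_law {g. is_path (g 0) q} \<partial>count_space UNIV)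
    = (\<integral>\<^sup>+t. bush_weight t * of_nat (length (post_word t)) \<partial>count_space UNIV)"
proof -
  interpret product_prob_space "\<lambda>_::int. measure_pmf bush_pmf" UNIV by standard
  have "emeasure bush_law {g. is_path (g 0) q} = (\<integral>\<^sup>+t. bush_weight t * indicator {t. is_path t q} t \<partial>count_space UNIV)" for q
  proof -
    have "emeasure bush_law {g. is_path (g 0) q} = emeasure (measure_pmf bush_pmf) {t. is_path t q}"
      using emeasure_PiM_Collect_single[of 0 "{t. is_path t q}"] by (simp add: bush_law_def[symmetric] space_bush_law)
    also have "\<dots> = (\<integral>\<^sup>+t. indicator {t. is_path t q} t \<partial>measure_pmf bush_pmf)" by simp
    also have "\<dots> = (\<integral>\<^sup>+t. bush_weight t * indicator {t. is_path t q} t \<partial>count_space UNIV)"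
      by (simp only: nn_integral_measure_pmf pmf_bush_pmf)
    finally show ?thesis .
  qed
  then have "(\<integral>\<^sup>+q. emeasure bush_law {g. is_path (g 0) q} \<partial>count_space UNIV)
    = (\<integral>\<^sup>+q. \<integral>\<^sup>+t. bush_weight t * indicator {t. is_path t q} t \<partial>count_space UNIV \<partial>count_space UNIV)" by simp
  also have "\<dots> = (\<integral>\<^sup>+t. \<integral>\<^sup>+q. bush_weight t * indicator {t. is_path t q} t \<partial>count_space UNIV \<partial>count_space UNIV)"
    using nn_integral_fst_count_space[of "\<lambda>(q, t). bush_weight t * indicator {t. is_path t q} t"]
      nn_integral_snd_count_space[of "\<lambda>(q, t). bush_weight t * indicator {t. is_path t q} t"] by simp
  also have "\<dots> = (\<integral>\<^sup>+t. bush_weight t * of_nat (length (post_word t)) \<partial>count_space UNIV)"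
  proof (intro nn_integral_cong)
    fix t
    have *: "indicator {t. is_path t q} t = (indicator {q. is_path t q} q :: ennreal)" for q
      by (simp add: indicator_def)
    show "(\<integral>\<^sup>+q. bush_weight t * indicator {t. is_path t q} t \<partial>count_space UNIV) = bush_weight t * of_nat (length (post_word t))"
      unfolding * by (simp add: nn_integral_cmult card_paths)
  qed
  finally show ?thesis .
qed

end

text \<open>The only probabilistic input is the probability of spelling a pattern. This form is
  passed on easily to the reflected sequence, for which \<open>hit_c_eq\<close> instantiates the
  locale a second time.\<close>

locale iid_record = prob_space M + offspring p for M :: "'a measure" and p +
  fixes X :: "int \<Rightarrow> 'a \<Rightarrow> int"
  assumes X_meas: "\<And>n. X n \<in> measurable M (count_space UNIV)"
    and X_ge: "\<And>n \<omega>. \<omega> \<in> space M \<Longrightarrow> -1 \<le> X n \<omega>"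
    and spells_prob: "\<And>a ds. emeasure M {\<omega> \<in> space M. spells (\<lambda>n. X n \<omega>) a ds}
        = prod_list (map (\<lambda>d. emeasure (measure_pmf p) {k. int k - 1 \<in> d}) ds)"
begin

abbreviation x :: "'a \<Rightarrow> int \<Rightarrow> int" where "x \<omega> \<equiv> \<lambda>n. X n \<omega>"

definition pr :: "int set list \<Rightarrow> ennreal" where
  "pr ds = prod_list (map (\<lambda>d. emeasure (measure_pmf p) {k. int k - 1 \<in> d}) ds)"

lemma pr_append: "pr (ds @ es) = pr ds * pr es"
  by (simp add: pr_def)

lemma pr_words: "pr (map (\<lambda>k. {int k - 1}) ks) = prod_list (map (\<lambda>k. ennreal (pmf p k)) ks)"
proof -
  have "{k'. int k' - 1 \<in> {int k - 1}} = {k}" for k by auto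
  then show ?thesis by (simp add: pr_def comp_def emeasure_pmf_single)
qed

lemma pr_tree_pattern: "pr (tree_pattern t) = weight (\<lambda>k. ennreal (pmf p k)) t"
  unfolding tree_pattern_def pr_words weight_def ..

lemma pr_bush_pattern: "pr (bush_pattern t) = bush_weight t"
proof -
  have "{k. int k - 1 \<in> {int (length (kids t))..}} = {length (kids t)<..}" by auto
  then show ?thesis
    unfolding bush_pattern_def pr_append forest_pattern_def pr_words bush_weight_eq prod_list_forest_word by (simp add: pr_def emeasure_tail)
qed

lemma spells_meas [measurable]: "Measurable.pred M (\<lambda>\<omega>. spells (x \<omega>) a ds)"
proof (induction ds arbitrary: a)
  case (Cons d ds)
  note [measurable] = Cons X_meas
  show ?case by simp
qed simp

lemma left_record_iff: "\<omega> \<in> space M \<Longrightarrow> left_record (x \<omega>) a \<longleftrightarrow> (\<forall>t. \<not> spells (x \<omega>) (a - int (length (post_word t))) (tree_pattern t))"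
  using not_left_record_iff[of "x \<omega>" a] X_ge by blast

lemma left_record_meas [measurable]: "Measurable.pred M (\<lambda>\<omega>. left_record (x \<omega>) a)"
  by (subst measurable_cong[OF left_record_iff]) measurable

text \<open>The event splits according to the tree that ends at \<open>a\<close>. Its word followed
  by \<open>ds\<close> is a single longer pattern, so independence of past and future comes out of
  \<open>spells_prob\<close>.\<close>

lemma not_left_record_prob:
  "emeasure M {\<omega> \<in> space M. \<not> left_record (x \<omega>) a \<and> spells (x \<omega>) a ds} = C * pr ds"
proof -
  let ?S = "\<lambda>t. {\<omega> \<in> space M. spells (x \<omega>) (a - int (length (post_word t))) (tree_pattern t @ ds)}"
  have "{\<omega> \<in> space M. \<not> left_record (x \<omega>) a \<and> spells (x \<omega>) a ds} = (\<Union>t. ?S t)"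
    by (auto simp: left_record_iff spells_append)
  also have "emeasure M \<dots> = (\<integral>\<^sup>+t. emeasure M (?S t) \<partial>count_space UNIV)"
  proof (rule emeasure_UN_countable)
    show "disjoint_family_on ?S UNIV"
      by (auto simp: disjoint_family_on_def spells_append dest: spells_tree_pattern_unique)
  qed auto
  also have "\<dots> = (\<integral>\<^sup>+t. weight (\<lambda>k. ennreal (pmf p k)) t * pr ds \<partial>count_space UNIV)"
    unfolding spells_prob pr_def[symmetric] pr_append pr_tree_pattern ..
  finally show ?thesis by (simp add: nn_integral_multc C_def)
qed

text \<open>The complement of \<open>not_left_record_prob\<close> inside the event that
  \<open>ds\<close> is spelled; the cancellation is legitimate because \<open>pr ds\<close> is
  finite.\<close>

lemma left_record_prob:
  "emeasure M {\<omega> \<in> space M. left_record (x \<omega>) a \<and> spells (x \<omega>) a ds} = ennreal (1 - c) * pr ds"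
proof -
  let ?L = "{\<omega> \<in> space M. left_record (x \<omega>) a \<and> spells (x \<omega>) a ds}"
  let ?N = "{\<omega> \<in> space M. \<not> left_record (x \<omega>) a \<and> spells (x \<omega>) a ds}"
  have "emeasure M ?L + emeasure M ?N = emeasure M (?L \<union> ?N)"
    by (rule plus_emeasure) auto
  also have "?L \<union> ?N = {\<omega> \<in> space M. spells (x \<omega>) a ds}" by blast
  finally have 1: "emeasure M ?L + ennreal c * pr ds = pr ds"
    by (simp add: not_left_record_prob C_eq spells_prob pr_def[symmetric])
  have "pr ds \<le> 1" unfolding pr_def spells_prob[symmetric, where a = 0] by (rule emeasure_le_1)
  then obtain r where r: "pr ds = ennreal r" "0 \<le> r" by (cases "pr ds") (auto simp: top_unique)
  have "ennreal c * pr ds + ennreal (1 - c) * pr ds = (ennreal c + ennreal (1 - c)) * pr ds"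
    by (simp only: distrib_right)
  also have "\<dots> = pr ds" using c_pos c_less_1 by (simp add: ennreal_plus[symmetric] del: ennreal_plus)
  finally have "ennreal c * pr ds + emeasure M ?L = ennreal c * pr ds + ennreal (1 - c) * pr ds"
    using 1 by (simp add: add.commute)
  then show ?thesis using r by (subst (asm) ennreal_add_left_cancel) (auto simp: ennreal_mult_eq_top_iff)
qed

lemma spells_concat_bushes:
  "spells y (bush_end f q (l - 1)) (concat (map (\<lambda>i. bush_pattern (f i)) [l..h])) \<longleftrightarrow>
    (\<forall>i. l \<le> i \<and> i \<le> h \<longrightarrow> spells y (bush_end f q (i - 1)) (bush_pattern (f i)))"
  if "l - 1 \<le> h"
proof -
  \<comment> \<open>The second conjunct says where the concatenated word ends, which the induction
    needs for appending the next bush.\<close>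
  have "(spells y (bush_end f q (l - 1)) (concat (map (\<lambda>i. bush_pattern (f i)) [l..h])) \<longleftrightarrow>
    (\<forall>i. l \<le> i \<and> i \<le> h \<longrightarrow> spells y (bush_end f q (i - 1)) (bush_pattern (f i)))) \<and>
    bush_end f q (l - 1) + int (length (concat (map (\<lambda>i. bush_pattern (f i)) [l..h]))) = bush_end f q h"
    using that
  proof (induction h rule: int_ge_induct)
    case (step h)
    then have u: "[l..h + 1] = [l..h] @ [h + 1]" using upto_rec2[of l "h + 1"] by simp
    have "(\<forall>i. l \<le> i \<and> i \<le> h + 1 \<longrightarrow> P i) \<longleftrightarrow> (\<forall>i. l \<le> i \<and> i \<le> h \<longrightarrow> P i) \<and> P (h + 1)" for P
    proof (intro iffI conjI allI impI)
      fix i assume "(\<forall>i. l \<le> i \<and> i \<le> h \<longrightarrow> P i) \<and> P (h + 1)" "l \<le> i \<and> i \<le> h + 1"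
      then show "P i" by (cases "i = h + 1") auto
    qed (use step(1) in auto)
    then show ?case using step by (simp add: u spells_append bush_end_Suc)
  qed auto
  then show ?thesis by blast
qed

lemma window_prob:
  "emeasure M {\<omega> \<in> space M. window n (x \<omega>) f q}
    = ennreal (1 - c) * (indicator {h. is_path (h 0) q} f * (\<Prod>i\<in>int_window n. bush_weight (f i)))"
proof (cases "is_path (f 0) q")
  case True
  let ?ds = "concat (map (\<lambda>i. bush_pattern (f i)) [- int n..int n])"
  have "{\<omega> \<in> space M. window n (x \<omega>) f q}
    = {\<omega> \<in> space M. left_record (x \<omega>) (bush_end f q (- int n - 1)) \<and> spells (x \<omega>) (bush_end f q (- int n - 1)) ?ds}"
    by (subst spells_concat_bushes) (auto simp: window_def True)
  also have "emeasure M \<dots> = ennreal (1 - c) * pr ?ds" by (rule left_record_prob)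
  also have "pr ?ds = prod_list (map (\<lambda>i. bush_weight (f i)) [- int n..int n])"
  proof -
    have "pr (concat (map (\<lambda>i. bush_pattern (f i)) js)) = prod_list (map (\<lambda>i. bush_weight (f i)) js)" for js
      by (induction js) (simp_all add: pr_append pr_bush_pattern, simp add: pr_def)
    then show ?thesis .
  qed
  also have "\<dots> = (\<Prod>i\<in>int_window n. bush_weight (f i))"
    by (subst prod.distinct_set_conv_list[symmetric]) auto
  finally show ?thesis using True by simp
qed (simp add: window_def)

end

lemma ysum_of_int: "real_of_int (ysum y j k) = (\<Sum>l\<in>{j..<k}. real_of_int (y l))"
  by (simp add: ysum_def)

lemma record_par_eq_Some:
  "record_par y i = Some b \<longleftrightarrow> i < b \<and> 0 \<le> ysum y i b \<and> (\<forall>n. i < n \<longrightarrow> n < b \<longrightarrow> ysum y i n < 0)"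
proof
  assume r: "record_par y i = Some b"
  then have ne: "record_map y i \<noteq> i" and b: "record_map y i = b" by (auto simp: record_par_def split: if_splits)
  then have ex: "\<exists>n>i. 0 \<le> ysum y i n" by (auto simp: record_map_def split: if_splits)
  then obtain n0 where n0: "n0 > i" "0 \<le> ysum y i n0" by blast
  \<comment> \<open>The integers are not well-ordered, so the least time is sought over natural
    offsets, with offset 0 standing for \<open>i + 1\<close>.\<close>
  let ?P = "\<lambda>k. 0 \<le> ysum y i (i + 1 + int k)"
  have "?P (nat (n0 - i - 1))" using n0 by simp
  then have P: "?P (LEAST k. ?P k)" by (rule LeastI[where P = ?P])
  define k where "k = (LEAST k. ?P k)"
  have neg: "ysum y i n < 0" if "i < n" "n < i + 1 + int k" for n
  proof -
    have "nat (n - i - 1) < k" using that by simp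
    then have "\<not> ?P (nat (n - i - 1))" unfolding k_def by (rule not_less_Least[where P = ?P])
    then show ?thesis using that by simp
  qed
  have "record_par y i = Some (i + 1 + int k)"
    using P neg by (intro record_par_eqI) (auto simp: k_def)
  with r show "i < b \<and> 0 \<le> ysum y i b \<and> (\<forall>n. i < n \<longrightarrow> n < b \<longrightarrow> ysum y i n < 0)"
    using P neg by (auto simp: k_def)
qed (auto intro: record_par_eqI)

context iid_record
begin

lemma record_code_meas: "(\<lambda>\<omega>. record_code (x \<omega>)) \<in> measurable M code_space"
  unfolding record_code_def
proof (rule measurable_tree_code)
  have [measurable]: "(\<lambda>\<omega>. real_of_int (X n \<omega>)) \<in> borel_measurable M" for n
    by (rule measurable_compose[OF X_meas]) simp
  have eq: "0 \<le> ysum (x \<omega>) j k \<longleftrightarrow> 0 \<le> (\<Sum>l\<in>{j..<k}. real_of_int (X l \<omega>))" for \<omega> j k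
    unfolding ysum_of_int[symmetric] by simp
  have [measurable]: "Measurable.pred M (\<lambda>\<omega>. 0 \<le> ysum (x \<omega>) j k)" for j k
    unfolding eq by measurable
  show "Measurable.pred M (\<lambda>\<omega>. record_par (x \<omega>) v = Some w)" for v w
    unfolding record_par_eq_Some not_le[symmetric] by measurable
  show "sib_linear UNIV (record_par (x \<omega>)) (<)" for \<omega> by (auto simp: sib_linear_def)
qed auto

section \<open>Total mass of the windows and the almost sure decomposition\<close>

abbreviation "win_funs n \<equiv> PiE (int_window n) (\<lambda>_. UNIV :: ptree set)"

lemma window_meas [measurable]: "Measurable.pred M (\<lambda>\<omega>. window n (x \<omega>) f q)"
  unfolding window_def by measurable

text \<open>Only the values inside the window matter, so a quantifier over all sequences of bushes
  becomes a countable one.\<close>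

lemma window_ex_iff:
  "(\<exists>f q. window n y f q) \<longleftrightarrow> (\<exists>z\<in>UNIV \<times> win_funs n. window n y (snd z) (fst z))"
proof
  assume "\<exists>f q. window n y f q"
  then obtain f q where w: "window n y f q" by blast
  obtain h where h: "h \<in> win_funs n" "\<forall>i\<in>int_window n. h i = f i"
    using window_fun_ex[of n f] by (elim bexE)
  have "window n y h q = window n y f q" by (rule window_cong) (use h(2) in auto)
  then have "window n y h q" using w by blast
  with h(1) show "\<exists>z\<in>UNIV \<times> win_funs n. window n y (snd z) (fst z)"
    by (intro bexI[of _ "(q, h)"]) simp_all
qed blast

lemma countable_win_funs: "countable (win_funs n)"
  by (rule countable_window_funs)

text \<open>By \<open>window_unique\<close> different data give disjoint events, so their
  probabilities add up. Summing over the address of 0 counts the central bush by its size, and the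
  other bushes integrate to 1; hence the value is the same for all \<open>n\<close>.\<close>

lemma window_total:
  "emeasure M {\<omega> \<in> space M. \<exists>f q. window n (x \<omega>) f q}
    = ennreal (1 - c) * (\<integral>\<^sup>+t. bush_weight t * of_nat (length (post_word t)) \<partial>count_space UNIV)"
proof -
  let ?S = "\<lambda>z. {\<omega> \<in> space M. window n (x \<omega>) (snd z) (fst z)}"
  have "{\<omega> \<in> space M. \<exists>f q. window n (x \<omega>) f q} = \<Union>(?S ` (UNIV \<times> win_funs n))"
    unfolding window_ex_iff by blast
  also have "emeasure M \<dots> = (\<integral>\<^sup>+z. emeasure M (?S z) \<partial>count_space (UNIV \<times> win_funs n))"
  proof (rule emeasure_UN_countable)
    show "disjoint_family_on ?S (UNIV \<times> win_funs n)"
    proof (unfold disjoint_family_on_def, intro ballI impI, rule ccontr)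
      fix z z' assume z: "z \<in> UNIV \<times> win_funs n" "z' \<in> UNIV \<times> win_funs n" "z \<noteq> z'" and "?S z \<inter> ?S z' \<noteq> {}"
      then obtain \<omega> where "window n (x \<omega>) (snd z) (fst z)" "window n (x \<omega>) (snd z') (fst z')" by blast
      note w = window_unique[OF this]
      have "snd z = snd z'" using z w(2) by (intro window_fun_eq[of "snd z" n "snd z'"]) auto
      with w(1) z(3) show False by (simp add: prod_eq_iff)
    qed
    show "countable ((UNIV :: nat list set) \<times> win_funs n)" by (intro countable_SIGMA countable_win_funs countableI_type)
  qed measurable
  also have "\<dots> = (\<integral>\<^sup>+z. ennreal (1 - c) * (indicator {h. is_path (h 0) (fst z)} (snd z) * (\<Prod>i\<in>int_window n. bush_weight (snd z i)))
      \<partial>(count_space UNIV \<Otimes>\<^sub>M count_space (win_funs n)))"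
    unfolding window_prob using countable_win_funs
    by (subst pair_measure_countable) (auto simp del: UNIV_Times_UNIV)
  also have "\<dots> = (\<integral>\<^sup>+q. \<integral>\<^sup>+h. ennreal (1 - c) * (indicator {h. is_path (h 0) q} h * (\<Prod>i\<in>int_window n. bush_weight (h i)))
      \<partial>count_space (win_funs n) \<partial>count_space UNIV)"
  proof -
    interpret sigma_finite_measure "count_space (win_funs n)"
      using countable_win_funs by (rule sigma_finite_measure_count_space_countable)
    show ?thesis
    proof (subst nn_integral_fst[symmetric])
      show "(\<lambda>z. ennreal (1 - c) * (indicator {h. is_path (h 0) (fst z)} (snd z) * (\<Prod>i\<in>int_window n. bush_weight (snd z i))))
        \<in> borel_measurable (count_space UNIV \<Otimes>\<^sub>M count_space (win_funs n))"
        using countable_win_funs by (subst pair_measure_countable) auto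
    qed simp
  qed
  also have "\<dots> = (\<integral>\<^sup>+q. ennreal (1 - c) * emeasure bush_law {g. is_path (g 0) q} \<partial>count_space UNIV)"
    by (simp add: nn_integral_cmult emeasure_bush_law_path[of _ n])
  also have "\<dots> = ennreal (1 - c) * (\<integral>\<^sup>+t. bush_weight t * of_nat (length (post_word t)) \<partial>count_space UNIV)"
    by (simp add: nn_integral_cmult nn_integral_bush_law_path)
  finally show ?thesis .
qed

text \<open>Windows with distinct data are disjoint events, so their total mass is at most 1.\<close>

lemma bush_size_le: "ennreal (1 - c) * (\<integral>\<^sup>+t. bush_weight t * of_nat (length (post_word t)) \<partial>count_space UNIV) \<le> 1"
  unfolding window_total[of 0, symmetric] by (rule emeasure_le_1)

lemmas bush_size' = bush_size[OF bush_size_le]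

lemma windows_ex_meas [measurable]: "Measurable.pred M (\<lambda>\<omega>. \<exists>f q. window n (x \<omega>) f q)"
proof -
  have "{\<omega> \<in> space M. \<exists>f q. window n (x \<omega>) f q}
      = (\<Union>z\<in>UNIV \<times> win_funs n. {\<omega> \<in> space M. window n (x \<omega>) (snd z) (fst z)})"
    unfolding window_ex_iff by blast
  also have "\<dots> \<in> sets M"
    by (intro sets.countable_UN'' countable_SIGMA countable_win_funs countableI_type) measurable
  finally show ?thesis by (simp add: pred_def)
qed

lemma AE_windows: "AE \<omega> in M. \<exists>f q. \<forall>n. window n (x \<omega>) f q"
proof -
  have "AE \<omega> in M. \<exists>f q. window n (x \<omega>) f q" for n
  proof (rule AE_I_eq_1)
    show "{\<omega> \<in> space M. \<exists>f q. window n (x \<omega>) f q} \<in> sets M" by measurable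
    show "emeasure M {\<omega> \<in> space M. \<exists>f q. window n (x \<omega>) f q} = 1"
      unfolding window_total by (rule bush_size')
  qed
  then have "AE \<omega> in M. \<forall>n. \<exists>f q. window n (x \<omega>) f q" by (simp add: AE_all_countable)
  then show ?thesis by (rule AE_mp) (auto intro!: AE_I2 windows_glue)
qed

section \<open>Law of the bush sequence for a given address of 0\<close>

definition good :: "'a \<Rightarrow> bool" where
  "good \<omega> \<longleftrightarrow> (\<forall>n. \<exists>f q. window n (x \<omega>) f q)"

text \<open>The constant value outside \<open>good\<close> keeps the choice measurable. The address
  needs no such default, as it is only consulted together with \<open>good\<close>.\<close>

definition bush_seq :: "'a \<Rightarrow> int \<Rightarrow> ptree" where
  "bush_seq \<omega> = (if good \<omega> then SOME f. \<exists>q. \<forall>n. window n (x \<omega>) f q else (\<lambda>_. Node []))"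

definition root_addr :: "'a \<Rightarrow> nat list" where
  "root_addr \<omega> = (SOME q. \<forall>n. window n (x \<omega>) (bush_seq \<omega>) q)"

lemma window_bush_seq:
  assumes "good \<omega>"
  shows "window n (x \<omega>) (bush_seq \<omega>) (root_addr \<omega>)"
proof -
  have "\<exists>f q. \<forall>n. window n (x \<omega>) f q" using assms unfolding good_def by (intro windows_glue) blast
  then have "\<exists>q. \<forall>n. window n (x \<omega>) (bush_seq \<omega>) q"
    using someI_ex[of "\<lambda>f. \<exists>q. \<forall>n. window n (x \<omega>) f q"] assms by (simp add: bush_seq_def)
  then show ?thesis unfolding root_addr_def using someI_ex[of "\<lambda>q. \<forall>n. window n (x \<omega>) (bush_seq \<omega>) q"] by blast
qed

text \<open>On \<open>good\<close> the chosen objects are described by window events, so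
  measurability and laws can be handled without reference to the choice operator.\<close>

lemma window_iff:
  assumes "good \<omega>"
  shows "window n (x \<omega>) h q \<longleftrightarrow> root_addr \<omega> = q \<and> (\<forall>i\<in>int_window n. bush_seq \<omega> i = h i)"
proof
  assume "window n (x \<omega>) h q"
  note window_unique[OF window_bush_seq[OF assms] this]
  then show "root_addr \<omega> = q \<and> (\<forall>i\<in>int_window n. bush_seq \<omega> i = h i)" by auto
next
  assume *: "root_addr \<omega> = q \<and> (\<forall>i\<in>int_window n. bush_seq \<omega> i = h i)"
  have "window n (x \<omega>) (bush_seq \<omega>) q = window n (x \<omega>) h q"
    by (rule window_cong) (use * in auto)
  then show "window n (x \<omega>) h q" using window_bush_seq[OF assms, of n] * by simp
qed

lemma good_meas [measurable]: "Measurable.pred M good"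
  unfolding good_def by measurable

lemma AE_good: "AE \<omega> in M. good \<omega>"
  using AE_windows by (rule AE_mp) (auto simp: good_def intro!: AE_I2)

definition addr_event :: "nat list \<Rightarrow> 'a set" where
  "addr_event q = {\<omega> \<in> space M. good \<omega> \<and> root_addr \<omega> = q}"

lemma win_funs_ex_meas:
  "Measurable.pred M (\<lambda>\<omega>. \<exists>h\<in>win_funs n. P h \<and> window n (x \<omega>) h q)"
proof -
  have "{\<omega> \<in> space M. \<exists>h\<in>win_funs n. P h \<and> window n (x \<omega>) h q}
      = (\<Union>h\<in>win_funs n. {\<omega> \<in> space M. P h \<and> window n (x \<omega>) h q})"
    by blast
  also have "\<dots> \<in> sets M"
    by (intro sets.countable_UN'' countable_win_funs) measurable
  finally show ?thesis by (simp add: pred_def)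
qed

lemma window_fun_window_iff:
  assumes "good \<omega>" "i \<in> int_window n"
  shows "(\<exists>h\<in>win_funs n. P (h i) \<and> window n (x \<omega>) h q) \<longleftrightarrow> root_addr \<omega> = q \<and> P (bush_seq \<omega> i)"
proof
  assume "\<exists>h\<in>win_funs n. P (h i) \<and> window n (x \<omega>) h q"
  then show "root_addr \<omega> = q \<and> P (bush_seq \<omega> i)" using window_iff[OF assms(1)] assms(2) by auto
next
  assume *: "root_addr \<omega> = q \<and> P (bush_seq \<omega> i)"
  obtain h where h: "h \<in> win_funs n" "\<forall>i\<in>int_window n. h i = bush_seq \<omega> i"
    using window_fun_ex[of n "bush_seq \<omega>"] by (elim bexE)
  then have "P (h i) \<and> window n (x \<omega>) h q" using * assms(2) by (simp add: window_iff[OF assms(1)])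
  with h(1) show "\<exists>h\<in>win_funs n. P (h i) \<and> window n (x \<omega>) h q" by blast
qed

lemma addr_event_meas [measurable]: "addr_event q \<in> sets M"
proof -
  have "addr_event q = {\<omega> \<in> space M. good \<omega> \<and> (\<exists>h\<in>win_funs 0. True \<and> window 0 (x \<omega>) h q)}"
    using window_fun_window_iff[where P = "\<lambda>_. True" and n = 0 and i = 0] by (auto simp: addr_event_def)
  moreover note [measurable] = win_funs_ex_meas[where P = "\<lambda>_. True" and n = 0 and q = q]
  have "{\<omega> \<in> space M. good \<omega> \<and> (\<exists>h\<in>win_funs 0. True \<and> window 0 (x \<omega>) h q)} \<in> sets M" by measurable
  ultimately show ?thesis by simp
qed

lemma bush_seq_meas [measurable]: "bush_seq \<in> measurable M seq_space"
proof (rule measurable_PiM_single')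
  fix i :: int
  have "Measurable.pred M (\<lambda>\<omega>. bush_seq \<omega> i = t)" for t
  proof -
    let ?n = "nat \<bar>i\<bar>"
    have "bush_seq \<omega> i = t \<longleftrightarrow> (good \<omega> \<and> (\<exists>q. \<exists>h\<in>win_funs ?n. h i = t \<and> window ?n (x \<omega>) h q)) \<or> (\<not> good \<omega> \<and> t = Node [])" for \<omega>
    proof (cases "good \<omega>")
      case True
      have "i \<in> int_window ?n" by auto
      from window_fun_window_iff[OF True this, where P = "\<lambda>u. u = t"] show ?thesis using True by blast
    next
      case False
      then have "bush_seq \<omega> i = Node []" by (simp only: bush_seq_def if_False)
      then show ?thesis by (simp only: False simp_thms) (rule eq_commute)
    qed
    moreover note [measurable] = win_funs_ex_meas[where P = "\<lambda>h. h i = t" and n = ?n]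
    have "Measurable.pred M (\<lambda>\<omega>. (good \<omega> \<and> (\<exists>q. \<exists>h\<in>win_funs ?n. h i = t \<and> window ?n (x \<omega>) h q)) \<or> (\<not> good \<omega> \<and> t = Node []))"
      by measurable
    ultimately show ?thesis by (simp only:)
  qed
  then show "(\<lambda>\<omega>. bush_seq \<omega> i) \<in> measurable M (count_space UNIV)"
    by (subst measurable_count_space_eq2_countable) (auto simp: pred_def vimage_def Int_def conj_commute)
qed auto

lemma emeasure_distr_bush_seq:
  assumes "B \<in> sets seq_space"
  shows "emeasure (distr (density M (indicator (addr_event q))) seq_space bush_seq) B
    = emeasure M {\<omega> \<in> addr_event q. bush_seq \<omega> \<in> B}"
proof -
  have B: "bush_seq -` B \<inter> space M \<in> sets M" using assms by measurable
  have eq: "{\<omega> \<in> addr_event q. bush_seq \<omega> \<in> B} = addr_event q \<inter> (bush_seq -` B \<inter> space M)"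
    by (auto simp: addr_event_def)
  have "emeasure (distr (density M (indicator (addr_event q))) seq_space bush_seq) B
      = (\<integral>\<^sup>+\<omega>. indicator (addr_event q) \<omega> * indicator (bush_seq -` B \<inter> space M) \<omega> \<partial>M)"
    using assms B by (subst emeasure_distr) (auto simp: emeasure_density)
  also have "\<dots> = (\<integral>\<^sup>+\<omega>. indicator (addr_event q \<inter> (bush_seq -` B \<inter> space M)) \<omega> \<partial>M)"
    by (simp only: indicator_inter_arith)
  also have "\<dots> = emeasure M (addr_event q \<inter> (bush_seq -` B \<inter> space M))"
    using B by (intro nn_integral_indicator) auto
  finally show ?thesis unfolding eq .
qed

text \<open>Once the address \<open>q\<close> is fixed, the bushes are independent apart from the
  constraint that the central one contains \<open>q\<close>. The size-biased law only appears when
  the addresses are summed.\<close>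

lemma bush_seq_law:
  "distr (density M (indicator (addr_event q))) seq_space bush_seq
    = density bush_law (\<lambda>g. ennreal (1 - c) * indicator {g. is_path (g 0) q} g)" (is "?N1 = ?N2")
proof (rule measure_eq_windows)
  have dens [measurable]: "indicator (addr_event q) \<in> borel_measurable M" by measurable
  have path [measurable]: "{g. is_path (g 0) q} \<in> sets bush_law" by (rule sets_bush_law_path)
  show "sets ?N1 = sets seq_space" by simp
  show "sets ?N2 = sets seq_space" by (simp add: sets_bush_law)
  note dist = emeasure_distr_bush_seq[of _ q]
  show "finite_measure ?N1"
  proof
    have "UNIV \<in> sets (seq_space :: (int \<Rightarrow> ptree) measure)" using sets.top[of seq_space] by simp
    then have "emeasure ?N1 (space ?N1) \<le> 1" using dist[of UNIV] by (simp add: emeasure_le_1)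
    then show "emeasure ?N1 (space ?N1) \<noteq> \<infinity>" by (auto simp: top_unique)
  qed
  fix n and h :: "int \<Rightarrow> ptree"
  let ?C = "{g. \<forall>i\<in>int_window n. g i = h i}"
  have C: "?C \<in> sets seq_space" by (rule sets_window_cylinder)
  have "emeasure ?N1 ?C = emeasure M {\<omega> \<in> addr_event q. bush_seq \<omega> \<in> ?C}" by (rule dist[OF C])
  also have "\<dots> = emeasure M {\<omega> \<in> space M. good \<omega> \<and> window n (x \<omega>) h q}"
    by (rule arg_cong[of _ _ "emeasure M"]) (auto simp: addr_event_def window_iff)
  also have "\<dots> = emeasure M {\<omega> \<in> space M. window n (x \<omega>) h q}"
    using AE_good by (intro emeasure_eq_AE) auto
  also have "\<dots> = ennreal (1 - c) * (indicator {h. is_path (h 0) q} h * (\<Prod>i\<in>int_window n. bush_weight (h i)))"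
    by (rule window_prob)
  also have "\<dots> = (\<integral>\<^sup>+g. ennreal (1 - c) * indicator {h. is_path (h 0) q} h * indicator ?C g \<partial>bush_law)"
    using C by (subst nn_integral_cmult_indicator) (simp_all only: sets_bush_law emeasure_bush_law_window mult.assoc)
  also have "\<dots> = (\<integral>\<^sup>+g. ennreal (1 - c) * indicator {g. is_path (g 0) q} g * indicator ?C g \<partial>bush_law)"
    by (intro nn_integral_cong) (auto simp: indicator_def)
  also have "\<dots> = emeasure ?N2 ?C"
    using C by (subst emeasure_density) (auto simp: sets_bush_law)
  finally show "emeasure ?N1 ?C = emeasure ?N2 ?C" .
qed

lemma bush_seq_prob:
  assumes "B \<in> sets seq_space"
  shows "emeasure M {\<omega> \<in> addr_event q. bush_seq \<omega> \<in> B} = ennreal (1 - c) * emeasure bush_law {g \<in> B. is_path (g 0) q}"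
proof -
  have dens [measurable]: "indicator (addr_event q) \<in> borel_measurable M" by measurable
  have path [measurable]: "{g. is_path (g 0) q} \<in> sets bush_law" by (rule sets_bush_law_path)
  have "emeasure M {\<omega> \<in> addr_event q. bush_seq \<omega> \<in> B}
      = emeasure (distr (density M (indicator (addr_event q))) seq_space bush_seq) B"
    by (rule emeasure_distr_bush_seq[OF assms, symmetric])
  also have "\<dots> = (\<integral>\<^sup>+g. ennreal (1 - c) * indicator {g. is_path (g 0) q} g * indicator B g \<partial>bush_law)"
    unfolding bush_seq_law using assms by (subst emeasure_density) (auto simp: sets_bush_law)
  also have "\<dots> = (\<integral>\<^sup>+g. ennreal (1 - c) * indicator {g \<in> B. is_path (g 0) q} g \<partial>bush_law)"
    by (intro nn_integral_cong) (auto simp: indicator_def)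
  also have "\<dots> = ennreal (1 - c) * emeasure bush_law {g \<in> B. is_path (g 0) q}"
  proof (rule nn_integral_cmult_indicator)
    have "{g \<in> B. is_path (g 0) q} = B \<inter> {g. is_path (g 0) q}" by blast
    then show "{g \<in> B. is_path (g 0) q} \<in> sets bush_law" using assms path by (simp add: sets_bush_law)
  qed
  finally show ?thesis .
qed

text \<open>Almost surely the record graph is the canonical tree of its bushes, rooted at the
  address of 0, so the event splits according to this address.\<close>

lemma record_code_prob:
  assumes A: "A \<in> sets code_space"
  shows "emeasure M {\<omega> \<in> space M. record_code (x \<omega>) \<in> A}
    = ennreal (1 - c) * (\<integral>\<^sup>+q. emeasure bush_law {g. canon_code g (0, q) \<in> A \<and> is_path (g 0) q} \<partial>count_space UNIV)"
proof -
  let ?B = "\<lambda>q. {g. canon_code g (0, q) \<in> A}"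
  let ?S = "\<lambda>q. {\<omega> \<in> addr_event q. bush_seq \<omega> \<in> ?B q}"
  have B: "?B q \<in> sets seq_space" for q
    using measurable_sets[OF measurable_canon_code A, of "(0, q)"] by (simp add: vimage_def)
  have S: "?S q \<in> sets M" for q
  proof -
    have "?S q = addr_event q \<inter> (bush_seq -` ?B q \<inter> space M)" by (auto simp: addr_event_def)
    then show ?thesis using measurable_sets[OF bush_seq_meas B] by auto
  qed
  have "emeasure M {\<omega> \<in> space M. record_code (x \<omega>) \<in> A} = emeasure M (\<Union>q. ?S q)"
  proof (rule emeasure_eq_AE)
    show "AE \<omega> in M. \<omega> \<in> {\<omega> \<in> space M. record_code (x \<omega>) \<in> A} \<longleftrightarrow> \<omega> \<in> (\<Union>q. ?S q)"
      using AE_good AE_space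
    proof eventually_elim
      case (elim \<omega>)
      then have "record_code (x \<omega>) = canon_code (bush_seq \<omega>) (0, root_addr \<omega>)"
        by (intro record_code_eq window_bush_seq)
      then show ?case using elim by (auto simp: addr_event_def)
    qed
    show "{\<omega> \<in> space M. record_code (x \<omega>) \<in> A} \<in> sets M"
      using measurable_sets[OF record_code_meas A] by (simp add: vimage_def Int_def conj_commute)
    show "(\<Union>q. ?S q) \<in> sets M" by (intro sets.countable_UN) (use S in auto)
  qed
  also have "\<dots> = (\<integral>\<^sup>+q. emeasure M (?S q) \<partial>count_space UNIV)"
    by (rule emeasure_UN_countable) (use S in \<open>auto simp: disjoint_family_on_def addr_event_def\<close>)
  also have "\<dots> = ennreal (1 - c) * (\<integral>\<^sup>+q. emeasure bush_law {g \<in> ?B q. is_path (g 0) q} \<partial>count_space UNIV)"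
    by (simp only: bush_seq_prob[OF B]) (simp add: nn_integral_cmult)
  finally show ?thesis by simp
qed

end

section \<open>The Eternal Kesten Tree\<close>

text \<open>The word-based weight becomes a product over addresses, because the offspring numbers of
  the Kesten tree are indexed by labels.\<close>

lemma weight_prod_paths: "weight v t = (\<Prod>w | is_path t w. v (arity t w))"
proof (induction t)
  case (Node ts)
  have fin: "finite {p. is_path (ts ! j) p}" for j by simp
  have "(\<Prod>w | is_path (Node ts) w. v (arity (Node ts) w))
    = v (length ts) * (\<Prod>w\<in>(\<Union>j<length ts. (#) j ` {p. is_path (ts ! j) p}). v (arity (Node ts) w))"
    unfolding paths_eq[of "Node ts"] by (subst prod.insert) auto
  also have "(\<Prod>w\<in>(\<Union>j<length ts. (#) j ` {p. is_path (ts ! j) p}). v (arity (Node ts) w))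
    = (\<Prod>j<length ts. \<Prod>w\<in>(#) j ` {p. is_path (ts ! j) p}. v (arity (Node ts) w))"
    by (subst prod.UNION_disjoint) auto
  also have "\<dots> = (\<Prod>j<length ts. weight v (ts ! j))"
    by (intro prod.cong refl, subst prod.reindex) (auto simp: Node.IH inj_on_def)
  also have "\<dots> = prod_list (map (weight v) ts)"
    by (simp add: prod.list_conv_set_nth lessThan_atLeast0)
  finally show ?case by (simp add: weight_kids[of v "Node ts"] mult.commute)
qed

lemma ptree_eqI_arity:
  "(\<And>w. is_path t w \<Longrightarrow> y w = arity t w) \<Longrightarrow> (\<And>w. is_path u w \<Longrightarrow> y w = arity u w) \<Longrightarrow> t = u"
proof (induction t arbitrary: u y)
  case (Node ts)
  have len: "length ts = length (kids u)" using Node.prems(1)[of "[]"] Node.prems(2)[of "[]"] by simp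
  have "ts ! j = kids u ! j" if "j < length ts" for j
  proof (rule Node.IH[of _ "\<lambda>w. y (j # w)"])
    show "ts ! j \<in> set ts" using that by simp
    show "is_path (ts ! j) w \<Longrightarrow> y (j # w) = arity (ts ! j) w" for w
      using Node.prems(1)[of "j # w"] that by simp
    show "is_path (kids u ! j) w \<Longrightarrow> y (j # w) = arity (kids u ! j) w" for w
      using Node.prems(2)[of "j # w"] that len by simp
  qed
  then show ?case using len by (intro ptree.expand) (simp add: list_eq_iff_nth_eq)
qed

text \<open>The tree \<open>t\<close> has the ECS order built in: the child labelled
  \<open>j\<close> stands at index \<open>snd (fst \<omega> i) j\<close>, and labels below it are
  kept. Only finitely many variables are inspected, so the event has a finite product as its
  probability.\<close>

definition shows_tree :: "ekt_omega \<Rightarrow> int \<Rightarrow> ptree \<Rightarrow> bool" where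
  "shows_tree \<omega> i t \<longleftrightarrow> fst (fst \<omega> i) = length (kids t) \<and> snd (fst \<omega> i) permutes {..<length (kids t)} \<and>
    (\<forall>j<length (kids t). \<forall>w. is_path (kids t ! snd (fst \<omega> i) j) w \<longrightarrow>
      snd \<omega> (i, j # w) = arity (kids t ! snd (fst \<omega> i) j) w)"

text \<open>The permutation reaches every index, so each subtree of the root has its arities
  prescribed by \<omega>.\<close>

lemma shows_tree_unique:
  assumes "shows_tree \<omega> i t" "shows_tree \<omega> i u"
  shows "t = u"
proof -
  have len: "length (kids t) = length (kids u)" using assms by (simp add: shows_tree_def)
  have "kids t ! k = kids u ! k" if "k < length (kids t)" for k
  proof -
    have "snd (fst \<omega> i) permutes {..<length (kids t)}" using assms by (simp add: shows_tree_def)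
    then have "k \<in> snd (fst \<omega> i) ` {..<length (kids t)}" using that by (simp add: permutes_image)
    then obtain j where j: "j < length (kids t)" "k = snd (fst \<omega> i) j" by auto
    show ?thesis
      by (rule ptree_eqI_arity[of _ "\<lambda>w. snd \<omega> (i, j # w)"])
        (use assms j len in \<open>auto simp: shows_tree_def\<close>)
  qed
  then show ?thesis using len by (intro ptree.expand) (simp add: list_eq_iff_nth_eq)
qed

context offspring
begin

abbreviation "root_space \<equiv> PiM UNIV (\<lambda>_::int. measure_pmf (root_pmf \<alpha>))"
abbreviation "offspring_space \<equiv> PiM UNIV (\<lambda>_::int \<times> nat list. measure_pmf \<beta>)"

lemma emeasure_offspring_space:
  assumes "finite S"
  shows "emeasure offspring_space {y. \<forall>v\<in>S. y v = l v} = (\<Prod>v\<in>S. ennreal (pmf \<beta> (l v)))"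
proof -
  interpret product_prob_space "\<lambda>_::int \<times> nat list. measure_pmf \<beta>" UNIV by standard
  show ?thesis
    using emeasure_PiM_Collect[of S "\<lambda>v. {l v}"] assms
    by (simp add: space_PiM emeasure_pmf_single)
qed

lemma emeasure_root_pmf:
  "emeasure (measure_pmf (root_pmf \<alpha>)) {z. fst z = n \<and> snd z permutes {..<n}} = ennreal (pmf \<alpha> n)"
proof -
  have fin: "finite {\<sigma>. \<sigma> permutes {..<m}}" for m :: nat by (intro finite_permutations) simp
  have ne: "{\<sigma>. \<sigma> permutes {..<m}} \<noteq> {}" for m :: nat using permutes_id by blast
  have "emeasure (map_pmf (Pair m) (pmf_of_set {\<sigma>. \<sigma> permutes {..<m}})) {z. fst z = n \<and> snd z permutes {..<n}}
      = indicator {n} m" for m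
  proof (cases "m = n")
    case True
    then have "emeasure (map_pmf (Pair m) (pmf_of_set {\<sigma>. \<sigma> permutes {..<m}})) {z. fst z = n \<and> snd z permutes {..<n}}
      = emeasure (measure_pmf (pmf_of_set {\<sigma>. \<sigma> permutes {..<n}})) {\<sigma>. \<sigma> permutes {..<n}}"
      by (simp add: vimage_def)
    also have "\<dots> = 1"
      by (intro measure_pmf.emeasure_eq_1_AE) (simp_all add: AE_measure_pmf_iff set_pmf_of_set[OF ne fin])
    finally show ?thesis using True by simp
  qed (simp add: vimage_def)
  then show ?thesis
    unfolding root_pmf_def by (simp add: emeasure_bind_pmf emeasure_pmf_single)
qed

text \<open>The value does not depend on the permutations, so the ECS order does not affect the law.\<close>

lemma shows_prob_given_root:
  assumes J: "finite J"
    and r: "\<And>i. i \<in> J \<Longrightarrow> fst (r i) = length (kids (h i)) \<and> snd (r i) permutes {..<length (kids (h i))}"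
  shows "emeasure offspring_space {y. \<forall>i\<in>J. shows_tree (r, y) i (h i)}
    = (\<Prod>i\<in>J. prod_list (map (weight (\<lambda>k. ennreal (pmf \<beta> k))) (kids (h i))))"
proof -
  let ?b = "\<lambda>k. ennreal (pmf \<beta> k)"
  define n where "n i = length (kids (h i))" for i
  define t where "t i j = kids (h i) ! snd (r i) j" for i j
  \<comment> \<open>The triples index the variables that the event prescribes: \<open>e\<close>
    turns them into labels, and \<open>l\<close> is the prescribed value. The label \<open>j\<close>
    and the index of the subtree differ by the permutation.\<close>
  define T where "T = (SIGMA i:J. SIGMA j:{..<n i}. {w. is_path (t i j) w})"
  define e where "e z = (case z of (i, j, w) \<Rightarrow> (i, j # w))" for z :: "int \<times> nat \<times> nat list"
  define l where "l v = arity (t (fst v) (hd (snd v))) (tl (snd v))" for v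
  have fin: "finite T" unfolding T_def using J by (intro finite_SigmaI) auto
  have "{y. \<forall>i\<in>J. shows_tree (r, y) i (h i)} = {y. \<forall>v\<in>e ` T. y v = l v}"
    using r by (auto simp: shows_tree_def T_def e_def l_def t_def n_def)
  then have "emeasure offspring_space {y. \<forall>i\<in>J. shows_tree (r, y) i (h i)} = (\<Prod>v\<in>e ` T. ?b (l v))"
    using emeasure_offspring_space[of "e ` T" l] fin by simp
  also have "\<dots> = (\<Prod>z\<in>T. ?b (l (e z)))"
    by (subst prod.reindex) (auto simp: inj_on_def e_def)
  also have "\<dots> = (\<Prod>i\<in>J. \<Prod>j<n i. \<Prod>w | is_path (t i j) w. ?b (arity (t i j) w))"
    unfolding T_def using J
    by (simp add: prod.Sigma split_def) (simp add: e_def l_def split_def)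
  also have "\<dots> = (\<Prod>i\<in>J. \<Prod>j<n i. weight ?b (t i j))" by (simp only: weight_prod_paths)
  also have "\<dots> = (\<Prod>i\<in>J. prod_list (map (weight ?b) (kids (h i))))"
  proof (rule prod.cong[OF refl])
    fix i assume "i \<in> J"
    then have p: "snd (r i) permutes {..<n i}" using r by (simp add: n_def)
    \<comment> \<open>Reindexing by the permutation puts the factors back into plane order.\<close>
    have "(\<Prod>j<n i. weight ?b (t i j)) = (\<Prod>j<n i. weight ?b (kids (h i) ! j))"
      using prod.permute[OF p, of "\<lambda>j. weight ?b (kids (h i) ! j)"] by (simp add: t_def comp_def)
    also have "\<dots> = prod_list (map (weight ?b) (kids (h i)))"
      by (simp add: prod.list_conv_set_nth lessThan_atLeast0 n_def)
    finally show "(\<Prod>j<n i. weight ?b (t i j)) = prod_list (map (weight ?b) (kids (h i)))" .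
  qed
  finally show ?thesis .
qed

lemma space_ekt: "space (ekt_space \<alpha> \<beta>) = UNIV"
  by (auto simp: ekt_space_def space_pair_measure space_PiM)

lemma shows_tree_meas [measurable]: "Measurable.pred (ekt_space \<alpha> \<beta>) (\<lambda>\<omega>. shows_tree \<omega> i t)"
proof -
  have r [measurable]: "Measurable.pred (ekt_space \<alpha> \<beta>) (\<lambda>\<omega>. P (fst \<omega> i))" for P
  proof -
    have "(\<lambda>\<omega>. fst \<omega> i) \<in> measurable (ekt_space \<alpha> \<beta>) (measure_pmf (root_pmf \<alpha>))"
      unfolding ekt_space_def by measurable
    then show ?thesis by (rule measurable_compose) simp
  qed
  have y [measurable]: "Measurable.pred (ekt_space \<alpha> \<beta>) (\<lambda>\<omega>. snd \<omega> v = n)" for v n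
  proof -
    have "(\<lambda>\<omega>. snd \<omega> v) \<in> measurable (ekt_space \<alpha> \<beta>) (measure_pmf \<beta>)"
      unfolding ekt_space_def by measurable
    then show ?thesis by (rule measurable_compose) simp
  qed
  \<comment> \<open>The random index is replaced by a quantified \<open>k\<close>, so that every
    statement involves a fixed subtree.\<close>
  have "shows_tree \<omega> i t \<longleftrightarrow> (fst (fst \<omega> i) = length (kids t) \<and> snd (fst \<omega> i) permutes {..<length (kids t)}) \<and>
    (\<forall>j k w. j < length (kids t) \<longrightarrow> is_path (kids t ! k) w \<longrightarrow> \<not> snd (fst \<omega> i) j = k \<or>
      snd \<omega> (i, j # w) = arity (kids t ! k) w)" for \<omega>
    unfolding shows_tree_def by blast
  moreover have "Measurable.pred (ekt_space \<alpha> \<beta>) (\<lambda>\<omega>. (fst (fst \<omega> i) = length (kids t) \<and> snd (fst \<omega> i) permutes {..<length (kids t)}) \<and>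
    (\<forall>j k w. j < length (kids t) \<longrightarrow> is_path (kids t ! k) w \<longrightarrow> \<not> snd (fst \<omega> i) j = k \<or>
      snd \<omega> (i, j # w) = arity (kids t ! k) w))"
    by (intro pred_intros_logic pred_intros_countable r y)
  ultimately show ?thesis by (simp only:)
qed

text \<open>Fubini over the root data: on admissible root data the conditional probability is a
  constant, and the root data themselves contribute the factors of \<alpha>.\<close>

lemma shows_prob:
  assumes J: "finite J"
  shows "emeasure (ekt_space \<alpha> \<beta>) {\<omega>. \<forall>i\<in>J. shows_tree \<omega> i (h i)} = (\<Prod>i\<in>J. bush_weight (h i))"
proof -
  let ?W = "\<Prod>i\<in>J. prod_list (map (weight (\<lambda>k. ennreal (pmf \<beta> k))) (kids (h i)))"
  let ?R = "{r. \<forall>i\<in>J. r i \<in> {z. fst z = length (kids (h i)) \<and> snd z permutes {..<length (kids (h i))}}}"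
  let ?E = "{\<omega>. \<forall>i\<in>J. shows_tree \<omega> i (h i)}"
  interpret R: product_prob_space "\<lambda>_::int. measure_pmf (root_pmf \<alpha>)" UNIV by standard
  interpret O: product_prob_space "\<lambda>_::int \<times> nat list. measure_pmf \<beta>" UNIV by standard
  have R: "emeasure root_space ?R = (\<Prod>i\<in>J. ennreal (pmf \<alpha> (length (kids (h i)))))"
    using R.emeasure_PiM_Collect[of J "\<lambda>i. {z. fst z = length (kids (h i)) \<and> snd z permutes {..<length (kids (h i))}}"] J
    by (simp only: emeasure_root_pmf) (simp add: space_PiM)
  have Rs: "?R \<in> sets root_space"
  proof -
    have "Measurable.pred root_space (\<lambda>r. r i \<in> B)" for i and B :: "(nat \<times> (nat \<Rightarrow> nat)) set"
      by (rule measurable_compose[OF measurable_component_singleton[of i]]) auto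
    then have "Measurable.pred root_space (\<lambda>r. \<forall>i\<in>J. r i \<in> {z. fst z = length (kids (h i)) \<and> snd z permutes {..<length (kids (h i))}})"
      using J by (intro pred_intros_finite)
    then show ?thesis by (simp add: pred_def space_PiM)
  qed
  have E: "?E \<in> sets (root_space \<Otimes>\<^sub>M offspring_space)"
  proof -
    have "Measurable.pred (ekt_space \<alpha> \<beta>) (\<lambda>\<omega>. \<forall>i\<in>J. shows_tree \<omega> i (h i))"
      using J by (intro pred_intros_finite) auto
    then show ?thesis by (simp add: pred_def space_ekt) (simp add: ekt_space_def)
  qed
  have "emeasure (ekt_space \<alpha> \<beta>) ?E = (\<integral>\<^sup>+r. emeasure offspring_space (Pair r -` ?E) \<partial>root_space)"
    unfolding ekt_space_def by (rule O.emeasure_pair_measure_alt[OF E])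
  also have "\<dots> = (\<integral>\<^sup>+r. ?W * indicator ?R r \<partial>root_space)"
  proof (rule nn_integral_cong)
    fix r :: "int \<Rightarrow> nat \<times> (nat \<Rightarrow> nat)"
    show "emeasure offspring_space (Pair r -` ?E) = ?W * indicator ?R r"
    proof (cases "r \<in> ?R")
      case True
      then have "emeasure offspring_space {y. \<forall>i\<in>J. shows_tree (r, y) i (h i)} = ?W"
        by (intro shows_prob_given_root[OF J]) auto
      then show ?thesis using True by (simp add: vimage_def)
    next
      case False
      then have "Pair r -` ?E = {}" by (auto simp: shows_tree_def)
      then have "emeasure offspring_space (Pair r -` ?E) = 0" by (simp only: emeasure_empty)
      then show ?thesis using False by (simp only: indicator_simps mult_zero_right if_False not_False_eq_True)
    qed
  qed
  also have "\<dots> = ?W * (\<Prod>i\<in>J. ennreal (pmf \<alpha> (length (kids (h i)))))"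
    using Rs by (subst nn_integral_cmult_indicator) (simp_all only: R)
  finally show ?thesis by (simp add: bush_weight_def prod.distrib)
qed

end

section \<open>From labelled trees to ordered plane trees\<close>

definition ekt_tree :: "ekt_omega \<Rightarrow> int \<Rightarrow> ptree" where
  "ekt_tree \<omega> i = (if \<exists>t. shows_tree \<omega> i t then SOME t. shows_tree \<omega> i t else Node [])"

lemma ekt_tree_eqI: "shows_tree \<omega> i t \<Longrightarrow> ekt_tree \<omega> i = t"
  unfolding ekt_tree_def using shows_tree_unique someI[of "shows_tree \<omega> i" t] by auto

definition ecs_addr :: "ekt_omega \<Rightarrow> int \<times> nat list \<Rightarrow> int \<times> nat list" where
  "ecs_addr \<omega> v = (case v of (i, []) \<Rightarrow> (i, []) | (i, j # w) \<Rightarrow> (i, snd (fst \<omega> i) j # w))"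

lemma ecs_addr_simps [simp]:
  "ecs_addr \<omega> (i, []) = (i, [])" "ecs_addr \<omega> (i, j # w) = (i, snd (fst \<omega> i) j # w)"
  by (simp_all add: ecs_addr_def)

lemma gw_ok_iff:
  "(\<And>w. is_path t w \<Longrightarrow> y (i, p @ w) = arity t w) \<Longrightarrow> gw_ok y i p w \<longleftrightarrow> is_path t w"
proof (induction w arbitrary: t p)
  case (Cons j w)
  have len: "y (i, p) = length (kids t)" using Cons.prems[of "[]"] by simp
  have "gw_ok y i (p @ [j]) w \<longleftrightarrow> is_path (kids t ! j) w" if "j < length (kids t)"
  proof (rule Cons.IH)
    show "is_path (kids t ! j) w \<Longrightarrow> y (i, (p @ [j]) @ w) = arity (kids t ! j) w" for w
      using Cons.prems[of "j # w"] that by simp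
  qed
  then show ?case by (auto simp: len)
qed simp

text \<open>\<open>ekt_vertex\<close> tests labels and \<open>is_path\<close> tests ordered
  addresses. They correspond because the permutation preserves the range of child indices and labels
  further down are unchanged.\<close>

lemma ekt_vertex_iff:
  assumes "shows_tree \<omega> i t"
  shows "ekt_vertex \<omega> (i, w) \<longleftrightarrow> is_path t (snd (ecs_addr \<omega> (i, w))) \<and> (\<forall>j v. w = j # v \<longrightarrow> j < length (kids t))"
proof (cases w)
  case (Cons j v)
  have s: "fst (fst \<omega> i) = length (kids t)" "snd (fst \<omega> i) permutes {..<length (kids t)}"
    using assms by (auto simp: shows_tree_def)
  have "gw_ok (snd \<omega>) i [j] v \<longleftrightarrow> is_path (kids t ! snd (fst \<omega> i) j) v" if "j < length (kids t)"
    by (rule gw_ok_iff) (use assms that in \<open>simp add: shows_tree_def\<close>)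
  moreover have "snd (fst \<omega> i) j < length (kids t)" if "j < length (kids t)"
    using permutes_in_image[OF s(2), of j] that by simp
  ultimately show ?thesis using s by (auto simp: Cons ekt_vertex_def)
qed (simp add: ekt_vertex_def)

lemma canon_key_ecs_addr: "canon_key (ecs_addr \<omega> v) = ekt_key \<omega> v"
proof -
  obtain i w where v: "v = (i, w)" by (cases v)
  show ?thesis by (cases w) (auto simp: v canon_key_def ekt_key_def)
qed

lemma ekt_par_ecs_addr: "ekt_par (ecs_addr \<omega> v) = map_option (ecs_addr \<omega>) (ekt_par v)"
proof -
  obtain i w where v: "v = (i, w)" by (cases v)
  show ?thesis by (cases w) (auto simp: v ekt_par_def)
qed

lemma ecs_addr_bij:
  assumes s: "\<And>i. shows_tree \<omega> i (f i)"
  shows "bij_betw (ecs_addr \<omega>) {v. ekt_vertex \<omega> v} (canon_verts f)"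
  unfolding bij_betw_def
proof
  have perm: "snd (fst \<omega> i) permutes {..<length (kids (f i))}" for i
    using s[of i] by (simp add: shows_tree_def)
  have inj: "inj (snd (fst \<omega> i))" for i using perm[of i] by (rule permutes_inj)
  have eq: "a = b" if "ecs_addr \<omega> a = ecs_addr \<omega> b" for a b
  proof -
    obtain i v k w where ab: "a = (i, v)" "b = (k, w)" by (cases a, cases b)
    show ?thesis using that injD[OF inj] by (cases v; cases w) (auto simp: ab)
  qed
  then show "inj_on (ecs_addr \<omega>) {v. ekt_vertex \<omega> v}" by (auto intro: inj_onI)
  show "ecs_addr \<omega> ` {v. ekt_vertex \<omega> v} = canon_verts f"
  proof (intro equalityI subsetI)
    fix z assume "z \<in> ecs_addr \<omega> ` {v. ekt_vertex \<omega> v}"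
    then obtain i w where z: "z = ecs_addr \<omega> (i, w)" "ekt_vertex \<omega> (i, w)" by auto
    then show "z \<in> canon_verts f"
      using ekt_vertex_iff[OF s] by (cases w) (auto simp: canon_verts_def)
  next
    fix z assume z: "z \<in> canon_verts f"
    obtain i q where iq: "z = (i, q)" by (cases z)
    show "z \<in> ecs_addr \<omega> ` {v. ekt_vertex \<omega> v}"
    proof (cases q)
      case Nil
      then show ?thesis by (intro image_eqI[of _ _ "(i, [])"]) (simp_all add: iq ekt_vertex_def)
    next
      case (Cons k w)
      then have k: "k < length (kids (f i))" using z iq by (simp add: canon_verts_def)
      then have "k \<in> snd (fst \<omega> i) ` {..<length (kids (f i))}" by (simp add: permutes_image[OF perm])
      then obtain j where j: "j < length (kids (f i))" "k = snd (fst \<omega> i) j" by auto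
      then have "ekt_vertex \<omega> (i, j # w)"
        using ekt_vertex_iff[OF s, of i "j # w"] z iq Cons by (simp add: canon_verts_def)
      then show ?thesis using j Cons iq by (intro image_eqI[of _ _ "(i, j # w)"]) simp_all
    qed
  qed
qed

lemma ekt_vertex_par:
  assumes "ekt_vertex \<omega> v" "ekt_par v = Some w" "\<And>i. shows_tree \<omega> i (f i)"
  shows "ekt_vertex \<omega> w"
proof -
  note bij = ecs_addr_bij[OF assms(3)]
  consider i where "v = (i, [])" "w = (i + 1, [])" | i q j where "v = (i, q @ [j])" "w = (i, q)"
    using assms(2) unfolding ekt_par_eq_Some by blast
  then show ?thesis
  proof cases
    case 1
    then show ?thesis by (simp add: ekt_vertex_def)
  next
    case (2 i q j)
    then show ?thesis
      using assms(1) ekt_vertex_iff[OF assms(3), of i q] ekt_vertex_iff[OF assms(3), of i "q @ [j]"]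
      by (cases q) (auto simp: is_path_append)
  qed
qed

text \<open>Keys and parents correspond under \<open>ecs_addr\<close>, so the relabelling is an
  isomorphism of ordered trees, and the code depends on \<omega> only through the sequence of plane
  trees.\<close>

lemma ekt_code_eq:
  assumes s: "\<And>i. shows_tree \<omega> i (f i)" and v: "ekt_vertex \<omega> v"
  shows "ekt_code \<omega> v = canon_code f (ecs_addr \<omega> v)"
proof -
  note bij = ecs_addr_bij[OF s]
  \<comment> \<open>That siblings have distinct keys is pulled back from the canonical tree along
    the injective relabelling.\<close>
  have lin: "sib_linear {v. ekt_vertex \<omega> v} ekt_par (\<lambda>a b. ekt_key \<omega> a < ekt_key \<omega> b)"
  proof -
    have "ekt_key \<omega> a < ekt_key \<omega> b \<or> ekt_key \<omega> b < ekt_key \<omega> a"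
      if ab: "ekt_vertex \<omega> a" "ekt_par a = Some z" "ekt_vertex \<omega> b" "ekt_par b = Some z" "a \<noteq> b" for a b z
    proof -
      have "ecs_addr \<omega> a \<in> children (canon_verts f) ekt_par (ecs_addr \<omega> z)"
        "ecs_addr \<omega> b \<in> children (canon_verts f) ekt_par (ecs_addr \<omega> z)"
        using ab bij by (auto simp: children_def bij_betw_def ekt_par_ecs_addr)
      moreover have "ecs_addr \<omega> a \<noteq> ecs_addr \<omega> b"
        using inj_onD[OF bij_betw_imp_inj_on[OF bij], of a b] ab by blast
      ultimately have "canon_key (ecs_addr \<omega> a) < canon_key (ecs_addr \<omega> b) \<or> canon_key (ecs_addr \<omega> b) < canon_key (ecs_addr \<omega> a)"
        using sib_linear_canon[of "canon_verts f"] unfolding sib_linear_def by blast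
      then show ?thesis by (simp add: canon_key_ecs_addr)
    qed
    then show ?thesis by (auto simp: sib_linear_def children_def)
  qed
  interpret tree_iso "{v. ekt_vertex \<omega> v}" ekt_par "\<lambda>a b. ekt_key \<omega> a < ekt_key \<omega> b"
    "canon_verts f" ekt_par "\<lambda>a b. canon_key a < canon_key b" "ecs_addr \<omega>"
    by standard
      (use bij lin sib_linear_canon ekt_vertex_par[OF _ _ s] in \<open>auto simp: canon_key_ecs_addr ekt_par_ecs_addr\<close>)
  show ?thesis unfolding ekt_code_def canon_code_def using tree_code_g[of v] v by simp
qed

section \<open>Law of the plane trees and the sum over the vertices of the central one\<close>

context offspring
begin

abbreviation "E \<equiv> ekt_space \<alpha> \<beta>"

lemma prob_space_ekt: "prob_space E"
proof -
  interpret R: product_prob_space "\<lambda>_::int. measure_pmf (root_pmf \<alpha>)" UNIV by standard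
  interpret O: product_prob_space "\<lambda>_::int \<times> nat list. measure_pmf \<beta>" UNIV by standard
  interpret pair_prob_space root_space offspring_space by standard
  show ?thesis unfolding ekt_space_def by (rule P.prob_space_axioms)
qed

text \<open>A \<open>ptree\<close> is finite, so this contains the almost sure finiteness of the
  trees T_i: the disjoint events of showing a given finite tree have total mass
  \<open>bush_weight_sum\<close>.\<close>

lemma AE_shows_tree: "AE \<omega> in E. \<forall>i. shows_tree \<omega> i (ekt_tree \<omega> i)"
proof -
  interpret prob_space E by (rule prob_space_ekt)
  have "AE \<omega> in E. \<exists>t. shows_tree \<omega> i t" for i
  proof (rule AE_I_eq_1)
    let ?S = "\<lambda>t. {\<omega>. shows_tree \<omega> i t}"
    have S: "?S t \<in> sets E" for t using shows_tree_meas[of i t] by (simp add: pred_def space_ekt)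
    have "{\<omega> \<in> space E. \<exists>t. shows_tree \<omega> i t} = (\<Union>t. ?S t)" by (auto simp: space_ekt)
    also have "emeasure E \<dots> = (\<integral>\<^sup>+t. emeasure E (?S t) \<partial>count_space UNIV)"
      by (rule emeasure_UN_countable) (use S in \<open>auto simp: disjoint_family_on_def dest: shows_tree_unique\<close>)
    also have "\<dots> = (\<integral>\<^sup>+t. bush_weight t \<partial>count_space UNIV)"
      using shows_prob[of "{i}" "\<lambda>_. t" for t] by simp
    finally show "emeasure E {\<omega> \<in> space E. \<exists>t. shows_tree \<omega> i t} = 1" by (simp add: bush_weight_sum)
  qed measurable
  then have "AE \<omega> in E. \<forall>i. \<exists>t. shows_tree \<omega> i t" by (simp add: AE_all_countable)
  then show ?thesis by (rule AE_mp) (auto intro!: AE_I2 simp: ekt_tree_eqI, metis ekt_tree_eqI)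
qed

lemma ekt_tree_meas [measurable]: "ekt_tree \<in> measurable E seq_space"
proof (rule measurable_PiM_single')
  fix i :: int
  have "Measurable.pred E (\<lambda>\<omega>. ekt_tree \<omega> i = t)" for t
  proof -
    have "ekt_tree \<omega> i = t \<longleftrightarrow> shows_tree \<omega> i t \<or> ((\<forall>u. \<not> shows_tree \<omega> i u) \<and> t = Node [])" for \<omega>
    proof (cases "\<exists>u. shows_tree \<omega> i u")
      case True
      then show ?thesis using ekt_tree_eqI by blast
    next
      case False
      then show ?thesis by (auto simp: ekt_tree_def)
    qed
    moreover have "Measurable.pred E (\<lambda>\<omega>. shows_tree \<omega> i t \<or> ((\<forall>u. \<not> shows_tree \<omega> i u) \<and> t = Node []))"
      by measurable
    ultimately show ?thesis by (simp only:)
  qed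
  then show "(\<lambda>\<omega>. ekt_tree \<omega> i) \<in> measurable E (count_space UNIV)"
    by (subst measurable_count_space_eq2_countable) (auto simp: pred_def vimage_def Int_def conj_commute)
qed auto

lemma ekt_tree_law: "distr E seq_space ekt_tree = bush_law"
proof (rule measure_eq_windows)
  interpret prob_space E by (rule prob_space_ekt)
  show "finite_measure (distr E seq_space ekt_tree)" by (rule finite_measure_distr) measurable
  show "sets bush_law = sets seq_space" by (rule sets_bush_law)
  fix n and h :: "int \<Rightarrow> ptree"
  let ?C = "{g. \<forall>i\<in>int_window n. g i = h i}"
  have C: "?C \<in> sets seq_space" by (rule sets_window_cylinder)
  have "emeasure (distr E seq_space ekt_tree) ?C = emeasure E {\<omega>. \<forall>i\<in>int_window n. ekt_tree \<omega> i = h i}"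
    using C by (subst emeasure_distr) (auto simp: space_ekt vimage_def)
  also have "\<dots> = emeasure E {\<omega>. \<forall>i\<in>int_window n. shows_tree \<omega> i (h i)}"
  proof (rule emeasure_eq_AE)
    show "AE \<omega> in E. \<omega> \<in> {\<omega>. \<forall>i\<in>int_window n. ekt_tree \<omega> i = h i} \<longleftrightarrow> \<omega> \<in> {\<omega>. \<forall>i\<in>int_window n. shows_tree \<omega> i (h i)}"
      using AE_shows_tree
    proof eventually_elim
      case (elim \<omega>)
      then have "ekt_tree \<omega> i = h i \<longleftrightarrow> shows_tree \<omega> i (h i)" for i
        using ekt_tree_eqI[of \<omega> i "h i"] by (metis (no_types))
      then show ?case by simp
    qed
    show "{\<omega>. \<forall>i\<in>int_window n. ekt_tree \<omega> i = h i} \<in> sets E"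
      using measurable_sets[OF ekt_tree_meas C] by (simp add: space_ekt vimage_def)
    have "Measurable.pred E (\<lambda>\<omega>. \<forall>i\<in>int_window n. shows_tree \<omega> i (h i))" by measurable
    then show "{\<omega>. \<forall>i\<in>int_window n. shows_tree \<omega> i (h i)} \<in> sets E" by (simp add: pred_def space_ekt)
  qed
  also have "\<dots> = (\<Prod>i\<in>int_window n. bush_weight (h i))" by (rule shows_prob) simp
  also have "\<dots> = emeasure bush_law ?C" by (rule emeasure_bush_law_window[symmetric])
  finally show "emeasure (distr E seq_space ekt_tree) ?C = emeasure bush_law ?C" .
qed simp

text \<open>The random vertex set is traded for the fixed set of all addresses with an indicator,
  which allows the sum and the expectation to be exchanged afterwards.\<close>

lemma ekt_sum_eq:
  assumes s: "\<And>i. shows_tree \<omega> i (f i)"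
  shows "(\<integral>\<^sup>+u. indicator A (ekt_code \<omega> (0, u)) \<partial>count_space {u. ekt_vertex \<omega> (0, u)})
    = (\<integral>\<^sup>+q. indicator {g. canon_code g (0, q) \<in> A \<and> is_path (g 0) q} f \<partial>count_space UNIV)"
proof -
  let ?V = "{u. ekt_vertex \<omega> (0, u)}" and ?P = "{q. is_path (f 0) q}"
  let ?g = "\<lambda>u. snd (ecs_addr \<omega> (0, u))"
  have e: "ecs_addr \<omega> (0, u) = (0, ?g u)" for u by (cases u) auto
  note bij = ecs_addr_bij[OF s]
  have "bij_betw ?g ?V ?P"
    unfolding bij_betw_def
  proof
    show "inj_on ?g ?V"
    proof (rule inj_onI)
      fix u v assume uv: "u \<in> ?V" "v \<in> ?V" "?g u = ?g v"
      then have "ecs_addr \<omega> (0, u) = ecs_addr \<omega> (0, v)"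
        using trans[OF e[of u] trans[OF _ e[of v, symmetric]]] by simp
      from inj_onD[OF bij_betw_imp_inj_on[OF bij] this] uv show "u = v" by simp
    qed
    show "?g ` ?V = ?P"
    proof (intro equalityI subsetI)
      fix q assume "q \<in> ?g ` ?V"
      then obtain u where "ekt_vertex \<omega> (0, u)" "q = ?g u" by auto
      moreover have "ecs_addr \<omega> (0, u) \<in> canon_verts f"
        using bij_betw_apply[OF bij, of "(0, u)"] calculation(1) by simp
      ultimately show "q \<in> ?P" unfolding canon_verts_def by (subst (asm) e) simp
    next
      fix q assume "q \<in> ?P"
      then have "(0, q) \<in> ecs_addr \<omega> ` {v. ekt_vertex \<omega> v}"
        unfolding bij_betw_imp_surj_on[OF bij] by (simp add: canon_verts_def)
      then obtain i u where v: "ekt_vertex \<omega> (i, u)" "(0, q) = ecs_addr \<omega> (i, u)" by auto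
      then have "i = 0" by (cases u) auto
      then show "q \<in> ?g ` ?V" using v by (intro image_eqI[of _ _ u]) (metis snd_conv, simp)
    qed
  qed
  then have "(\<integral>\<^sup>+u. indicator A (canon_code f (0, ?g u)) \<partial>count_space ?V)
    = (\<integral>\<^sup>+q. indicator A (canon_code f (0, q)) \<partial>count_space ?P)"
    by (rule nn_integral_bij_count_space)
  moreover have "(\<integral>\<^sup>+u. indicator A (ekt_code \<omega> (0, u)) \<partial>count_space ?V)
    = (\<integral>\<^sup>+u. indicator A (canon_code f (0, ?g u)) \<partial>count_space ?V)"
    by (intro nn_integral_cong) (simp add: ekt_code_eq[OF s] arg_cong[OF e, of "canon_code f", symmetric])
  moreover have "(\<integral>\<^sup>+q. indicator A (canon_code f (0, q)) \<partial>count_space ?P)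
    = (\<integral>\<^sup>+q. indicator {g. canon_code g (0, q) \<in> A \<and> is_path (g 0) q} f \<partial>count_space ?P)"
    by (intro nn_integral_cong) (auto simp: indicator_def)
  moreover have "\<dots> = (\<integral>\<^sup>+q. indicator {g. canon_code g (0, q) \<in> A \<and> is_path (g 0) q} f \<partial>count_space UNIV)"
    by (rule nn_integral_count_space_eq) auto
  ultimately show ?thesis by simp
qed

lemma ekt_integral:
  assumes A: "A \<in> sets code_space"
  shows "(\<integral>\<^sup>+\<omega>. (\<integral>\<^sup>+u. indicator A (ekt_code \<omega> (0, u)) \<partial>count_space {u. ekt_vertex \<omega> (0, u)}) \<partial>E)
    = (\<integral>\<^sup>+q. emeasure bush_law {g. canon_code g (0, q) \<in> A \<and> is_path (g 0) q} \<partial>count_space UNIV)"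
proof -
  let ?B = "\<lambda>q. {g. canon_code g (0, q) \<in> A \<and> is_path (g 0) q}"
  have B: "?B q \<in> sets seq_space" for q
  proof -
    have "{g. canon_code g (0, q) \<in> A} \<in> sets seq_space"
      using measurable_sets[OF measurable_canon_code A, of "(0, q)"] by (simp add: vimage_def)
    moreover have "?B q = {g. canon_code g (0, q) \<in> A} \<inter> {g. is_path (g 0) q}" by blast
    ultimately show ?thesis using sets_bush_law_path[of 0 q] by (simp add: sets_bush_law)
  qed
  have "(\<integral>\<^sup>+\<omega>. (\<integral>\<^sup>+u. indicator A (ekt_code \<omega> (0, u)) \<partial>count_space {u. ekt_vertex \<omega> (0, u)}) \<partial>E)
    = (\<integral>\<^sup>+\<omega>. (\<integral>\<^sup>+q. indicator (?B q) (ekt_tree \<omega>) \<partial>count_space UNIV) \<partial>E)"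
  proof (intro nn_integral_cong_AE)
    show "AE \<omega> in E. (\<integral>\<^sup>+u. indicator A (ekt_code \<omega> (0, u)) \<partial>count_space {u. ekt_vertex \<omega> (0, u)})
      = (\<integral>\<^sup>+q. indicator (?B q) (ekt_tree \<omega>) \<partial>count_space UNIV)"
      using AE_shows_tree
    proof eventually_elim
      case (elim \<omega>)
      then show ?case by (intro ekt_sum_eq) blast
    qed
  qed
  also have "\<dots> = (\<integral>\<^sup>+q. (\<integral>\<^sup>+\<omega>. indicator (?B q) (ekt_tree \<omega>) \<partial>E) \<partial>count_space UNIV)"
  proof (rule nn_integral_count_space_nn_integral)
    show "(\<lambda>\<omega>. indicator (?B q) (ekt_tree \<omega>)) \<in> borel_measurable E" for q
      using B by (intro measurable_compose[OF ekt_tree_meas]) auto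
  qed simp
  also have "\<dots> = (\<integral>\<^sup>+q. emeasure bush_law (?B q) \<partial>count_space UNIV)"
  proof (intro nn_integral_cong)
    fix q
    have "(\<integral>\<^sup>+\<omega>. indicator (?B q) (ekt_tree \<omega>) \<partial>E) = (\<integral>\<^sup>+g. indicator (?B q) g \<partial>distr E seq_space ekt_tree)"
      using B by (intro nn_integral_distr[symmetric]) auto
    also have "\<dots> = emeasure bush_law (?B q)" unfolding ekt_tree_law using B by (simp add: sets_bush_law)
    finally show "(\<integral>\<^sup>+\<omega>. indicator (?B q) (ekt_tree \<omega>) \<partial>E) = emeasure bush_law (?B q)" .
  qed
  finally show ?thesis .
qed

lemma ekt_size:
  "(\<integral>\<^sup>+\<omega>. emeasure (count_space UNIV) {u. ekt_vertex \<omega> (0, u)} \<partial>E)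
    = (\<integral>\<^sup>+t. bush_weight t * of_nat (length (post_word t)) \<partial>count_space UNIV)"
proof -
  have U: "UNIV \<in> sets code_space"
  proof -
    have "space code_space = UNIV" by (auto simp: code_space_def space_pair_measure space_PiM)
    then show ?thesis using sets.top[of code_space] by simp
  qed
  have "emeasure (count_space UNIV) {u. ekt_vertex \<omega> (0, u)}
      = (\<integral>\<^sup>+u. indicator UNIV (ekt_code \<omega> (0, u)) \<partial>count_space {u. ekt_vertex \<omega> (0, u)})" for \<omega>
    by (simp add: emeasure_count_space)
  then show ?thesis by (simp only: ekt_integral[OF U] UNIV_I simp_thms nn_integral_bush_law_path)
qed

end

text \<open>Both sides are the same sum over addresses up to normalisation, and the normalisations
  agree because the mean bush size is the reciprocal of 1 - c.\<close>

lemma (in iid_record) record_code_unimod: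
  assumes A: "A \<in> sets code_space"
  shows "emeasure M {\<omega> \<in> space M. record_code (x \<omega>) \<in> A} = unimod_ekt_prob \<alpha> \<beta> A"
proof -
  define D where "D = (\<integral>\<^sup>+t. bush_weight t * of_nat (length (post_word t)) \<partial>count_space UNIV)"
  have D: "ennreal (1 - c) * D = 1" unfolding D_def by (rule bush_size')
  have "D \<noteq> \<top>" using D c_less_1 by (auto simp: ennreal_mult_top)
  then obtain d where d: "D = ennreal d" "0 \<le> d" by (cases D) auto
  have "ennreal ((1 - c) * d) = 1" using D d c_less_1 by (simp add: ennreal_mult)
  then have cd: "(1 - c) * d = 1" by simp
  then have "0 < d" using d by (cases "d = 0") auto
  then have "inverse d = 1 - c" using cd by (intro inverse_unique) (simp add: mult.commute)
  then have "inverse D = ennreal (1 - c)"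
    using \<open>0 < d\<close> by (simp add: d inverse_ennreal)
  then show ?thesis
    unfolding unimod_ekt_prob_def ekt_integral[OF A] ekt_size record_code_prob[OF A] D_def[symmetric]
    by (simp add: divide_ennreal_def mult.commute)
qed

section \<open>Independent identically distributed steps\<close>

lemma pmf_of_prob_space:
  fixes D :: "'b::countable measure"
  assumes "prob_space D" "sets D = UNIV"
  shows "\<exists>p. measure_pmf p = D"
proof -
  interpret prob_space D by fact
  have sp: "space D = UNIV" using sets_eq_imp_space_eq[of D "count_space UNIV"] assms(2) by simp
  define p where "p = embed_pmf (\<lambda>k. measure D {k})"
  have "pmf p k = measure D {k}" for k
    unfolding p_def
  proof (rule pmf_embed_pmf)
    have "(\<integral>\<^sup>+k. ennreal (measure D {k}) \<partial>count_space UNIV) = emeasure D UNIV"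
      by (subst emeasure_countable_singleton) (simp_all add: assms(2) emeasure_eq_measure)
    then show "(\<integral>\<^sup>+k. ennreal (measure D {k}) \<partial>count_space UNIV) = 1"
      using emeasure_space_1 by (simp add: sp)
  qed simp
  then have "measure_pmf p = D"
    by (intro measure_eqI_countable[of _ UNIV])
      (simp_all add: assms(2) emeasure_pmf_single emeasure_eq_measure)
  then show ?thesis by blast
qed

locale iid_steps = prob_space M for M :: "'a measure" +
  fixes X :: "int \<Rightarrow> 'a \<Rightarrow> int"
  assumes indep: "indep_vars (\<lambda>_. count_space UNIV) X UNIV"
    and ident: "\<And>n. distr M (count_space UNIV) (X n) = distr M (count_space UNIV) (X 0)"
    and ge: "\<And>n \<omega>. \<omega> \<in> space M \<Longrightarrow> -1 \<le> X n \<omega>"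
    and pos: "0 < measure M {\<omega> \<in> space M. X 0 \<omega> = -1}"
    and drift: "1 < (\<integral>\<^sup>+\<omega>. ennreal (real_of_int (X 0 \<omega>) + 1) \<partial>M)"
begin

lemma X_measurable [measurable]: "X n \<in> measurable M (count_space UNIV)"
  using indep by (simp add: indep_vars_def)

definition p :: "nat pmf" where
  "p = (SOME p. measure_pmf p = distr M (count_space UNIV) (\<lambda>\<omega>. nat (X 0 \<omega> + 1)))"

lemma shift_measurable [measurable]: "(\<lambda>\<omega>. nat (X 0 \<omega> + 1)) \<in> measurable M (count_space UNIV)"
  by (rule measurable_compose[OF X_measurable]) simp

lemma measure_p: "measure_pmf p = distr M (count_space UNIV) (\<lambda>\<omega>. nat (X 0 \<omega> + 1))"
  unfolding p_def by (rule someI_ex, rule pmf_of_prob_space) (auto intro: prob_space_distr)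

lemma emeasure_p: "emeasure (measure_pmf p) B = emeasure M {\<omega> \<in> space M. nat (X 0 \<omega> + 1) \<in> B}"
  unfolding measure_p by (subst emeasure_distr) (auto simp: vimage_def Int_def conj_commute)

lemma emeasure_p_shift: "emeasure (measure_pmf p) {k. int k - 1 \<in> d} = emeasure M {\<omega> \<in> space M. X 0 \<omega> \<in> d}"
proof -
  have "{\<omega> \<in> space M. nat (X 0 \<omega> + 1) \<in> {k. int k - 1 \<in> d}} = {\<omega> \<in> space M. X 0 \<omega> \<in> d}"
    by (rule Collect_cong, rule conj_cong[OF refl]) (use ge[of _ 0] in fastforce)
  then show ?thesis unfolding emeasure_p by (rule arg_cong)
qed

lemma pmf_p: "pmf p k = measure M {\<omega> \<in> space M. X 0 \<omega> = int k - 1}"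
proof -
  have "ennreal (pmf p k) = emeasure M {\<omega> \<in> space M. nat (X 0 \<omega> + 1) \<in> {k}}"
    by (simp only: emeasure_p[symmetric] emeasure_pmf_single)
  also have "{\<omega> \<in> space M. nat (X 0 \<omega> + 1) \<in> {k}} = {\<omega> \<in> space M. X 0 \<omega> = int k - 1}"
    using ge[of _ 0] by force
  finally show ?thesis by (simp add: emeasure_eq_measure)
qed

lemma prob_p_tail: "measure_pmf.prob p {k<..} = measure M {\<omega> \<in> space M. int k \<le> X 0 \<omega>}"
proof -
  have "ennreal (measure_pmf.prob p {k<..}) = emeasure M {\<omega> \<in> space M. nat (X 0 \<omega> + 1) \<in> {k<..}}"
    by (simp only: emeasure_p[symmetric] measure_pmf.emeasure_eq_measure)
  also have "{\<omega> \<in> space M. nat (X 0 \<omega> + 1) \<in> {k<..}} = {\<omega> \<in> space M. int k \<le> X 0 \<omega>}"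
    by force
  finally show ?thesis by (simp add: emeasure_eq_measure)
qed

sublocale offspring p
proof
  show "0 < pmf p 0" using pos by (simp add: pmf_p)
  have "(\<integral>\<^sup>+k. of_nat k \<partial>measure_pmf p) = (\<integral>\<^sup>+\<omega>. of_nat (nat (X 0 \<omega> + 1)) \<partial>M)"
    unfolding measure_p by (subst nn_integral_distr) auto
  also have "\<dots> = (\<integral>\<^sup>+\<omega>. ennreal (real_of_int (X 0 \<omega>) + 1) \<partial>M)"
  proof (intro nn_integral_cong)
    fix \<omega> assume "\<omega> \<in> space M"
    then have "0 \<le> X 0 \<omega> + 1" using ge[of \<omega> 0] by simp
    then show "of_nat (nat (X 0 \<omega> + 1)) = ennreal (real_of_int (X 0 \<omega>) + 1)"
      by (simp add: ennreal_of_nat_eq_real_of_nat)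
  qed
  finally show "1 < (\<integral>\<^sup>+k. of_nat k \<partial>measure_pmf p)" using drift by simp
qed

text \<open>An arbitrary injective reindexing covers both the sequence itself and its reflection n
  -> -1 - n.\<close>

lemma spells_reindexed_prob:
  assumes e: "inj e"
  shows "emeasure M {\<omega> \<in> space M. spells (\<lambda>n. X (e n) \<omega>) a ds}
    = prod_list (map (\<lambda>d. emeasure (measure_pmf p) {k. int k - 1 \<in> d}) ds)"
proof (cases "ds = []")
  case True
  then show ?thesis using emeasure_space_1 by simp
next
  case False
  let ?f = "\<lambda>k. e (a + int k)"
  let ?J = "?f ` {..<length ds}"
  have f: "inj ?f" by (rule injI) (use injD[OF e] in force)
  define A where "A i = ds ! (inv ?f i)" for i
  have A: "A (?f k) = ds ! k" for k unfolding A_def by (simp add: inv_f_f[OF f])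
  have "{\<omega> \<in> space M. spells (\<lambda>n. X (e n) \<omega>) a ds} = (\<Inter>i\<in>?J. X i -` A i \<inter> space M)"
    using False by (auto simp: spells_iff A)
  also have "emeasure M \<dots> = ennreal (\<Prod>i\<in>?J. prob (X i -` A i \<inter> space M))"
    unfolding emeasure_eq_measure using False
    by (subst indep_varsD[OF indep]) auto
  also have "(\<Prod>i\<in>?J. prob (X i -` A i \<inter> space M)) = (\<Prod>k<length ds. prob (X (?f k) -` (ds ! k) \<inter> space M))"
    using inj_on_subset[OF f] by (subst prod.reindex) (simp_all only: comp_def A subset_UNIV)
  also have "\<dots> = (\<Prod>k<length ds. prob {\<omega> \<in> space M. X 0 \<omega> \<in> ds ! k})"
  proof (rule prod.cong[OF refl])
    fix k
    have "prob (X (?f k) -` (ds ! k) \<inter> space M) = measure (distr M (count_space UNIV) (X (?f k))) (ds ! k)"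
      by (subst measure_distr) auto
    also have "\<dots> = prob (X 0 -` (ds ! k) \<inter> space M)" unfolding ident[of "?f k"] by (subst measure_distr) auto
    finally show "prob (X (?f k) -` (ds ! k) \<inter> space M) = prob {\<omega> \<in> space M. X 0 \<omega> \<in> ds ! k}"
      by (simp add: vimage_def Int_def conj_commute)
  qed
  also have "ennreal \<dots> = (\<Prod>k<length ds. emeasure (measure_pmf p) {j. int j - 1 \<in> ds ! k})"
    by (simp add: prod_ennreal emeasure_p_shift emeasure_eq_measure)
  also have "\<dots> = prod_list (map (\<lambda>d. emeasure (measure_pmf p) {k. int k - 1 \<in> d}) ds)"
    by (simp add: prod.list_conv_set_nth lessThan_atLeast0)
  finally show ?thesis .
qed

sublocale iid_record M p X
proof
  show "emeasure M {\<omega> \<in> space M. spells (\<lambda>n. X n \<omega>) a ds}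
      = prod_list (map (\<lambda>d. emeasure (measure_pmf p) {k. int k - 1 \<in> d}) ds)" for a ds
    using spells_reindexed_prob[of "\<lambda>n. n"] by simp
qed (use ge in auto)

text \<open>Reflection turns the first \<open>n\<close> steps of the walk into the \<open>n\<close>
  steps before 0. Failing to be a left record only asks for some negative sum, but then a tree word
  ends at 0, and its sum is exactly -1.\<close>

lemma walk_hits_iff:
  assumes "\<omega> \<in> space M"
  shows "(\<exists>n. walk_S X n \<omega> = -1) \<longleftrightarrow> \<not> left_record (\<lambda>n. X (-1 - n) \<omega>) 0"
proof -
  let ?y = "\<lambda>n. X (-1 - n) \<omega>"
  have walk: "walk_S X n \<omega> = ysum ?y (- int n) 0" for n
  proof (induction n)
    case (Suc n)
    have "ysum ?y (- int (Suc n)) 0 = ?y (- int (Suc n)) + ysum ?y (- int n) 0"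
      using ysum_add[of "- int (Suc n)" "- int n" 0 ?y] ysum_Suc[of "- int (Suc n)" "- int (Suc n)" ?y] by simp
    then show ?case using Suc by (simp add: walk_S_def)
  qed (simp add: walk_S_def)
  show ?thesis
  proof
    assume "\<exists>n. walk_S X n \<omega> = -1"
    then obtain n where n: "ysum ?y (- int n) 0 = -1" using walk by auto
    then have "n \<noteq> 0" by (intro notI) simp
    with n show "\<not> left_record ?y 0" by (auto simp: left_record_def intro!: exI[of _ "- int n"])
  next
    assume "\<not> left_record ?y 0"
    then obtain t where "spells ?y (0 - int (length (post_word t))) (tree_pattern t)"
      using not_left_record_iff[of ?y 0] ge[OF assms] by blast
    from spells_tree_pattern(1)[OF this] have "walk_S X (length (post_word t)) \<omega> = -1" by (simp add: walk)
    then show "\<exists>n. walk_S X n \<omega> = -1" by blast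
  qed
qed

text \<open>The walk hits \<open>-1\<close> exactly when \<open>0\<close> is not a left record of the reflected sequence.\<close>

lemma hit_c_eq: "hit_c M X = c"
proof -
  interpret R: iid_record M p "\<lambda>n. X (-1 - n)"
    by unfold_locales
      (use ge spells_reindexed_prob[of "\<lambda>n. -1 - n"] in \<open>auto simp: inj_on_def\<close>)
  have "emeasure M {\<omega> \<in> space M. \<exists>n. walk_S X n \<omega> = -1} = emeasure M {\<omega> \<in> space M. \<not> left_record (\<lambda>n. X (-1 - n) \<omega>) 0 \<and> spells (\<lambda>n. X (-1 - n) \<omega>) 0 []}"
    using walk_hits_iff by (intro arg_cong[of _ _ "emeasure M"]) auto
  also have "\<dots> = ennreal c" by (simp only: R.not_left_record_prob R.pr_def C_eq) simp
  finally show ?thesis using c_pos by (simp add: hit_c_def emeasure_eq_measure)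
qed

lemma pmf_\<alpha>_eq: "pmf \<alpha> k = bar_pi M X k"
  by (simp add: pmf_\<alpha> bar_pi_def prob_p_tail hit_c_eq)

lemma pmf_\<beta>_eq: "pmf \<beta> k = tilde_pi M X k"
  using c_pos by (simp add: pmf_\<beta> tilde_pi_def pmf_p hit_c_eq power_int_diff)

lemma unimodularised_ekt:
  "\<exists>\<alpha> \<beta>. (\<forall>k. pmf \<alpha> k = bar_pi M X k) \<and> (\<forall>k. pmf \<beta> k = tilde_pi M X k)
            \<and> (\<integral>\<^sup>+k. of_nat k \<partial>measure_pmf \<alpha>) < \<infinity>
            \<and> (\<integral>\<^sup>+k. of_nat k \<partial>measure_pmf \<beta>) < 1
            \<and> (\<forall>A \<in> sets code_space.
                 emeasure M {\<omega> \<in> space M. record_code (\<lambda>n. X n \<omega>) \<in> A} = unimod_ekt_prob \<alpha> \<beta> A)"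
  using bush_size'(2,3) record_code_unimod
  by (intro exI[of _ \<alpha>] exI[of _ \<beta>])
    (simp add: pmf_\<alpha>_eq pmf_\<beta>_eq m\<alpha>_def m\<beta>_def nn_integral_measure_pmf)

end

theorem theorem4p22:
  fixes M :: "'a measure" and X :: "int \<Rightarrow> 'a \<Rightarrow> int"
  assumes "prob_space M"
    and "prob_space.indep_vars M (\<lambda>_. count_space UNIV) X UNIV"
    and "\<forall>n. distr M (count_space UNIV) (X n) = distr M (count_space UNIV) (X 0)"
    and "\<forall>n. \<forall>\<omega>\<in>space M. X n \<omega> \<ge> -1"
    and "measure M {\<omega> \<in> space M. X 0 \<omega> = -1} > 0"
    and "(\<integral>\<^sup>+\<omega>. ennreal (real_of_int (X 0 \<omega>) + 1) \<partial>M) > 1"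
  shows "\<exists>\<alpha> \<beta>. (\<forall>k. pmf \<alpha> k = bar_pi M X k) \<and> (\<forall>k. pmf \<beta> k = tilde_pi M X k)
            \<and> (\<integral>\<^sup>+k. of_nat k \<partial>measure_pmf \<alpha>) < \<infinity>
            \<and> (\<integral>\<^sup>+k. of_nat k \<partial>measure_pmf \<beta>) < 1
            \<and> (\<forall>A \<in> sets code_space.
                 emeasure M {\<omega> \<in> space M. record_code (\<lambda>n. X n \<omega>) \<in> A} = unimod_ekt_prob \<alpha> \<beta> A)"
proof -
  interpret prob_space M by fact
  interpret iid_steps M X
    by unfold_locales (use assms in auto)
  show ?thesis by (rule unimodularised_ekt)
qed

end
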